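(* Let $f\colon B\to M$ be a smooth map between smooth manifolds and let $L$ be a Dirac structure on $M$ which is transverse to $f$. Consider the pullback Dirac structure $\mathfrak{B}L$ on $B$, viewed as a Lie algebroid over $B$, and the Lie algebroid pullback $f^!L$ of (the Lie algebroid underlying) $L$. There is a canonical isomorphism of Lie algebroids, covering $\mathrm{id}_B$, $$\mathfrak{B}L\cong f^!L.$$
   Context: **Dirac structures.** A Dirac structure on $M$ is a vector subbundle $L\subset TM\oplus T^*M$ which is maximal isotropic for the canonical symmetric pairing and involutive for the Courant bracket $[(X,\xi),(X',\xi')]=([X,X'],\mathcal{L}_X\xi'-\iota_{X'}\mathrm{d}\xi)$. It is a Lie algebroid with anchor $\rho=\mathrm{pr}_{TM}|_L$ and bracket the restriction of the Courant bracket. **Transversality.** $L$ is transverse to $f$ if $\rho(L_{f(x)})+f_*(T_xB)=T_{f(x)}M$ for all $x\in B$. **Pullback Dirac structure.** $\mathfrak{B}L:=\{(X,f^*\eta):X\in T_xB,\ \eta\in T^*_{f(x)}M,\ (f_*X,\eta)\in L_{f(x)},\ x\in B\}\subset TB\oplus T^*B$. When $L$ is transverse to $f$ this is known to be a Dirac structure on $B$. **Pullback Lie algebroid.** For a Lie algebroid $A$ over $M$ with anchor $\rho$, $f^!A:=\{(a,v)\in f^*A\oplus TB:\rho(a)=f_*v\}$. When its fibers over $B$ have constant rank (which holds in the transverse case), it is a vector subbundle of $f^*A\oplus TB$ and a Lie algebroid over $B$ with anchor $(a,v)\mapsto v$. Sections are of the form $(\sum_i h_ia_i,X)$ (finite sum,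 $a_i$ standing for $a_i\circ f$) with $h_i\in C^\infty(B)$, $a_i\in\Gamma(A)$, $X\in\mathfrak{X}(B)$, $f_*X=\sum_ih_i\rho(a_i)$, and the bracket is $$\Big[\big(\textstyle\sum_i h_ia_i,X\big),\big(\sum_j h'_ja'_j,X'\big)\Big]=\Big(\sum_{i,j}h_ih'_j[a_i,a'_j]+\sum_jX(h'_j)a'_j-\sum_iX'(h_i)a_i,\ [X,X']\Big).$$ $f^!L$ denotes this construction applied to the Lie algebroid underlying $L$. *)

theory Defs
  imports "HOL-Analysis.Analysis" "HOL-Library.Function_Algebras"
begin

section \<open>Pointwise real vector space structure on functions\<close>

instantiation "fun" :: (type, real_vector) real_vector
begin

definition scaleR_fun :: "real \<Rightarrow> ('a \<Rightarrow> 'b) \<Rightarrow> 'a \<Rightarrow> 'b" where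
  "scaleR_fun c f = (\<lambda>x. c *\<^sub>R f x)"

instance
  by standard (simp_all add: scaleR_fun_def fun_eq_iff scaleR_add_right scaleR_add_left)

end


section \<open>Smooth manifolds\<close>

text \<open>
  The model space of a manifold is a linear subspace \<open>V\<close> of a Euclidean space, so that every
  dimension, including \<open>0\<close>, occurs.  \<open>Ck_on k V S g\<close> is meant for \<open>S\<close> relatively open in \<open>V\<close>.
  There the derivative within \<open>S\<close> is only determined on vectors of \<open>V\<close>; this is why it is
  quantified existentially and then evaluated on \<open>V\<close> only.
\<close>

primrec Ck_on ::
    "nat \<Rightarrow> 'e::euclidean_space set \<Rightarrow> 'e set \<Rightarrow> ('e \<Rightarrow> 'f::real_normed_vector) \<Rightarrow> bool" where
  "Ck_on 0 V S g \<longleftrightarrow> continuous_on S g"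
| "Ck_on (Suc k) V S g \<longleftrightarrow>
     (\<exists>g'. (\<forall>x\<in>S. (g has_derivative g' x) (at x within S)) \<and>
           (\<forall>v\<in>V. Ck_on k V S (\<lambda>x. g' x v)))"

definition smooth_on ::
    "'e::euclidean_space set \<Rightarrow> 'e set \<Rightarrow> ('e \<Rightarrow> 'f::real_normed_vector) \<Rightarrow> bool" where
  "smooth_on V S g \<longleftrightarrow> (\<forall>k. Ck_on k V S g)"

text \<open>The points of a manifold are all elements of the type \<open>'m\<close>, with its topology.\<close>

record ('m, 'e) manifold =
  model :: "'e set"
  charts :: "('m set \<times> ('m \<Rightarrow> 'e)) set"

definition smooth_manifold ::
    "('m::{t2_space, second_countable_topology}, 'e::euclidean_space) manifold \<Rightarrow> bool" where
  "smooth_manifold M \<longleftrightarrow>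
     subspace (model M) \<and>
     (\<Union>(U, \<phi>)\<in>charts M. U) = UNIV \<and>
     (\<forall>(U, \<phi>)\<in>charts M. open U \<and> openin (top_of_set (model M)) (\<phi> ` U) \<and>
        homeomorphism U (\<phi> ` U) \<phi> (inv_into U \<phi>)) \<and>
     (\<forall>(U, \<phi>)\<in>charts M. \<forall>(W, \<psi>)\<in>charts M.
        smooth_on (model M) (\<phi> ` (U \<inter> W)) (\<psi> \<circ> inv_into U \<phi>))"

definition smooth_map ::
    "('b::topological_space, 'd::euclidean_space) manifold \<Rightarrow>
     ('m::topological_space, 'e::euclidean_space) manifold \<Rightarrow> ('b \<Rightarrow> 'm) \<Rightarrow> bool" where
  "smooth_map B M f \<longleftrightarrow>
     continuous_on UNIV f \<and>
     (\<forall>(U, \<phi>)\<in>charts B. \<forall>(W, \<psi>)\<in>charts M.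
        smooth_on (model B) (\<phi> ` (U \<inter> f -` W)) (\<psi> \<circ> f \<circ> inv_into U \<phi>))"

text \<open>Functions that are smooth on the open subset \<open>W\<close> (with arbitrary values elsewhere).\<close>

definition Cinf_on :: "('m, 'e::euclidean_space) manifold \<Rightarrow> 'm set \<Rightarrow> ('m \<Rightarrow> real) set" where
  "Cinf_on M W =
     {g. \<forall>(U, \<phi>)\<in>charts M. smooth_on (model M) (\<phi> ` (U \<inter> W)) (g \<circ> inv_into U \<phi>)}"

abbreviation Cinf :: "('m, 'e::euclidean_space) manifold \<Rightarrow> ('m \<Rightarrow> real) set" where
  "Cinf M \<equiv> Cinf_on M UNIV"


section \<open>Tangent and cotangent vectors, vector fields and forms\<close>

text \<open>
  Tangent vectors are derivations of \<open>Cinf M\<close>, and covectors are linear functionals on the tangent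
  space.  Both are extended by \<open>0\<close>, so that equality in the function type is equality of
  (co)vectors.
\<close>

type_synonym 'm tvec = "('m \<Rightarrow> real) \<Rightarrow> real"
type_synonym 'm cotvec = "'m tvec \<Rightarrow> real"

definition tangent :: "('m, 'e::euclidean_space) manifold \<Rightarrow> 'm \<Rightarrow> 'm tvec set" where
  "tangent M x =
     {v. (\<forall>g\<in>Cinf M. \<forall>h\<in>Cinf M. \<forall>a b. v (\<lambda>y. a * g y + b * h y) = a * v g + b * v h) \<and>
         (\<forall>g\<in>Cinf M. \<forall>h\<in>Cinf M. v (\<lambda>y. g y * h y) = g x * v h + h x * v g) \<and>
         (\<forall>g. g \<notin> Cinf M \<longrightarrow> v g = 0)}"

definition cotangent :: "('m, 'e::euclidean_space) manifold \<Rightarrow> 'm \<Rightarrow> 'm cotvec set" where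
  "cotangent M x =
     {\<xi>. (\<forall>v\<in>tangent M x. \<forall>w\<in>tangent M x. \<forall>a b. \<xi> (a *\<^sub>R v + b *\<^sub>R w) = a * \<xi> v + b * \<xi> w) \<and>
         (\<forall>v. v \<notin> tangent M x \<longrightarrow> \<xi> v = 0)}"

definition pushforward ::
    "('m, 'e::euclidean_space) manifold \<Rightarrow> ('b \<Rightarrow> 'm) \<Rightarrow> 'b tvec \<Rightarrow> 'm tvec" where
  "pushforward M f v = (\<lambda>g. if g \<in> Cinf M then v (g \<circ> f) else 0)"

definition pullback_cov ::
    "('b, 'd::euclidean_space) manifold \<Rightarrow> ('m, 'e::euclidean_space) manifold \<Rightarrow> ('b \<Rightarrow> 'm) \<Rightarrow>
     'b \<Rightarrow> 'm cotvec \<Rightarrow> 'b cotvec" where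
  "pullback_cov B M f x \<eta> = (\<lambda>v. if v \<in> tangent B x then \<eta> (pushforward M f v) else 0)"

definition vfields :: "('m, 'e::euclidean_space) manifold \<Rightarrow> ('m \<Rightarrow> 'm tvec) set" where
  "vfields M = {X. (\<forall>x. X x \<in> tangent M x) \<and> (\<forall>g\<in>Cinf M. (\<lambda>x. X x g) \<in> Cinf M)}"

definition forms :: "('m, 'e::euclidean_space) manifold \<Rightarrow> ('m \<Rightarrow> 'm cotvec) set" where
  "forms M = {\<xi>. (\<forall>x. \<xi> x \<in> cotangent M x) \<and> (\<forall>X\<in>vfields M. (\<lambda>x. \<xi> x (X x)) \<in> Cinf M)}"

definition vf_bracket :: "('m \<Rightarrow> 'm tvec) \<Rightarrow> ('m \<Rightarrow> 'm tvec) \<Rightarrow> 'm \<Rightarrow> 'm tvec" where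
  "vf_bracket X Y = (\<lambda>x g. X x (\<lambda>y. Y y g) - Y x (\<lambda>y. X y g))"

definition extension :: "('m, 'e::euclidean_space) manifold \<Rightarrow> 'm \<Rightarrow> 'm tvec \<Rightarrow> 'm \<Rightarrow> 'm tvec" where
  "extension M x v = (SOME X. X \<in> vfields M \<and> X x = v)"

text \<open>
  The two definitions below are the usual formulas
  \<open>(\<L>\<^sub>X \<xi>)(Z) = X(\<xi>(Z)) - \<xi>([X,Z])\<close> and
  \<open>d\<xi>(V,W) = V(\<xi>(W)) - W(\<xi>(V)) - \<xi>([V,W])\<close>, whose values at \<open>x\<close> depend only on the
  values of \<open>Z\<close>, \<open>V\<close> and \<open>W\<close> at \<open>x\<close>.
\<close>

definition lie_derivative ::
    "('m, 'e::euclidean_space) manifold \<Rightarrow> ('m \<Rightarrow> 'm tvec) \<Rightarrow> ('m \<Rightarrow> 'm cotvec) \<Rightarrow> 'm \<Rightarrow> 'm cotvec"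
where
  "lie_derivative M X \<xi> = (\<lambda>x v.
     if v \<in> tangent M x
     then let Z = extension M x v in X x (\<lambda>y. \<xi> y (Z y)) - \<xi> x (vf_bracket X Z x)
     else 0)"

definition ext_derivative ::
    "('m, 'e::euclidean_space) manifold \<Rightarrow> ('m \<Rightarrow> 'm cotvec) \<Rightarrow> 'm \<Rightarrow> 'm tvec \<Rightarrow> 'm tvec \<Rightarrow> real"
where
  "ext_derivative M \<xi> = (\<lambda>x v w.
     if v \<in> tangent M x \<and> w \<in> tangent M x
     then let V = extension M x v; W = extension M x w
          in v (\<lambda>y. \<xi> y (W y)) - w (\<lambda>y. \<xi> y (V y)) - \<xi> x (vf_bracket V W x)
     else 0)"


section \<open>Vector bundles\<close>

text \<open>
  A vector bundle is given by its fibres \<open>F x\<close>, which are subspaces of an ambient vector space, and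
  its set \<open>\<Gamma>\<close> of smooth global sections.  Since local sections can be cut off, it suffices to
  consider local frames that consist of restrictions of global sections.
\<close>

definition local_frame ::
    "('m::topological_space \<Rightarrow> 'a::real_vector set) \<Rightarrow> ('m \<Rightarrow> 'a) set \<Rightarrow> nat \<Rightarrow> 'm set \<Rightarrow>
     (nat \<Rightarrow> 'm \<Rightarrow> 'a) \<Rightarrow> bool" where
  "local_frame F \<Gamma> r U e \<longleftrightarrow>
     open U \<and> (\<forall>i<r. e i \<in> \<Gamma>) \<and>
     (\<forall>x\<in>U. inj_on (\<lambda>i. e i x) {..<r} \<and> independent ((\<lambda>i. e i x) ` {..<r}) \<and>
             span ((\<lambda>i. e i x) ` {..<r}) = F x)"

definition vector_bundle ::
    "('m::topological_space, 'e::euclidean_space) manifold \<Rightarrow> ('m \<Rightarrow> 'a::real_vector set) \<Rightarrow>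
     ('m \<Rightarrow> 'a) set \<Rightarrow> bool" where
  "vector_bundle M F \<Gamma> \<longleftrightarrow>
     (\<exists>r. (\<forall>x. \<exists>U e. x \<in> U \<and> local_frame F \<Gamma> r U e) \<and>
          (\<forall>s. s \<in> \<Gamma> \<longleftrightarrow>
             (\<forall>x. s x \<in> F x) \<and>
             (\<forall>U e. local_frame F \<Gamma> r U e \<longrightarrow>
                (\<exists>c. (\<forall>i<r. c i \<in> Cinf_on M U) \<and>
                     (\<forall>x\<in>U. s x = (\<Sum>i<r. c i x *\<^sub>R e i x))))))"


section \<open>Lie algebroids\<close>

text \<open>Only the values of \<open>bracket\<close> on pairs of smooth sections are meaningful.\<close>

record ('m, 'a) lie_algebroid_data =
  fibre :: "'m \<Rightarrow> 'a set"
  sections :: "('m \<Rightarrow> 'a) set"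
  anchor :: "'m \<Rightarrow> 'a \<Rightarrow> 'm tvec"
  bracket :: "('m \<Rightarrow> 'a) \<Rightarrow> ('m \<Rightarrow> 'a) \<Rightarrow> 'm \<Rightarrow> 'a"

definition linear_between ::
    "'a::real_vector set \<Rightarrow> 'b::real_vector set \<Rightarrow> ('a \<Rightarrow> 'b) \<Rightarrow> bool" where
  "linear_between S T \<phi> \<longleftrightarrow>
     \<phi> ` S \<subseteq> T \<and> (\<forall>u\<in>S. \<forall>v\<in>S. \<forall>a b. \<phi> (a *\<^sub>R u + b *\<^sub>R v) = a *\<^sub>R \<phi> u + b *\<^sub>R \<phi> v)"

definition lie_algebroid ::
    "('m::topological_space, 'e::euclidean_space) manifold \<Rightarrow>
     ('m, 'a::real_vector) lie_algebroid_data \<Rightarrow> bool" where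
  "lie_algebroid M A \<longleftrightarrow>
     vector_bundle M (fibre A) (sections A) \<and>
     (\<forall>x. linear_between (fibre A x) (tangent M x) (anchor A x)) \<and>
     (\<forall>s\<in>sections A. (\<lambda>x. anchor A x (s x)) \<in> vfields M) \<and>
     (\<forall>s\<in>sections A. \<forall>t\<in>sections A. bracket A s t \<in> sections A) \<and>
     (\<forall>s\<in>sections A. \<forall>t\<in>sections A. \<forall>u\<in>sections A. \<forall>a b.
        bracket A (a *\<^sub>R s + b *\<^sub>R t) u = a *\<^sub>R bracket A s u + b *\<^sub>R bracket A t u) \<and>
     (\<forall>s\<in>sections A. \<forall>t\<in>sections A. bracket A s t = - bracket A t s) \<and>
     (\<forall>s\<in>sections A. \<forall>t\<in>sections A. \<forall>u\<in>sections A.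
        bracket A s (bracket A t u) + bracket A t (bracket A u s) + bracket A u (bracket A s t) = 0) \<and>
     (\<forall>s\<in>sections A. \<forall>t\<in>sections A. \<forall>h\<in>Cinf M.
        bracket A s (\<lambda>x. h x *\<^sub>R t x) =
          (\<lambda>x. h x *\<^sub>R bracket A s t x + anchor A x (s x) h *\<^sub>R t x))"

text \<open>
  Morphisms covering the identity.  A fibrewise linear map is a smooth bundle map iff it maps smooth
  sections to smooth sections.
\<close>

definition lie_algebroid_hom ::
    "('m, 'a::real_vector) lie_algebroid_data \<Rightarrow> ('m, 'b::real_vector) lie_algebroid_data \<Rightarrow>
     ('m \<Rightarrow> 'a \<Rightarrow> 'b) \<Rightarrow> bool" where
  "lie_algebroid_hom A A' \<Phi> \<longleftrightarrow>
     (\<forall>x. linear_between (fibre A x) (fibre A' x) (\<Phi> x)) \<and>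
     (\<forall>s\<in>sections A. (\<lambda>x. \<Phi> x (s x)) \<in> sections A') \<and>
     (\<forall>x. \<forall>a\<in>fibre A x. anchor A' x (\<Phi> x a) = anchor A x a) \<and>
     (\<forall>s\<in>sections A. \<forall>t\<in>sections A.
        (\<lambda>x. \<Phi> x (bracket A s t x)) = bracket A' (\<lambda>x. \<Phi> x (s x)) (\<lambda>x. \<Phi> x (t x)))"

definition lie_algebroid_iso ::
    "('m::topological_space, 'e::euclidean_space) manifold \<Rightarrow>
     ('m, 'a::real_vector) lie_algebroid_data \<Rightarrow> ('m, 'b::real_vector) lie_algebroid_data \<Rightarrow>
     ('m \<Rightarrow> 'a \<Rightarrow> 'b) \<Rightarrow> bool" where
  "lie_algebroid_iso M A A' \<Phi> \<longleftrightarrow>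
     lie_algebroid M A \<and> lie_algebroid M A' \<and> lie_algebroid_hom A A' \<Phi> \<and>
     (\<exists>\<Psi>. lie_algebroid_hom A' A \<Psi> \<and>
          (\<forall>x. (\<forall>a\<in>fibre A x. \<Psi> x (\<Phi> x a) = a) \<and> (\<forall>a'\<in>fibre A' x. \<Phi> x (\<Psi> x a') = a')))"


section \<open>Dirac structures\<close>

definition gen_tangent ::
    "('m, 'e::euclidean_space) manifold \<Rightarrow> 'm \<Rightarrow> ('m tvec \<times> 'm cotvec) set" where
  "gen_tangent M x = tangent M x \<times> cotangent M x"

definition gen_sections ::
    "('m, 'e::euclidean_space) manifold \<Rightarrow> ('m \<Rightarrow> 'm tvec \<times> 'm cotvec) set" where
  "gen_sections M = {s. fst \<circ> s \<in> vfields M \<and> snd \<circ> s \<in> forms M}"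

definition pairing :: "'m tvec \<times> 'm cotvec \<Rightarrow> 'm tvec \<times> 'm cotvec \<Rightarrow> real" where
  "pairing a a' = snd a (fst a') + snd a' (fst a)"

definition courant ::
    "('m, 'e::euclidean_space) manifold \<Rightarrow> ('m \<Rightarrow> 'm tvec \<times> 'm cotvec) \<Rightarrow>
     ('m \<Rightarrow> 'm tvec \<times> 'm cotvec) \<Rightarrow> 'm \<Rightarrow> 'm tvec \<times> 'm cotvec" where
  "courant M s s' =
     (let X = fst \<circ> s; \<xi> = snd \<circ> s; X' = fst \<circ> s'; \<xi>' = snd \<circ> s'
      in (\<lambda>x. (vf_bracket X X' x,
                \<lambda>v. lie_derivative M X \<xi>' x v - ext_derivative M \<xi> x (X' x) v)))"

definition isotropic :: "('m tvec \<times> 'm cotvec) set \<Rightarrow> bool" where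
  "isotropic S \<longleftrightarrow> (\<forall>a\<in>S. \<forall>b\<in>S. pairing a b = 0)"

definition maximal_isotropic ::
    "('m, 'e::euclidean_space) manifold \<Rightarrow> 'm \<Rightarrow> ('m tvec \<times> 'm cotvec) set \<Rightarrow> bool" where
  "maximal_isotropic M x S \<longleftrightarrow>
     subspace S \<and> S \<subseteq> gen_tangent M x \<and> isotropic S \<and>
     (\<forall>T. subspace T \<and> T \<subseteq> gen_tangent M x \<and> isotropic T \<and> S \<subseteq> T \<longrightarrow> T = S)"

definition dirac_sections ::
    "('m, 'e::euclidean_space) manifold \<Rightarrow> ('m \<Rightarrow> ('m tvec \<times> 'm cotvec) set) \<Rightarrow>
     ('m \<Rightarrow> 'm tvec \<times> 'm cotvec) set" where
  "dirac_sections M L = {s \<in> gen_sections M. \<forall>x. s x \<in> L x}"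

definition dirac_structure ::
    "('m::topological_space, 'e::euclidean_space) manifold \<Rightarrow>
     ('m \<Rightarrow> ('m tvec \<times> 'm cotvec) set) \<Rightarrow> bool" where
  "dirac_structure M L \<longleftrightarrow>
     vector_bundle M L (dirac_sections M L) \<and>
     (\<forall>x. maximal_isotropic M x (L x)) \<and>
     (\<forall>s\<in>dirac_sections M L. \<forall>s'\<in>dirac_sections M L. courant M s s' \<in> dirac_sections M L)"

definition dirac_algebroid ::
    "('m, 'e::euclidean_space) manifold \<Rightarrow> ('m \<Rightarrow> ('m tvec \<times> 'm cotvec) set) \<Rightarrow>
     ('m, 'm tvec \<times> 'm cotvec) lie_algebroid_data" where
  "dirac_algebroid M L =
     \<lparr>fibre = L, sections = dirac_sections M L, anchor = (\<lambda>x. fst), bracket = courant M\<rparr>"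

definition transverse ::
    "('b, 'd::euclidean_space) manifold \<Rightarrow> ('m, 'e::euclidean_space) manifold \<Rightarrow> ('b \<Rightarrow> 'm) \<Rightarrow>
     ('m \<Rightarrow> ('m tvec \<times> 'm cotvec) set) \<Rightarrow> bool" where
  "transverse B M f L \<longleftrightarrow>
     (\<forall>x. {u + w |u w. u \<in> fst ` L (f x) \<and> w \<in> pushforward M f ` tangent B x} = tangent M (f x))"

definition pullback_dirac ::
    "('b, 'd::euclidean_space) manifold \<Rightarrow> ('m, 'e::euclidean_space) manifold \<Rightarrow> ('b \<Rightarrow> 'm) \<Rightarrow>
     ('m \<Rightarrow> ('m tvec \<times> 'm cotvec) set) \<Rightarrow> 'b \<Rightarrow> ('b tvec \<times> 'b cotvec) set" where
  "pullback_dirac B M f L x =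
     {(v, pullback_cov B M f x \<eta>) |v \<eta>.
        v \<in> tangent B x \<and> \<eta> \<in> cotangent M (f x) \<and> (pushforward M f v, \<eta>) \<in> L (f x)}"


section \<open>Pullback of Lie algebroids\<close>

text \<open>
  \<open>presented_near B A f x \<sigma> n h a\<close>: near \<open>x\<close>, the section \<open>\<sigma>\<close> of \<open>f\<^sup>*A\<close> is the
  finite sum of the \<open>h\<^sub>i (a\<^sub>i \<circ> f)\<close>.  Smoothness of \<open>\<sigma>\<close> and the bracket on \<open>f\<^sup>!A\<close> are local, so
  such presentations are only required near each point; a global presentation is one near every
  point, and then the bracket below is given by the usual global formula.
\<close>

definition presented_near ::
    "('b::topological_space, 'd::euclidean_space) manifold \<Rightarrow>
     ('m, 'a::real_vector) lie_algebroid_data \<Rightarrow> ('b \<Rightarrow> 'm) \<Rightarrow> 'b \<Rightarrow> ('b \<Rightarrow> 'a) \<Rightarrow>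
     nat \<Rightarrow> (nat \<Rightarrow> 'b \<Rightarrow> real) \<Rightarrow> (nat \<Rightarrow> 'm \<Rightarrow> 'a) \<Rightarrow> bool" where
  "presented_near B A f x \<sigma> n h a \<longleftrightarrow>
     (\<forall>i<n. h i \<in> Cinf B \<and> a i \<in> sections A) \<and>
     (\<exists>U. open U \<and> x \<in> U \<and> (\<forall>y\<in>U. \<sigma> y = (\<Sum>i<n. h i y *\<^sub>R a i (f y))))"

definition pullback_fibre ::
    "('b, 'd::euclidean_space) manifold \<Rightarrow> ('m, 'e::euclidean_space) manifold \<Rightarrow> ('b \<Rightarrow> 'm) \<Rightarrow>
     ('m, 'a::real_vector) lie_algebroid_data \<Rightarrow> 'b \<Rightarrow> ('a \<times> 'b tvec) set" where
  "pullback_fibre B M f A x =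
     {(a, v). a \<in> fibre A (f x) \<and> v \<in> tangent B x \<and> anchor A (f x) a = pushforward M f v}"

definition pullback_sections ::
    "('b::topological_space, 'd::euclidean_space) manifold \<Rightarrow>
     ('m, 'e::euclidean_space) manifold \<Rightarrow> ('b \<Rightarrow> 'm) \<Rightarrow>
     ('m, 'a::real_vector) lie_algebroid_data \<Rightarrow> ('b \<Rightarrow> 'a \<times> 'b tvec) set" where
  "pullback_sections B M f A =
     {s. (\<forall>x. s x \<in> pullback_fibre B M f A x) \<and>
         (\<forall>x. \<exists>n h a. presented_near B A f x (fst \<circ> s) n h a) \<and>
         snd \<circ> s \<in> vfields B}"

definition pullback_bracket ::
    "('b::topological_space, 'd::euclidean_space) manifold \<Rightarrow> ('b \<Rightarrow> 'm) \<Rightarrow>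
     ('m, 'a::real_vector) lie_algebroid_data \<Rightarrow> ('b \<Rightarrow> 'a \<times> 'b tvec) \<Rightarrow>
     ('b \<Rightarrow> 'a \<times> 'b tvec) \<Rightarrow> 'b \<Rightarrow> 'a \<times> 'b tvec" where
  "pullback_bracket B f A s s' = (\<lambda>x. THE w.
     \<exists>n h a n' h' a'.
       presented_near B A f x (fst \<circ> s) n h a \<and>
       presented_near B A f x (fst \<circ> s') n' h' a' \<and>
       w = ((\<Sum>i<n. \<Sum>j<n'. (h i x * h' j x) *\<^sub>R bracket A (a i) (a' j) (f x))
              + (\<Sum>j<n'. snd (s x) (h' j) *\<^sub>R a' j (f x))
              - (\<Sum>i<n. snd (s' x) (h i) *\<^sub>R a i (f x)),
            vf_bracket (snd \<circ> s) (snd \<circ> s') x))"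

definition pullback_algebroid ::
    "('b::topological_space, 'd::euclidean_space) manifold \<Rightarrow>
     ('m, 'e::euclidean_space) manifold \<Rightarrow> ('b \<Rightarrow> 'm) \<Rightarrow>
     ('m, 'a::real_vector) lie_algebroid_data \<Rightarrow> ('b, 'a \<times> 'b tvec) lie_algebroid_data" where
  "pullback_algebroid B M f A =
     \<lparr>fibre = pullback_fibre B M f A, sections = pullback_sections B M f A,
      anchor = (\<lambda>x. snd), bracket = pullback_bracket B f A\<rparr>"

end

theory Submission
  imports Defs
begin

text \<open>
  The map \<open>((w, \<eta>), v) \<mapsto> (v, f\<^sup>*\<eta>)\<close> sends \<open>f\<^sup>!L\<close> onto \<open>BL\<close>, and isotropy together with transversality
  makes it injective on fibres; its inverse is the isomorphism.  Fibrewise \<open>f\<^sup>!L\<close> is the kernel of the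
  surjection \<open>L \<oplus> TB \<rightarrow> TM\<close>, \<open>((w, \<eta>), v) \<mapsto> w - f\<^sub>*v\<close>, so Gaussian elimination yields smooth local frames of it
  and hence of \<open>BL\<close>.  Computing with forms \<open>\<Sum> p dq\<close>, every presentation of two sections
  of \<open>f\<^sup>!L\<close> produces, by the bracket formula, the element lying over the Courant bracket of their images.
  Thus the bracket of \<open>f\<^sup>!L\<close> is well defined and corresponds to the Courant bracket on \<open>BL\<close>, \<open>BL\<close> is
  involutive, and the algebroid axioms, which hold for the Courant bracket on any involutive isotropic
  bundle, carry over to \<open>f\<^sup>!L\<close>.
\<close>

section \<open>Smooth functions on open subsets of the model space\<close>

text \<open>The data come without coordinates: tangent vectors are derivations of global functions,
  forms are tested on global vector fields, and the fibres of a bundle lie in function spaces with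
  no smooth structure. Hence cut-offs and Hadamard's lemma are needed before even TM has a local
  frame, and smoothness of coefficients is detected by applying linear functionals and solving
  linear systems.

  Two notions of smooth section have to be matched: on BL a section is smooth if its evaluations
  are, on f^!L if its L-part is locally a combination of sections a_i o f. Passing from the second
  to the first is easy, since forms pull back. The converse is the hard direction; for it the frames
  of f^!L are built with explicit presentations by one family of sections that frames L near f(x).

  The bracket of f^!L is a definite description over all pairs of presentations. Their coefficients
  are far from unique, so two presentations are never compared with each other; each is compared
  with the Courant bracket on B, which knows nothing of presentations.\<close>

definition dir_deriv :: "'e::euclidean_space \<Rightarrow> ('e \<Rightarrow> 'f::real_normed_vector) \<Rightarrow> 'e \<Rightarrow> 'f" where
  "dir_deriv v g x = vector_derivative (\<lambda>t. g (x + t *\<^sub>R v)) (at 0)"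

text \<open>Relative openness keeps x + t v inside S for small t when v lies in V, so the derivative
  within S restricts to a one-variable derivative at 0. In particular any two derivatives within S
  agree on V, which makes \<open>dir_deriv\<close> a canonical choice for the existential one in
  \<open>Ck_on\<close>.\<close>

lemma dir_deriv_eq:
  assumes V: "subspace V" and S: "openin (top_of_set V) S" and x: "x \<in> S" and v: "v \<in> V"
    and A: "(g has_derivative A) (at x within S)"
  shows "dir_deriv v g x = A v"
proof -
  obtain O' where O': "open O'" "S = V \<inter> O'" using S by (auto simp: openin_open)
  define T where "T = (\<lambda>t. x + t *\<^sub>R v) -` O'"
  have oT: "open T" unfolding T_def
    by (intro open_vimage O' continuous_intros)
  have 0: "0 \<in> T" using x O' by (auto simp: T_def)
  have sub: "(\<lambda>t. x + t *\<^sub>R v) ` T \<subseteq> S"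
    using V v x by (auto simp: O' T_def subspace_add subspace_mul)
  have d1: "((\<lambda>t. x + t *\<^sub>R v) has_derivative (\<lambda>t. t *\<^sub>R v)) (at 0 within T)"
    by (auto intro!: derivative_eq_intros)
  have "(g has_derivative A) (at (x + 0 *\<^sub>R v) within (\<lambda>t. x + t *\<^sub>R v) ` T)"
    using has_derivative_subset[OF A sub] by simp
  from has_derivative_in_compose[OF d1 this]
  have "((\<lambda>t. g (x + t *\<^sub>R v)) has_derivative (\<lambda>t. A (t *\<^sub>R v))) (at 0 within T)" .
  then have "((\<lambda>t. g (x + t *\<^sub>R v)) has_derivative (\<lambda>t. A (t *\<^sub>R v))) (at 0)"
    using at_within_open[OF 0 oT] by simp
  moreover have "A (t *\<^sub>R v) = t *\<^sub>R A v" for t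
    using A by (simp add: has_derivative_def bounded_linear.linear linear_cmul)
  ultimately have "((\<lambda>t. g (x + t *\<^sub>R v)) has_vector_derivative A v) (at 0)"
    by (simp add: has_vector_derivative_def)
  then show ?thesis unfolding dir_deriv_def by (rule vector_derivative_at)
qed

section \<open>Maps of class C^k on relatively open subsets of a subspace\<close>

lemma Ck_on_SucE:
  assumes "Ck_on (Suc k) V S g"
  obtains g' where "\<And>x. x \<in> S \<Longrightarrow> (g has_derivative g' x) (at x within S)"
    "\<And>v. v \<in> V \<Longrightarrow> Ck_on k V S (\<lambda>x. g' x v)"
  using assms by auto

lemma Ck_on_SucI:
  assumes "\<And>x. x \<in> S \<Longrightarrow> (g has_derivative g' x) (at x within S)"
    "\<And>v. v \<in> V \<Longrightarrow> Ck_on k V S (\<lambda>x. g' x v)"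
  shows "Ck_on (Suc k) V S g"
  using assms by auto

lemma Ck_on_cong:
  assumes "\<And>x. x \<in> S \<Longrightarrow> g x = h x"
  shows "Ck_on k V S g \<longleftrightarrow> Ck_on k V S h"
proof (cases k)
  case 0
  then show ?thesis using assms by (simp cong: continuous_on_cong)
next
  case (Suc n)
  have "(g has_derivative A) (at x within S) \<longleftrightarrow> (h has_derivative A) (at x within S)" if "x \<in> S" for x A
    using that assms by (metis has_derivative_transform)
  then show ?thesis unfolding Suc by simp
qed

text \<open>Derivatives chosen on different sets need not fit together, whereas
  \<open>dir_deriv\<close> does not refer to S at all. In this form the class C^k is seen to be
  local, and directional derivatives of smooth maps are seen to be smooth.\<close>

lemma Ck_on_Suc_iff:
  assumes V: "subspace V" and S: "openin (top_of_set V) S"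
  shows "Ck_on (Suc k) V S g \<longleftrightarrow>
    (\<forall>x\<in>S. g differentiable (at x within S)) \<and> (\<forall>v\<in>V. Ck_on k V S (dir_deriv v g))"
proof
  assume "Ck_on (Suc k) V S g"
  then obtain g' where g': "\<And>x. x \<in> S \<Longrightarrow> (g has_derivative g' x) (at x within S)"
    "\<And>v. v \<in> V \<Longrightarrow> Ck_on k V S (\<lambda>x. g' x v)" by auto
  have "Ck_on k V S (dir_deriv v g)" if "v \<in> V" for v
    using g'(2)[OF that] Ck_on_cong[of S "dir_deriv v g" "\<lambda>x. g' x v"] dir_deriv_eq[OF V S _ that g'(1)]
    by metis
  then show "(\<forall>x\<in>S. g differentiable (at x within S)) \<and> (\<forall>v\<in>V. Ck_on k V S (dir_deriv v g))"
    using g'(1) by (auto simp: differentiable_def)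
next
  assume r: "(\<forall>x\<in>S. g differentiable (at x within S)) \<and> (\<forall>v\<in>V. Ck_on k V S (dir_deriv v g))"
  then obtain g' where g': "\<And>x. x \<in> S \<Longrightarrow> (g has_derivative g' x) (at x within S)"
    unfolding differentiable_def by metis
  have "Ck_on k V S (\<lambda>x. g' x v)" if "v \<in> V" for v
    using r that Ck_on_cong[of S "dir_deriv v g" "\<lambda>x. g' x v"] dir_deriv_eq[OF V S _ that g'(1)]
    by metis
  with g' show "Ck_on (Suc k) V S g" by auto
qed

lemma Ck_on_Suc_D: "Ck_on (Suc k) V S g \<Longrightarrow> Ck_on k V S g"
proof (induction k arbitrary: g)
  case 0
  then show ?case
    by (auto simp: continuous_on_eq_continuous_within intro: has_derivative_continuous)
next
  case (Suc k)
  obtain g' where g': "\<And>x. x \<in> S \<Longrightarrow> (g has_derivative g' x) (at x within S)"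
    "\<And>v. v \<in> V \<Longrightarrow> Ck_on (Suc k) V S (\<lambda>x. g' x v)" using Ck_on_SucE[OF Suc.prems] by blast
  then have "\<And>v. v \<in> V \<Longrightarrow> Ck_on k V S (\<lambda>x. g' x v)" using Suc.IH by blast
  with g'(1) show ?case by (rule Ck_on_SucI)
qed

lemma Ck_on_subset:
  assumes "T \<subseteq> S"
  shows "Ck_on k V S g \<Longrightarrow> Ck_on k V T g"
proof (induction k arbitrary: g)
  case 0
  then show ?case using assms continuous_on_subset by auto
next
  case (Suc k)
  then obtain g' where "\<And>x. x \<in> S \<Longrightarrow> (g has_derivative g' x) (at x within S)"
    "\<And>v. v \<in> V \<Longrightarrow> Ck_on k V S (\<lambda>x. g' x v)" by auto
  then have "\<And>x. x \<in> T \<Longrightarrow> (g has_derivative g' x) (at x within T)"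
    "\<And>v. v \<in> V \<Longrightarrow> Ck_on k V T (\<lambda>x. g' x v)"
    using Suc.IH assms has_derivative_subset by blast+
  then show ?case by (rule Ck_on_SucI)
qed

lemma at_within_openin:
  assumes "openin (top_of_set S) T" "x \<in> T"
  shows "at x within T = at x within S"
proof -
  obtain O' where "open O'" "T = S \<inter> O'" using assms by (auto simp: openin_open)
  then show ?thesis using assms by (intro at_within_nhd[of x O']) auto
qed

text \<open>Near each point the filter within T is the one within S, so differentiability carries
  over; the induction goes through because the \<open>dir_deriv\<close> found on the various T are
  restrictions of one function.\<close>

lemma Ck_on_local:
  assumes V: "subspace V" and S: "openin (top_of_set V) S"
    and loc: "\<And>x. x \<in> S \<Longrightarrow> \<exists>T. openin (top_of_set V) T \<and> x \<in> T \<and> T \<subseteq> S \<and> Ck_on k V T g"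
  shows "Ck_on k V S g"
  using loc
proof (induction k arbitrary: g)
  case 0
  have "continuous (at x within S) g" if x: "x \<in> S" for x
  proof -
    obtain T where T: "openin (top_of_set V) T" "x \<in> T" "T \<subseteq> S" "continuous_on T g"
      using 0[OF x] by auto
    have "at x within T = at x within S"
      using at_within_openin[OF T(1,2)] at_within_openin[OF S x] by simp
    then show ?thesis using T by (metis continuous_on_eq_continuous_within)
  qed
  then show ?case by (simp add: continuous_on_eq_continuous_within)
next
  case (Suc k)
  have "g differentiable (at x within S) \<and>
      (\<exists>T. openin (top_of_set V) T \<and> x \<in> T \<and> T \<subseteq> S \<and> (\<forall>v\<in>V. Ck_on k V T (dir_deriv v g)))"
    if x: "x \<in> S" for x
  proof -
    obtain T where T: "openin (top_of_set V) T" "x \<in> T" "T \<subseteq> S" "Ck_on (Suc k) V T g"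
      using Suc.prems[OF x] by auto
    have "at x within T = at x within S"
      using at_within_openin[OF T(1,2)] at_within_openin[OF S x] by simp
    then show ?thesis using T Ck_on_Suc_iff[OF V T(1)] by metis
  qed
  then show ?case unfolding Ck_on_Suc_iff[OF V S] using Suc.IH by meson
qed

lemma Ck_on_const: "Ck_on k V S (\<lambda>x. c)"
proof (induction k arbitrary: c)
  case (Suc k)
  have "\<forall>x\<in>S. ((\<lambda>x. c) has_derivative (\<lambda>_. 0)) (at x within S)" by simp
  then show ?case using Suc by (auto intro!: exI[of _ "\<lambda>_ _. 0"])
qed simp

lemma Ck_on_add: "Ck_on k V S g \<Longrightarrow> Ck_on k V S h \<Longrightarrow> Ck_on k V S (\<lambda>x. g x + h x)"
proof (induction k arbitrary: g h)
  case 0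
  then show ?case by (auto intro: continuous_intros)
next
  case (Suc k)
  obtain g' where g':
    "\<And>x. x \<in> S \<Longrightarrow> (g has_derivative g' x) (at x within S)" "\<And>v. v \<in> V \<Longrightarrow> Ck_on k V S (\<lambda>x. g' x v)"
    using Ck_on_SucE[OF Suc.prems(1)] by blast
  obtain h' where h':
    "\<And>x. x \<in> S \<Longrightarrow> (h has_derivative h' x) (at x within S)" "\<And>v. v \<in> V \<Longrightarrow> Ck_on k V S (\<lambda>x. h' x v)"
    using Ck_on_SucE[OF Suc.prems(2)] by blast
  show ?case
    by (rule Ck_on_SucI[where g' = "\<lambda>x v. g' x v + h' x v"]) (intro has_derivative_add Suc.IH g' h'; assumption)+
qed

lemma Ck_on_sum: "finite I \<Longrightarrow> (\<And>i. i \<in> I \<Longrightarrow> Ck_on k V S (g i)) \<Longrightarrow> Ck_on k V S (\<lambda>x. \<Sum>i\<in>I. g i x)"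
  by (induction I rule: finite_induct) (auto intro: Ck_on_const Ck_on_add)

lemma Ck_on_bounded_linear:
  assumes "bounded_linear l"
  shows "Ck_on k V S g \<Longrightarrow> Ck_on k V S (\<lambda>x. l (g x))"
proof (induction k arbitrary: g)
  case 0
  then show ?case using assms linear_continuous_on continuous_on_compose2
    by (metis Ck_on.simps(1) UNIV_I subsetI)
next
  case (Suc k)
  obtain g' where g':
    "\<And>x. x \<in> S \<Longrightarrow> (g has_derivative g' x) (at x within S)" "\<And>v. v \<in> V \<Longrightarrow> Ck_on k V S (\<lambda>x. g' x v)"
    using Ck_on_SucE[OF Suc.prems(1)] by blast
  show ?case
    by (rule Ck_on_SucI[where g' = "\<lambda>x v. l (g' x v)"])
      (intro bounded_linear.has_derivative[OF assms] Suc.IH g'; assumption)+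
qed

lemma Ck_on_scaleR:
  fixes g :: "_ \<Rightarrow> real"
  shows "Ck_on k V S g \<Longrightarrow> Ck_on k V S h \<Longrightarrow> Ck_on k V S (\<lambda>x. g x *\<^sub>R h x)"
proof (induction k arbitrary: g h)
  case 0
  then show ?case by (auto intro: continuous_intros)
next
  case (Suc k)
  obtain g' where g':
    "\<And>x. x \<in> S \<Longrightarrow> (g has_derivative g' x) (at x within S)" "\<And>v. v \<in> V \<Longrightarrow> Ck_on k V S (\<lambda>x. g' x v)"
    using Ck_on_SucE[OF Suc.prems(1)] by blast
  obtain h' where h':
    "\<And>x. x \<in> S \<Longrightarrow> (h has_derivative h' x) (at x within S)" "\<And>v. v \<in> V \<Longrightarrow> Ck_on k V S (\<lambda>x. h' x v)"
    using Ck_on_SucE[OF Suc.prems(2)] by blast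
  have p: "Ck_on k V S g" "Ck_on k V S h" using Suc.prems Ck_on_Suc_D by blast+
  show ?case
    by (rule Ck_on_SucI[where g' = "\<lambda>x v. g x *\<^sub>R h' x v + g' x v *\<^sub>R h x"])
      (intro has_derivative_scaleR Ck_on_add Suc.IH p g' h'; assumption)+
qed

lemma Ck_on_mult:
  fixes g h :: "_ \<Rightarrow> real"
  shows "Ck_on k V S g \<Longrightarrow> Ck_on k V S h \<Longrightarrow> Ck_on k V S (\<lambda>x. g x * h x)"
  using Ck_on_scaleR[of k V S g h] by simp

text \<open>The derivative -g'/g^2 contains 1/g again, but only to order k, where the induction
  hypothesis supplies it.\<close>

lemma Ck_on_inverse:
  fixes g :: "_ \<Rightarrow> real"
  assumes nz: "\<And>x. x \<in> S \<Longrightarrow> g x \<noteq> 0"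
  shows "Ck_on k V S g \<Longrightarrow> Ck_on k V S (\<lambda>x. inverse (g x))"
proof (induction k)
  case 0
  then show ?case using nz by (auto intro!: continuous_intros)
next
  case (Suc k)
  obtain g' where *:
    "\<And>x. x \<in> S \<Longrightarrow> (g has_derivative g' x) (at x within S)" "\<And>v. v \<in> V \<Longrightarrow> Ck_on k V S (\<lambda>x. g' x v)"
    using Ck_on_SucE[OF Suc.prems] by blast
  have i: "Ck_on k V S (\<lambda>x. inverse (g x))" using Suc Ck_on_Suc_D by blast
  have "Ck_on k V S (\<lambda>x. (-1) * (inverse (g x) * g' x v * inverse (g x)))" if "v \<in> V" for v
    by (intro Ck_on_mult i *(2) that Ck_on_const)
  moreover have "\<forall>x\<in>S. ((\<lambda>x. inverse (g x)) has_derivative (\<lambda>v. (-1) * (inverse (g x) * g' x v * inverse (g x)))) (at x within S)"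
    using * nz by (auto intro!: derivative_eq_intros simp: fun_eq_iff)
  ultimately show ?case
    by (intro Ck_on_SucI[where g' = "\<lambda>x v. (-1) * (inverse (g x) * g' x v * inverse (g x))"]) blast+
qed

lemma Ck_on_linear:
  assumes "bounded_linear l"
  shows "Ck_on k V S l"
proof (cases k)
  case 0
  then show ?thesis using assms by (simp add: linear_continuous_on)
next
  case (Suc n)
  then show ?thesis using assms
    by (auto intro!: exI[of _ "\<lambda>x. l"] bounded_linear_imp_has_derivative Ck_on_const)
qed

section \<open>Orthonormal frames of the model space and the chain rule\<close>

definition orthonormal_frame :: "'e::euclidean_space set \<Rightarrow> (nat \<Rightarrow> 'e) \<Rightarrow> bool" where
  "orthonormal_frame V b \<longleftrightarrow> (\<forall>k<dim V. b k \<in> V) \<and>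
     (\<forall>j<dim V. \<forall>k<dim V. b j \<bullet> b k = (if j = k then 1 else 0)) \<and>
     (\<forall>v\<in>V. v = (\<Sum>k<dim V. (v \<bullet> b k) *\<^sub>R b k))"

lemma orthonormal_frame_exists:
  assumes "subspace V"
  obtains b where "orthonormal_frame V b"
proof -
  obtain C where C: "C \<subseteq> V" "pairwise orthogonal C" "\<And>x. x \<in> C \<Longrightarrow> norm x = 1"
      "independent C" "card C = dim V" "span C = V"
    using orthonormal_basis_subspace[OF assms] by metis
  have fin: "finite C" using C(4) independent_imp_finite by blast
  obtain b where b: "bij_betw b {..<dim V} C"
    using ex_bij_betw_nat_finite[OF fin] C(5) by (auto simp: atLeast0LessThan)
  have "v = (\<Sum>k<dim V. (v \<bullet> b k) *\<^sub>R b k)" if "v \<in> V" for v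
  proof -
    have "v = (\<Sum>c\<in>C. (v \<bullet> c) *\<^sub>R c)"
      using orthonormal_basis_expand[OF C(2) C(3) _ fin, of v] that C(6) by simp
    then show ?thesis using sum.reindex_bij_betw[OF b, of "\<lambda>c. (v \<bullet> c) *\<^sub>R c"] by simp
  qed
  moreover have "b j \<bullet> b k = (if j = k then 1 else 0)" if jk: "j < dim V" "k < dim V" for j k
  proof (cases "j = k")
    case True
    then show ?thesis using C(3)[of "b k"] b jk by (auto simp: norm_eq_1 bij_betw_def)
  next
    case False
    then have "b j \<noteq> b k" "b j \<in> C" "b k \<in> C" using b jk by (auto simp: bij_betw_def inj_on_def)
    then show ?thesis using C(2) False by (auto simp: pairwise_def orthogonal_def)
  qed
  moreover have "\<forall>k<dim V. b k \<in> V" using b C(1) by (auto simp: bij_betw_def)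
  ultimately show ?thesis using that unfolding orthonormal_frame_def by blast
qed

text \<open>The map P takes w to w minus its orthogonal projection onto V', so it vanishes exactly
  on V'. Since P o F is 0 on S, its derivative P o F' is 0 on V.\<close>

lemma derivative_in_subspace:
  fixes F :: "'d::euclidean_space \<Rightarrow> 'e::euclidean_space"
  assumes V: "subspace V" "subspace V'" and S: "openin (top_of_set V) S" and F: "F ` S \<subseteq> V'"
    and x: "x \<in> S" and v: "v \<in> V" and d: "(F has_derivative F') (at x within S)"
  shows "F' v \<in> V'"
proof -
  obtain b where b: "orthonormal_frame V' b" using orthonormal_frame_exists[OF V(2)] .
  define P where "P w = w - (\<Sum>k<dim V'. (w \<bullet> b k) *\<^sub>R b k)" for w
  have P: "bounded_linear P" unfolding P_def
    by (intro bounded_linear_intros)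
  have P0: "P (F y) = 0" if "y \<in> S" for y
    using that b F unfolding P_def orthonormal_frame_def by auto
  have "((\<lambda>y. P (F y)) has_derivative (\<lambda>w. P (F' w))) (at x within S)"
    using bounded_linear.has_derivative[OF P d] .
  then have "((\<lambda>y. 0) has_derivative (\<lambda>w. P (F' w))) (at x within S)"
    using has_derivative_transform[OF x, of "\<lambda>y. 0" "\<lambda>y. P (F y)"] P0 by simp
  then have "P (F' v) = dir_deriv v (\<lambda>y. 0) x" using dir_deriv_eq[OF V(1) S x v] by metis
  also have "\<dots> = 0" using dir_deriv_eq[OF V(1) S x v has_derivative_const[of 0]] by simp
  finally have "F' v = (\<Sum>k<dim V'. (F' v \<bullet> b k) *\<^sub>R b k)" by (simp add: P_def)
  also have "\<dots> \<in> V'" using b V(2) unfolding orthonormal_frame_def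
    by (auto intro!: subspace_sum subspace_mul)
  finally show ?thesis .
qed

text \<open>In the derivative g'(F x)(F' x v) the direction varies with x, whereas the induction
  hypothesis covers fixed directions only. Expanding F' x v in an orthonormal frame of V' yields the
  fixed directions \<open>b j\<close> with coefficients of class C^k; this is legitimate because F'
  x v stays in V'.\<close>

lemma Ck_on_compose:
  fixes F :: "'d::euclidean_space \<Rightarrow> 'e::euclidean_space"
  assumes V: "subspace V" "subspace V'" and S: "openin (top_of_set V) S"
    and T: "openin (top_of_set V') T" and F: "F ` S \<subseteq> T"
  shows "Ck_on k V S F \<Longrightarrow> Ck_on k V' T g \<Longrightarrow> Ck_on k V S (\<lambda>x. g (F x))"
proof (induction k arbitrary: g)
  case 0
  then show ?case using F continuous_on_compose2 by (metis Ck_on.simps(1))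
next
  case (Suc k)
  obtain b where b: "orthonormal_frame V' b" using orthonormal_frame_exists[OF V(2)] .
  obtain F' where F':
    "\<And>x. x \<in> S \<Longrightarrow> (F has_derivative F' x) (at x within S)" "\<And>v. v \<in> V \<Longrightarrow> Ck_on k V S (\<lambda>x. F' x v)"
    using Ck_on_SucE[OF Suc.prems(1)] by blast
  obtain g' where g':
    "\<And>x. x \<in> T \<Longrightarrow> (g has_derivative g' x) (at x within T)" "\<And>v. v \<in> V' \<Longrightarrow> Ck_on k V' T (\<lambda>x. g' x v)"
    using Ck_on_SucE[OF Suc.prems(2)] by blast
  note * = F' g'
  have d: "((\<lambda>x. g (F x)) has_derivative (\<lambda>v. g' (F x) (F' x v))) (at x within S)" if "x \<in> S" for x
    by (rule has_derivative_in_compose2[OF *(3) F that *(1)[OF that]])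
  have "Ck_on k V S (\<lambda>x. g' (F x) (F' x v))" if v: "v \<in> V" for v
  proof -
    have "g' (F x) (F' x v) = (\<Sum>j<dim V'. (F' x v \<bullet> b j) *\<^sub>R g' (F x) (b j))" if x: "x \<in> S" for x
    proof -
      have "F ` S \<subseteq> V'" using F T by (auto simp: openin_open)
      then have "F' x v \<in> V'"
        using derivative_in_subspace[OF V S _ x v *(1)[OF x]] by blast
      then have e: "F' x v = (\<Sum>j<dim V'. (F' x v \<bullet> b j) *\<^sub>R b j)"
        using b unfolding orthonormal_frame_def by blast
      have "linear (g' (F x))" using *(3) F x
        by (meson has_derivative_linear image_subset_iff)
      then show ?thesis by (subst e) (simp add: linear_sum linear_cmul)
    qed
    moreover have "Ck_on k V S (\<lambda>x. \<Sum>j<dim V'. (F' x v \<bullet> b j) *\<^sub>R g' (F x) (b j))"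
    proof (intro Ck_on_sum Ck_on_scaleR)
      fix j assume j: "j \<in> {..<dim V'}"
      show "Ck_on k V S (\<lambda>x. F' x v \<bullet> b j)"
        using Ck_on_bounded_linear[OF bounded_linear_inner_left *(2)[OF v]] .
      have "b j \<in> V'" using b j by (auto simp: orthonormal_frame_def)
      then show "Ck_on k V S (\<lambda>x. g' (F x) (b j))"
        using Suc.IH[OF Ck_on_Suc_D[OF Suc.prems(1)] *(4)] by blast
    qed simp
    ultimately show ?thesis
      using Ck_on_cong[of S "\<lambda>x. g' (F x) (F' x v)"
          "\<lambda>x. \<Sum>j<dim V'. (F' x v \<bullet> b j) *\<^sub>R g' (F x) (b j)" k V] by blast
  qed
  with d show ?case by (intro Ck_on_SucI[where g' = "\<lambda>x v. g' (F x) (F' x v)"])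
qed

section \<open>Smooth maps on relatively open sets\<close>

lemma smooth_onI: "(\<And>k. Ck_on k V S g) \<Longrightarrow> smooth_on V S g"
  unfolding smooth_on_def by simp

lemma smooth_onD: "smooth_on V S g \<Longrightarrow> Ck_on k V S g"
  unfolding smooth_on_def by simp

lemma smooth_on_cong: "(\<And>x. x \<in> S \<Longrightarrow> g x = h x) \<Longrightarrow> smooth_on V S g \<longleftrightarrow> smooth_on V S h"
  unfolding smooth_on_def by (intro iff_allI Ck_on_cong)

lemma smooth_on_subset: "smooth_on V S g \<Longrightarrow> T \<subseteq> S \<Longrightarrow> smooth_on V T g"
  by (rule smooth_onI) (rule Ck_on_subset[OF _ smooth_onD])

lemma smooth_on_local:
  assumes "subspace V" "openin (top_of_set V) S"
    and "\<And>x. x \<in> S \<Longrightarrow> \<exists>T. openin (top_of_set V) T \<and> x \<in> T \<and> T \<subseteq> S \<and> smooth_on V T g"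
  shows "smooth_on V S g"
  unfolding smooth_on_def
proof
  fix k
  have "\<exists>T. openin (top_of_set V) T \<and> x \<in> T \<and> T \<subseteq> S \<and> Ck_on k V T g" if "x \<in> S" for x
    using assms(3)[OF that] unfolding smooth_on_def by meson
  then show "Ck_on k V S g" by (rule Ck_on_local[OF assms(1,2)])
qed

lemma smooth_on_const: "smooth_on V S (\<lambda>x. c)"
  unfolding smooth_on_def by (simp add: Ck_on_const)

lemma smooth_on_add: "smooth_on V S g \<Longrightarrow> smooth_on V S h \<Longrightarrow> smooth_on V S (\<lambda>x. g x + h x)"
  unfolding smooth_on_def by (simp add: Ck_on_add)

lemma smooth_on_sum:
  "finite I \<Longrightarrow> (\<And>i. i \<in> I \<Longrightarrow> smooth_on V S (g i)) \<Longrightarrow> smooth_on V S (\<lambda>x. \<Sum>i\<in>I. g i x)"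
  unfolding smooth_on_def by (simp add: Ck_on_sum)

lemma smooth_on_bounded_linear:
  "bounded_linear l \<Longrightarrow> smooth_on V S g \<Longrightarrow> smooth_on V S (\<lambda>x. l (g x))"
  unfolding smooth_on_def by (simp add: Ck_on_bounded_linear)

lemma smooth_on_linear: "bounded_linear l \<Longrightarrow> smooth_on V S l"
  unfolding smooth_on_def by (simp add: Ck_on_linear)

lemma smooth_on_mult:
  fixes g h :: "_ \<Rightarrow> real"
  shows "smooth_on V S g \<Longrightarrow> smooth_on V S h \<Longrightarrow> smooth_on V S (\<lambda>x. g x * h x)"
  unfolding smooth_on_def by (simp add: Ck_on_mult)

lemma smooth_on_inverse:
  fixes g :: "_ \<Rightarrow> real"
  shows "(\<And>x. x \<in> S \<Longrightarrow> g x \<noteq> 0) \<Longrightarrow> smooth_on V S g \<Longrightarrow> smooth_on V S (\<lambda>x. inverse (g x))"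
  unfolding smooth_on_def by (simp add: Ck_on_inverse)

lemma smooth_on_compose:
  fixes F :: "'d::euclidean_space \<Rightarrow> 'e::euclidean_space"
  assumes "subspace V" "subspace V'" "openin (top_of_set V) S" "openin (top_of_set V') T"
    "F ` S \<subseteq> T" "smooth_on V S F" "smooth_on V' T g"
  shows "smooth_on V S (\<lambda>x. g (F x))"
  by (rule smooth_onI) (rule Ck_on_compose[OF assms(1-5) smooth_onD[OF assms(6)] smooth_onD[OF assms(7)]])

lemma smooth_on_dir_deriv:
  assumes "subspace V" "openin (top_of_set V) S" "smooth_on V S g" "v \<in> V"
  shows "smooth_on V S (dir_deriv v g)"
  using assms(3,4) Ck_on_Suc_iff[OF assms(1,2), of _ g] unfolding smooth_on_def by simp

lemma smooth_on_continuous: "smooth_on V S g \<Longrightarrow> continuous_on S g"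
  unfolding smooth_on_def by (metis Ck_on.simps(1))

text \<open>A derivative within S is not determined outside V, so an arbitrary one need not have
  this form. Precomposing g with the orthogonal projection P onto V, which fixes S pointwise,
  selects the derivative that factors through P.\<close>

lemma smooth_on_has_derivative:
  fixes V :: "'e::euclidean_space set"
  assumes V: "subspace V" and S: "openin (top_of_set V) S" and g: "smooth_on V S g"
    and b: "orthonormal_frame V b" and x: "x \<in> S"
  shows "(g has_derivative (\<lambda>h. \<Sum>k<dim V. (h \<bullet> b k) *\<^sub>R dir_deriv (b k) g x)) (at x within S)"
proof -
  have "Ck_on (Suc 0) V S g" using g by (simp add: smooth_on_def del: Ck_on.simps)
  then obtain A where A: "(g has_derivative A) (at x within S)"
    using Ck_on_Suc_iff[OF V S, of 0 g] x unfolding differentiable_def by blast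
  define P where "P h = (\<Sum>k<dim V. (h \<bullet> b k) *\<^sub>R b k)" for h
  have P: "bounded_linear P" unfolding P_def by (intro bounded_linear_intros)
  have PV: "P y = y" if "y \<in> V" for y using b that unfolding P_def orthonormal_frame_def by metis
  have SV: "S \<subseteq> V" using S by (simp add: openin_imp_subset)
  have "(P has_derivative P) (at x within S)" by (rule bounded_linear_imp_has_derivative[OF P])
  moreover have "P ` S = S" using PV SV by force
  ultimately have "((\<lambda>y. g (P y)) has_derivative (\<lambda>h. A (P h))) (at x within S)"
    using has_derivative_in_compose[of P P x S g A] A PV SV x by (metis subsetD)
  then have d: "(g has_derivative (\<lambda>h. A (P h))) (at x within S)"
    using has_derivative_transform[OF x, of g "\<lambda>y. g (P y)"] PV SV by (metis subsetD)
  have l: "linear A" using A has_derivative_linear by blast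
  have "dir_deriv (b k) g x = A (b k)" if "k < dim V" for k
    using dir_deriv_eq[OF V S x _ A] b that by (simp add: orthonormal_frame_def)
  then have "A (P h) = (\<Sum>k<dim V. (h \<bullet> b k) *\<^sub>R dir_deriv (b k) g x)" for h
    by (simp add: P_def linear_sum[OF l] linear_cmul[OF l])
  with d show ?thesis by simp
qed


subsection \<open>Bump functions\<close>

text \<open>The extra powers of 1/t make the family closed under differentiation up to linear
  combinations, which spares the bookkeeping of polynomials; \<open>flat_exp 0\<close> is the usual
  exp(-1/t).\<close>

definition flat_exp :: "nat \<Rightarrow> real \<Rightarrow> real" where
  "flat_exp k t = (if t > 0 then exp (- inverse t) * inverse t ^ k else 0)"

lemma flat_exp_has_derivative:
  "(flat_exp k has_real_derivative flat_exp (k + 2) t - real k * flat_exp (k + 1) t) (at t)"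
proof -
  consider "t > 0" | "t < 0" | "t = 0" by linarith
  then show ?thesis
  proof cases
    case 1
    have "((\<lambda>t. exp (- inverse t) * inverse t ^ k) has_real_derivative
        flat_exp (k + 2) t - real k * flat_exp (k + 1) t) (at t)"
    proof (cases k)
      case 0
      show ?thesis unfolding 0 using 1
        by (auto intro!: derivative_eq_intros simp: flat_exp_def power2_eq_square)
    next
      case (Suc n)
      show ?thesis unfolding Suc using 1
        by (auto intro!: derivative_eq_intros simp: flat_exp_def power2_eq_square algebra_simps simp del: power_Suc)
          (simp add: algebra_simps)
    qed
    then show ?thesis
      by (rule has_field_derivative_transform_within_open[of _ _ _ "{0<..}"]) (use 1 in \<open>auto simp: flat_exp_def\<close>)
  next
    case 2
    have "((\<lambda>t. 0) has_real_derivative flat_exp (k + 2) t - real k * flat_exp (k + 1) t) (at t)"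
      using 2 by (simp add: flat_exp_def)
    then show ?thesis
      by (rule has_field_derivative_transform_within_open[of _ _ _ "{..<0}"]) (use 2 in \<open>auto simp: flat_exp_def\<close>)
  next
    case 3
    \<comment> \<open>At 0 the right difference quotient is u^(k+1) / exp u with u = 1/h tending to
      infinity; the claimed derivative is 0 there by the default value of
      \<open>flat_exp\<close>.\<close>
    have "((\<lambda>x. x ^ (k + 1) / exp x) \<longlongrightarrow> (0::real)) at_top" by (rule tendsto_power_div_exp_0)
    from filterlim_compose[OF this filterlim_inverse_at_top_right]
    have "((\<lambda>h. inverse h ^ (k + 1) / exp (inverse h)) \<longlongrightarrow> (0::real)) (at_right 0)" .
    moreover have "eventually (\<lambda>h. inverse h ^ (k + 1) / exp (inverse h) = flat_exp k h / h) (at_right (0::real))"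
      unfolding eventually_at_right_field
      by (intro exI[of _ 1]) (auto simp: flat_exp_def exp_minus field_simps)
    ultimately have r: "((\<lambda>h. flat_exp k h / h) \<longlongrightarrow> 0) (at_right 0)"
      by (rule Lim_transform_eventually)
    have "eventually (\<lambda>h. 0 = flat_exp k h / h) (at_left (0::real))"
      unfolding eventually_at_left_field by (intro exI[of _ "-1"]) (auto simp: flat_exp_def)
    then have "((\<lambda>h. flat_exp k h / h) \<longlongrightarrow> 0) (at_left 0)"
      by (rule Lim_transform_eventually[OF tendsto_const])
    with r have "((\<lambda>h. flat_exp k h / h) \<longlongrightarrow> 0) (at 0)"
      by (simp add: filterlim_split_at_real)
    then show ?thesis using 3 by (simp add: DERIV_def flat_exp_def)
  qed
qed

lemma smooth_on_flat_exp: "smooth_on UNIV UNIV (flat_exp m)"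
  unfolding smooth_on_def
proof
  fix k
  show "Ck_on k UNIV UNIV (flat_exp m)"
  proof (induction k arbitrary: m)
    case 0
    have "isCont (flat_exp m) t" for t using flat_exp_has_derivative DERIV_isCont by blast
    then show ?case by (simp add: continuous_on_eq_continuous_at)
  next
    case (Suc k)
    show ?case
    proof (rule Ck_on_SucI)
      show "(flat_exp m has_derivative (\<lambda>h. (flat_exp (m + 2) x + (- real m) * flat_exp (m + 1) x) * h)) (at x within UNIV)" for x
        using flat_exp_has_derivative[of m x] by (simp add: has_field_derivative_def)
      show "Ck_on k UNIV UNIV (\<lambda>x. (flat_exp (m + 2) x + (- real m) * flat_exp (m + 1) x) * v)" for v :: real
        by (intro Ck_on_mult Ck_on_add Ck_on_const Suc)
    qed
  qed
qed

lemma smooth_bump: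
  fixes p :: "'e::euclidean_space"
  assumes "subspace V" and "r > 0"
  obtains \<beta> :: "'e \<Rightarrow> real" where "\<And>S. openin (top_of_set V) S \<Longrightarrow> smooth_on V S \<beta>"
    "\<And>x. dist p x \<le> r \<Longrightarrow> \<beta> x = 1" "\<And>x. dist p x \<ge> 2 * r \<Longrightarrow> \<beta> x = 0"
proof -
  \<comment> \<open>The usual cut-off on the line: 1 for t at most 1 and 0 for t at least 2. The
    denominator never vanishes, since 2 - t and t - 1 are not both nonpositive. Differences are
    spelled as sums so that the closure rules for sums and products apply.\<close>
  define c where "c t = flat_exp 0 (2 + (-1) * t) * inverse (flat_exp 0 (2 + (-1) * t) + flat_exp 0 (t + (-1)))" for t
  have comp: "smooth_on UNIV UNIV (\<lambda>x. flat_exp 0 (h x))" if "smooth_on UNIV UNIV h" for h :: "real \<Rightarrow> real"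
    using smooth_on_compose[OF _ _ _ _ _ that smooth_on_flat_exp] by simp
  have l: "smooth_on UNIV UNIV (\<lambda>t::real. t)" by (intro smooth_on_linear bounded_linear_ident)
  have c: "smooth_on UNIV UNIV c"
    unfolding c_def
    by (intro smooth_on_mult smooth_on_inverse smooth_on_add comp smooth_on_const l)
      (auto simp: flat_exp_def add_nonneg_eq_0_iff)
  \<comment> \<open>The squared distance is smooth at p as well; at distance 2 r it gives q = 4,
    beyond the value 2 from which on c is 0.\<close>
  define q where "q x = (\<Sum>i\<in>Basis. ((x + (- p)) \<bullet> i) * ((x + (- p)) \<bullet> i)) * inverse (r\<^sup>2)" for x
  have q: "q x = (dist p x)\<^sup>2 / r\<^sup>2" for x
    unfolding q_def dist_norm norm_minus_commute[of p] power2_norm_eq_inner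
    by (subst euclidean_inner) (simp add: divide_inverse algebra_simps)
  have lx: "smooth_on V S (\<lambda>x::'e. x)" for S by (intro smooth_on_linear bounded_linear_ident)
  have sq: "smooth_on V S q" for S unfolding q_def
    by (intro smooth_on_mult smooth_on_sum smooth_on_const finite_Basis lx smooth_on_add
        smooth_on_bounded_linear[OF bounded_linear_inner_left])
  show ?thesis
  proof (rule that[of "\<lambda>x. c (q x)"])
    show "smooth_on V S (\<lambda>x. c (q x))" if "openin (top_of_set V) S" for S
      using smooth_on_compose[OF assms(1) _ that _ _ sq c] by simp
    fix x
    show "c (q x) = 1" if "dist p x \<le> r"
    proof -
      have "q x \<le> 1" using that assms(2) unfolding q by (simp add: power_mono)
      then show ?thesis unfolding c_def by (simp add: flat_exp_def)
    qed
    show "c (q x) = 0" if "dist p x \<ge> 2 * r"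
    proof -
      have "(2 * r)\<^sup>2 \<le> (dist p x)\<^sup>2" using that assms(2) by (intro power_mono) auto
      then have "q x \<ge> 4" using assms(2) unfolding q by (simp add: field_simps)
      then show ?thesis unfolding c_def by (simp add: flat_exp_def)
    qed
  qed
qed


subsection \<open>Hadamard's lemma\<close>

text \<open>The integral of Hadamard's lemma, taken along the segment from p to q. The weight t^m is
  there for differentiation in q, which produces one more factor t each time.\<close>

definition ray_integral :: "'e::euclidean_space \<Rightarrow> nat \<Rightarrow> ('e \<Rightarrow> real) \<Rightarrow> 'e \<Rightarrow> real" where
  "ray_integral p m K q = integral {0..1} (\<lambda>t. t ^ m * K (p + t *\<^sub>R (q - p)))"

lemma convex_ray:
  assumes "convex S" "p \<in> S" "q \<in> S" "t \<in> {0..1}"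
  shows "p + t *\<^sub>R (q - p) \<in> S"
proof -
  have "p + t *\<^sub>R (q - p) = (1 - t) *\<^sub>R p + t *\<^sub>R q" by (simp add: algebra_simps)
  then show ?thesis using convexD_alt[OF assms(1-3)] assms(4) by simp
qed

text \<open>Differentiation under the integral sign. Convexity of S keeps the segments inside S and
  is also what the Leibniz rule asks of the parameter set.\<close>

lemma ray_integral_has_derivative:
  fixes V :: "'e::euclidean_space set"
  assumes V: "subspace V" and S: "openin (top_of_set V) S" "convex S" and p: "p \<in> S"
    and K: "smooth_on V S K" and b: "orthonormal_frame V b" and q: "q \<in> S"
  shows "(ray_integral p m K has_derivative
     (\<lambda>h. \<Sum>k<dim V. (h \<bullet> b k) *\<^sub>R ray_integral p (Suc m) (dir_deriv (b k) K) q)) (at q within S)"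
proof -
  \<comment> \<open>The q-derivative of the integrand as a bounded linear map; the factor t from the
    chain rule raises the exponent to \<open>Suc m\<close>.\<close>
  define fx where "fx q t = (\<Sum>k<dim V. (t ^ Suc m * dir_deriv (b k) K (p + t *\<^sub>R (q - p))) *\<^sub>R blinfun_inner_left (b k))"
    for q t
  have cont: "continuous_on (S \<times> {0..1}) (\<lambda>(q, t). k (p + t *\<^sub>R (q - p)))"
    if "smooth_on V S k" for k :: "'e \<Rightarrow> real"
    unfolding split_beta
    by (rule continuous_on_compose2[OF smooth_on_continuous[OF that]])
      (use convex_ray[OF S(2) p] in \<open>auto intro!: continuous_intros\<close>)
  have cont1: "continuous_on {0..1} (\<lambda>t. k (p + t *\<^sub>R (q - p)))"
    if "smooth_on V S k" "q \<in> S" for k :: "'e \<Rightarrow> real" and q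
    by (rule continuous_on_compose2[OF smooth_on_continuous[OF that(1)]])
      (use convex_ray[OF S(2) p that(2)] in \<open>auto intro!: continuous_intros\<close>)
  have bV: "b k \<in> V" if "k < dim V" for k using b that by (simp add: orthonormal_frame_def)
  have dd: "smooth_on V S (dir_deriv (b k) K)" if "k < dim V" for k
    using smooth_on_dir_deriv[OF V S(1) K bV[OF that]] .
  have "((\<lambda>x. integral (cbox 0 1) (\<lambda>t. t ^ m * K (p + t *\<^sub>R (x - p)))) has_derivative
      blinfun_apply (integral (cbox 0 1) (fx q))) (at q within S)"
  proof (rule leibniz_rule[OF _ _ _ q S(2)])
    fix x and t :: real assume x: "x \<in> S" and t: "t \<in> cbox 0 1"
    have r: "p + t *\<^sub>R (x - p) \<in> S" using convex_ray[OF S(2) p x] t by simp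
    have d1: "((\<lambda>x. p + t *\<^sub>R (x - p)) has_derivative (\<lambda>h. t *\<^sub>R h)) (at x within S)"
      by (auto intro!: derivative_eq_intros)
    have sub: "(\<lambda>x. p + t *\<^sub>R (x - p)) ` S \<subseteq> S" using convex_ray[OF S(2) p] t by auto
    have "((\<lambda>x. K (p + t *\<^sub>R (x - p))) has_derivative
        (\<lambda>h. \<Sum>k<dim V. ((t *\<^sub>R h) \<bullet> b k) *\<^sub>R dir_deriv (b k) K (p + t *\<^sub>R (x - p)))) (at x within S)"
      by (rule has_derivative_in_compose2[OF smooth_on_has_derivative[OF V S(1) K b] sub x d1])
    then have "((\<lambda>x. t ^ m * K (p + t *\<^sub>R (x - p))) has_derivative
        (\<lambda>h. t ^ m * (\<Sum>k<dim V. ((t *\<^sub>R h) \<bullet> b k) *\<^sub>R dir_deriv (b k) K (p + t *\<^sub>R (x - p))))) (at x within S)"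
      by (rule has_derivative_mult_right)
    moreover have "(\<lambda>h. t ^ m * (\<Sum>k<dim V. ((t *\<^sub>R h) \<bullet> b k) *\<^sub>R dir_deriv (b k) K (p + t *\<^sub>R (x - p))))
        = blinfun_apply (fx x t)"
      by (simp add: fun_eq_iff fx_def blinfun.sum_left blinfun.scaleR_left sum_distrib_left mult_ac)
    ultimately show "((\<lambda>x. t ^ m * K (p + t *\<^sub>R (x - p))) has_derivative blinfun_apply (fx x t)) (at x within S)"
      by simp
  next
    fix x assume x: "x \<in> S"
    show "(\<lambda>t. t ^ m * K (p + t *\<^sub>R (x - p))) integrable_on cbox 0 1"
      by (intro integrable_continuous continuous_intros) (use cont1[OF K x] in simp)
  next
    show "continuous_on (S \<times> cbox 0 1) (\<lambda>(x, t). fx x t)"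
      using cont[OF dd] unfolding fx_def split_beta by (auto intro!: continuous_intros)
  qed
  moreover have "blinfun_apply (integral (cbox 0 1) (fx q)) h =
      (\<Sum>k<dim V. (h \<bullet> b k) *\<^sub>R ray_integral p (Suc m) (dir_deriv (b k) K) q)" for h
  proof -
    have i: "fx q integrable_on cbox 0 1"
      unfolding fx_def by (intro integrable_continuous continuous_intros) (use cont1[OF dd q] in simp)
    have "blinfun_apply (integral (cbox 0 1) (fx q)) h = integral (cbox 0 1) (\<lambda>t. blinfun_apply (fx q t) h)"
      by (rule blinfun_apply_integral[OF i])
    also have "\<dots> = integral {0..1} (\<lambda>t. \<Sum>k<dim V. (t ^ Suc m * dir_deriv (b k) K (p + t *\<^sub>R (q - p))) * (h \<bullet> b k))"
      by (simp add: fx_def blinfun.sum_left blinfun.scaleR_left)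
    also have "\<dots> = (\<Sum>k<dim V. integral {0..1} (\<lambda>t. (t ^ Suc m * dir_deriv (b k) K (p + t *\<^sub>R (q - p))) * (h \<bullet> b k)))"
      using cont1[OF dd q] 
      by (intro integral_sum integrable_continuous_real continuous_intros) auto
    also have "\<dots> = (\<Sum>k<dim V. (h \<bullet> b k) *\<^sub>R ray_integral p (Suc m) (dir_deriv (b k) K) q)"
      by (simp add: ray_integral_def mult.commute)
    finally show ?thesis .
  qed
  then have "blinfun_apply (integral (cbox 0 1) (fx q)) =
      (\<lambda>h. \<Sum>k<dim V. (h \<bullet> b k) *\<^sub>R ray_integral p (Suc m) (dir_deriv (b k) K) q)" by (rule ext)
  moreover have "ray_integral p m K = (\<lambda>x. integral (cbox 0 1) (\<lambda>t. t ^ m * K (p + t *\<^sub>R (x - p))))"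
    by (simp add: fun_eq_iff ray_integral_def)
  ultimately show ?thesis by (simp only:)
qed

lemma smooth_on_ray_integral:
  fixes V :: "'e::euclidean_space set"
  assumes V: "subspace V" and S: "openin (top_of_set V) S" "convex S" and p: "p \<in> S"
    and K: "smooth_on V S K"
  shows "smooth_on V S (ray_integral p m K)"
  unfolding smooth_on_def
proof
  obtain b where b: "orthonormal_frame V b" using orthonormal_frame_exists[OF V] .
  note d = ray_integral_has_derivative[OF V S p _ b]
  fix k
  show "Ck_on k V S (ray_integral p m K)" using K
  proof (induction k arbitrary: m K)
    case 0
    have "continuous (at q within S) (ray_integral p m K)" if "q \<in> S" for q
      by (rule has_derivative_continuous[OF d[OF 0 that]])
    then show ?case by (simp add: continuous_on_eq_continuous_within)
  next
    case (Suc k)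
    show ?case
    proof (rule Ck_on_SucI[OF d[OF Suc.prems]])
      fix v
      have "smooth_on V S (dir_deriv (b j) K)" if "j < dim V" for j
        using smooth_on_dir_deriv[OF V S(1) Suc.prems] b that by (simp add: orthonormal_frame_def)
      then show "Ck_on k V S (\<lambda>x. \<Sum>j<dim V. (v \<bullet> b j) *\<^sub>R ray_integral p (Suc m) (dir_deriv (b j) K) x)"
        by (intro Ck_on_sum Ck_on_scaleR Ck_on_const Suc.IH) auto
    qed
  qed
qed

text \<open>The fundamental theorem of calculus along the segment from p to q, with the inner
  product of q - p and \<open>b k\<close> pulled out of the integral. The values H k p are all that
  a derivation at p will see of G.\<close>

lemma hadamard:
  fixes V :: "'e::euclidean_space set" and G :: "'e \<Rightarrow> real"
  assumes V: "subspace V" and S: "openin (top_of_set V) S" "convex S" and p: "p \<in> S"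
    and G: "smooth_on V S G" and b: "orthonormal_frame V b"
  obtains H where "\<And>k. k < dim V \<Longrightarrow> smooth_on V S (H k)" "\<And>k. k < dim V \<Longrightarrow> H k p = dir_deriv (b k) G p"
    "\<And>q. q \<in> S \<Longrightarrow> G q = G p + (\<Sum>k<dim V. ((q - p) \<bullet> b k) * H k q)"
proof
  define H where "H k = ray_integral p 0 (dir_deriv (b k) G)" for k
  have dd: "smooth_on V S (dir_deriv (b k) G)" if "k < dim V" for k
    using smooth_on_dir_deriv[OF V S(1) G] b that by (simp add: orthonormal_frame_def)
  show "smooth_on V S (H k)" if "k < dim V" for k
    unfolding H_def by (rule smooth_on_ray_integral[OF V S p dd[OF that]])
  show "H k p = dir_deriv (b k) G p" for k
    by (simp add: H_def ray_integral_def)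
  fix q assume q: "q \<in> S"
  let ?r = "\<lambda>t. p + t *\<^sub>R (q - p)"
  have "((\<lambda>t. \<Sum>k<dim V. ((q - p) \<bullet> b k) * dir_deriv (b k) G (?r t)) has_integral G (?r 1) - G (?r 0)) {0..1}"
  proof (rule fundamental_theorem_of_calculus)
    fix t :: real assume t: "t \<in> {0..1}"
    have sub: "?r ` {0..1} \<subseteq> S" using convex_ray[OF S(2) p q] by auto
    have d1: "(?r has_derivative (\<lambda>h. h *\<^sub>R (q - p))) (at t within {0..1})"
      by (auto intro!: derivative_eq_intros)
    show "((\<lambda>t. G (?r t)) has_vector_derivative (\<Sum>k<dim V. ((q - p) \<bullet> b k) * dir_deriv (b k) G (?r t))) (at t within {0..1})"
      unfolding has_vector_derivative_def
      using has_derivative_in_compose2[OF smooth_on_has_derivative[OF V S(1) G b] sub t d1]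
      by (simp add: sum_distrib_left mult_ac inner_diff_left)
  qed simp
  moreover have c: "continuous_on {0..1} (\<lambda>t. dir_deriv (b k) G (?r t))" if "k < dim V" for k
    by (rule continuous_on_compose2[OF smooth_on_continuous[OF dd[OF that]]])
      (use convex_ray[OF S(2) p q] in \<open>auto intro!: continuous_intros\<close>)
  have "((\<lambda>t. ((q - p) \<bullet> b k) * dir_deriv (b k) G (?r t)) has_integral ((q - p) \<bullet> b k) * H k q) {0..1}"
    if "k < dim V" for k
    using has_integral_mult_right[OF integrable_integral[OF integrable_continuous_real[OF c[OF that]]]]
    by (simp add: H_def ray_integral_def)
  then have "((\<lambda>t. \<Sum>k<dim V. ((q - p) \<bullet> b k) * dir_deriv (b k) G (?r t)) has_integral
      (\<Sum>k<dim V. ((q - p) \<bullet> b k) * H k q)) {0..1}"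
    by (intro has_integral_sum) auto
  ultimately have "G (?r 1) - G (?r 0) = (\<Sum>k<dim V. ((q - p) \<bullet> b k) * H k q)"
    by (rule has_integral_unique)
  then show "G q = G p + (\<Sum>k<dim V. ((q - p) \<bullet> b k) * H k q)" by simp
qed

section \<open>Smooth functions, bump functions and coordinates on manifolds\<close>

named_theorems smooth_intros

section \<open>Charts and smoothness near a point\<close>

locale smooth_mfd =
  fixes M :: "('m::{t2_space, second_countable_topology}, 'e::euclidean_space) manifold"
  assumes smooth_manifold: "smooth_manifold M"
begin

lemma subspace_model: "subspace (model M)"
  using smooth_manifold unfolding smooth_manifold_def by (elim conjE)

lemma chart_exists: obtains U \<phi> where "(U, \<phi>) \<in> charts M" "x \<in> U"
proof -
  have "(\<Union>(U, \<phi>)\<in>charts M. U) = UNIV"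
    using smooth_manifold unfolding smooth_manifold_def by (elim conjE)
  then have "x \<in> (\<Union>(U, \<phi>)\<in>charts M. U)" by simp
  then show ?thesis using that by auto
qed

lemma
  assumes "(U, \<phi>) \<in> charts M"
  shows chart_open: "open U"
    and chart_image_open: "openin (top_of_set (model M)) (\<phi> ` U)"
    and chart_homeo: "homeomorphism U (\<phi> ` U) \<phi> (inv_into U \<phi>)"
  using smooth_manifold assms unfolding smooth_manifold_def by fast+

lemma chart_change:
  assumes "(U, \<phi>) \<in> charts M" "(W, \<psi>) \<in> charts M"
  shows "smooth_on (model M) (\<phi> ` (U \<inter> W)) (\<psi> \<circ> inv_into U \<phi>)"
  using smooth_manifold assms unfolding smooth_manifold_def by fast

lemma chart_inv: "(U, \<phi>) \<in> charts M \<Longrightarrow> y \<in> U \<Longrightarrow> inv_into U \<phi> (\<phi> y) = y"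
  using chart_homeo by (auto simp: homeomorphism_def)

lemma chart_open_image:
  assumes c: "(U, \<phi>) \<in> charts M" and W: "open W"
  shows "openin (top_of_set (model M)) (\<phi> ` (U \<inter> W))"
proof -
  have "openin (top_of_set U) (U \<inter> W)" using W by (simp add: openin_open_Int)
  then have "openin (top_of_set (\<phi> ` U)) (\<phi> ` (U \<inter> W))"
    using homeomorphism_imp_open_map[OF chart_homeo[OF c]] by blast
  then show ?thesis using chart_image_open[OF c] openin_trans by blast
qed

text \<open>A change of charts reduces every other chart to the given one, because W lies in its
  domain.\<close>

lemma Cinf_on_chartI:
  assumes c: "(U, \<phi>) \<in> charts M" and W: "open W" "W \<subseteq> U"
    and g: "smooth_on (model M) (\<phi> ` W) (g \<circ> inv_into U \<phi>)"
  shows "g \<in> Cinf_on M W"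
  unfolding Cinf_on_def
proof (clarify)
  fix U' \<phi>' assume c': "(U', \<phi>') \<in> charts M"
  let ?F = "\<phi> \<circ> inv_into U' \<phi>'"
  have "smooth_on (model M) (\<phi>' ` (U' \<inter> W)) (\<lambda>x. (g \<circ> inv_into U \<phi>) (?F x))"
  proof (rule smooth_on_compose[OF subspace_model subspace_model chart_open_image[OF c' W(1)] _ _ _ g])
    show "openin (top_of_set (model M)) (\<phi> ` W)" using chart_open_image[OF c W(1)] W(2)
      by (simp add: Int_absorb1)
    show "?F ` \<phi>' ` (U' \<inter> W) \<subseteq> \<phi> ` W" using chart_inv[OF c'] by auto
    show "smooth_on (model M) (\<phi>' ` (U' \<inter> W)) ?F"
      by (rule smooth_on_subset[OF chart_change[OF c' c]]) (use W in auto)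
  qed
  then show "smooth_on (model M) (\<phi>' ` (U' \<inter> W)) (g \<circ> inv_into U' \<phi>')"
    by (rule smooth_on_cong[THEN iffD1, rotated]) (use chart_inv[OF c'] chart_inv[OF c] W in auto)
qed

lemma Cinf_onD:
  "g \<in> Cinf_on M W \<Longrightarrow> (U, \<phi>) \<in> charts M \<Longrightarrow> smooth_on (model M) (\<phi> ` (U \<inter> W)) (g \<circ> inv_into U \<phi>)"
  unfolding Cinf_on_def by auto

lemma Cinf_on_subset: "g \<in> Cinf_on M W \<Longrightarrow> W' \<subseteq> W \<Longrightarrow> g \<in> Cinf_on M W'"
proof -
  assume g: "g \<in> Cinf_on M W" and s: "W' \<subseteq> W"
  have "smooth_on (model M) (\<phi> ` (U \<inter> W')) (g \<circ> inv_into U \<phi>)" if "(U, \<phi>) \<in> charts M" for U \<phi>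
    by (rule smooth_on_subset[OF Cinf_onD[OF g that]]) (use s in auto)
  then show ?thesis unfolding Cinf_on_def by auto
qed

lemma Cinf_on_cong:
  assumes "\<And>x. x \<in> W \<Longrightarrow> g x = h x"
  shows "g \<in> Cinf_on M W \<longleftrightarrow> h \<in> Cinf_on M W"
proof -
  have "smooth_on (model M) (\<phi> ` (U \<inter> W)) (g \<circ> inv_into U \<phi>) \<longleftrightarrow>
      smooth_on (model M) (\<phi> ` (U \<inter> W)) (h \<circ> inv_into U \<phi>)" if "(U, \<phi>) \<in> charts M" for U \<phi>
    by (rule smooth_on_cong) (use chart_inv[OF that] assms in auto)
  then show ?thesis unfolding Cinf_on_def by blast
qed

text \<open>Smoothness as a property of germs. For open W, membership in \<open>Cinf_on M W\<close>
  is this property at every point of W, so functions assembled piecewise, such as a local function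
  times a cut-off, can be examined one point at a time.\<close>

definition smooth_at :: "('m \<Rightarrow> real) \<Rightarrow> 'm \<Rightarrow> bool" where
  "smooth_at g x \<longleftrightarrow> (\<exists>W. open W \<and> x \<in> W \<and> g \<in> Cinf_on M W)"

lemma smooth_atI: "open W \<Longrightarrow> x \<in> W \<Longrightarrow> g \<in> Cinf_on M W \<Longrightarrow> smooth_at g x"
  unfolding smooth_at_def by blast

lemma smooth_atE:
  assumes "smooth_at g x"
  obtains W where "open W" "x \<in> W" "g \<in> Cinf_on M W"
  using assms unfolding smooth_at_def by blast

lemma Cinf_on_iff: "open W \<Longrightarrow> g \<in> Cinf_on M W \<longleftrightarrow> (\<forall>x\<in>W. smooth_at g x)"
proof
  assume "open W" "g \<in> Cinf_on M W"
  then show "\<forall>x\<in>W. smooth_at g x" unfolding smooth_at_def by blast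
next
  assume W: "open W" and loc: "\<forall>x\<in>W. smooth_at g x"
  show "g \<in> Cinf_on M W" unfolding Cinf_on_def
  proof (clarify)
    fix U \<phi> assume c: "(U, \<phi>) \<in> charts M"
    show "smooth_on (model M) (\<phi> ` (U \<inter> W)) (g \<circ> inv_into U \<phi>)"
    proof (rule smooth_on_local[OF subspace_model chart_open_image[OF c W]])
      fix q assume "q \<in> \<phi> ` (U \<inter> W)"
      then obtain x where x: "x \<in> U" "x \<in> W" "q = \<phi> x" by auto
      then obtain W' where W': "open W'" "x \<in> W'" "g \<in> Cinf_on M W'"
        using loc unfolding smooth_at_def by blast
      show "\<exists>T. openin (top_of_set (model M)) T \<and> q \<in> T \<and> T \<subseteq> \<phi> ` (U \<inter> W) \<and>
          smooth_on (model M) T (g \<circ> inv_into U \<phi>)"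
      proof (intro exI conjI)
        show "openin (top_of_set (model M)) (\<phi> ` (U \<inter> (W \<inter> W')))"
          using chart_open_image[OF c] W W' by blast
        show "q \<in> \<phi> ` (U \<inter> (W \<inter> W'))" using x W' by auto
        show "\<phi> ` (U \<inter> (W \<inter> W')) \<subseteq> \<phi> ` (U \<inter> W)" by auto
        show "smooth_on (model M) (\<phi> ` (U \<inter> (W \<inter> W'))) (g \<circ> inv_into U \<phi>)"
          by (rule smooth_on_subset[OF Cinf_onD[OF W'(3) c]]) auto
      qed
    qed
  qed
qed

lemma Cinf_iff: "g \<in> Cinf M \<longleftrightarrow> (\<forall>x. smooth_at g x)"
  using Cinf_on_iff[of UNIV g] by simp

lemma Cinf_smooth_at: "g \<in> Cinf M \<Longrightarrow> smooth_at g x"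
  by (simp add: Cinf_iff)

lemma smooth_at_cong:
  assumes "eventually (\<lambda>y. g y = h y) (nhds x)"
  shows "smooth_at g x \<longleftrightarrow> smooth_at h x"
proof -
  obtain N where N: "open N" "x \<in> N" "\<And>y. y \<in> N \<Longrightarrow> g y = h y"
    using assms unfolding eventually_nhds by blast
  have "smooth_at k x" if k': "smooth_at k' x" and eq: "\<And>y. y \<in> N \<Longrightarrow> k y = k' y" for k k'
  proof -
    obtain W where W: "open W" "x \<in> W" "k' \<in> Cinf_on M W" by (rule smooth_atE[OF k'])
    have "k' \<in> Cinf_on M (W \<inter> N)" by (rule Cinf_on_subset[OF W(3)]) auto
    then have "k \<in> Cinf_on M (W \<inter> N)" 
      by (rule Cinf_on_cong[THEN iffD2, rotated]) (rule eq, simp)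
    then show ?thesis by (rule smooth_atI[rotated 2]) (use W N in auto)
  qed
  from this[of h g] this[of g h] show ?thesis using N(3) by auto
qed

lemma smooth_at_common:
  assumes "smooth_at g x" "smooth_at h x"
  obtains W where "open W" "x \<in> W" "g \<in> Cinf_on M W" "h \<in> Cinf_on M W"
proof -
  obtain W where W: "open W" "x \<in> W" "g \<in> Cinf_on M W" by (rule smooth_atE[OF assms(1)])
  obtain W' where W': "open W'" "x \<in> W'" "h \<in> Cinf_on M W'" by (rule smooth_atE[OF assms(2)])
  show ?thesis
    by (rule that[of "W \<inter> W'"])
      (use W W' in \<open>auto intro: Cinf_on_subset[OF W(3)] Cinf_on_subset[OF W'(3)]\<close>)
qed

lemma smooth_at_const [simp, smooth_intros]: "smooth_at (\<lambda>x. c) x"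
proof -
  have "(\<lambda>x. c) \<in> Cinf_on M UNIV" unfolding Cinf_on_def by (auto simp: o_def smooth_on_const)
  then show ?thesis by (rule smooth_atI[rotated 2]) simp_all
qed

lemma smooth_at_add [smooth_intros]:
  assumes "smooth_at g x" "smooth_at h x"
  shows "smooth_at (\<lambda>y. g y + h y) x"
proof -
  obtain W where W: "open W" "x \<in> W" "g \<in> Cinf_on M W" "h \<in> Cinf_on M W"
    using smooth_at_common[OF assms] .
  have "(\<lambda>y. g y + h y) \<in> Cinf_on M W" unfolding Cinf_on_def o_def
    using Cinf_onD[OF W(3)] Cinf_onD[OF W(4)] by (auto simp: o_def intro: smooth_on_add)
  then show ?thesis by (rule smooth_atI[OF W(1,2)])
qed

lemma smooth_at_mult [smooth_intros]:
  assumes "smooth_at g x" "smooth_at h x"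
  shows "smooth_at (\<lambda>y. g y * h y) x"
proof -
  obtain W where W: "open W" "x \<in> W" "g \<in> Cinf_on M W" "h \<in> Cinf_on M W"
    using smooth_at_common[OF assms] .
  have "(\<lambda>y. g y * h y) \<in> Cinf_on M W" unfolding Cinf_on_def o_def
    using Cinf_onD[OF W(3)] Cinf_onD[OF W(4)] by (auto simp: o_def intro: smooth_on_mult)
  then show ?thesis by (rule smooth_atI[OF W(1,2)])
qed

lemma smooth_at_minus [smooth_intros]: "smooth_at g x \<Longrightarrow> smooth_at (\<lambda>y. - g y) x"
  using smooth_at_mult[of "\<lambda>y. -1" x g] by simp

lemma smooth_at_diff [smooth_intros]: "smooth_at g x \<Longrightarrow> smooth_at h x \<Longrightarrow> smooth_at (\<lambda>y. g y - h y) x"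
  using smooth_at_add[of g x "\<lambda>y. - h y"] smooth_at_minus[of h x] by simp

lemma smooth_at_sum [smooth_intros]:
  "(\<And>i. i \<in> I \<Longrightarrow> smooth_at (g i) x) \<Longrightarrow> smooth_at (\<lambda>y. \<Sum>i\<in>I. g i y) x"
  by (induction I rule: infinite_finite_induct) (auto intro: smooth_at_add)

lemma Cinf_on_continuous:
  assumes "open W" "g \<in> Cinf_on M W"
  shows "continuous_on W g"
proof -
  have "isCont g x" if x: "x \<in> W" for x
  proof -
    obtain U \<phi> where c: "(U, \<phi>) \<in> charts M" "x \<in> U" using chart_exists .
    have h: "homeomorphism U (\<phi> ` U) \<phi> (inv_into U \<phi>)" by (rule chart_homeo[OF c(1)])
    have "continuous_on (U \<inter> W) (\<lambda>y. (g \<circ> inv_into U \<phi>) (\<phi> y))"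
      by (rule continuous_on_compose2[OF smooth_on_continuous[OF Cinf_onD[OF assms(2) c(1)]]])
        (use h in \<open>auto simp: homeomorphism_def elim: continuous_on_subset\<close>)
    then have "continuous_on (U \<inter> W) g"
      by (rule continuous_on_cong[THEN iffD1, rotated -1]) (use chart_inv[OF c(1)] in auto)
    then show ?thesis using c x chart_open[OF c(1)] assms(1)
      by (meson IntI continuous_on_eq_continuous_at open_Int)
  qed
  then show ?thesis by (simp add: continuous_at_imp_continuous_on)
qed

lemma smooth_at_inverse [smooth_intros]:
  assumes "smooth_at g x" "g x \<noteq> 0"
  shows "smooth_at (\<lambda>y. inverse (g y)) x"
proof -
  obtain W where W: "open W" "x \<in> W" "g \<in> Cinf_on M W" by (rule smooth_atE[OF assms(1)])
  define W' where "W' = {y \<in> W. g y \<noteq> 0}"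
  have "open (g -` (- {0}) \<inter> W)"
    by (rule continuous_open_preimage[OF Cinf_on_continuous[OF W(1,3)] W(1), unfolded Int_commute[of W]]) auto
  moreover have "W' = g -` (- {0}) \<inter> W" by (auto simp: W'_def)
  ultimately have W': "open W'" "x \<in> W'" using W(2) assms(2) by (auto simp: W'_def)
  have gW': "g \<in> Cinf_on M W'" by (rule Cinf_on_subset[OF W(3)]) (auto simp: W'_def)
  have "smooth_on (model M) (\<phi> ` (U \<inter> W')) (\<lambda>q. inverse ((g \<circ> inv_into U \<phi>) q))"
    if c: "(U, \<phi>) \<in> charts M" for U \<phi>
    by (rule smooth_on_inverse[OF _ Cinf_onD[OF gW' c]]) (auto simp: chart_inv[OF c] W'_def)
  then have "(\<lambda>y. inverse (g y)) \<in> Cinf_on M W'" unfolding Cinf_on_def by (auto simp: o_def)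
  then show ?thesis by (rule smooth_atI[OF W'(1,2)])
qed

lemma smooth_at_divide [smooth_intros]:
  "smooth_at g x \<Longrightarrow> smooth_at h x \<Longrightarrow> h x \<noteq> 0 \<Longrightarrow> smooth_at (\<lambda>y. g y / h y) x"
  unfolding divide_inverse by (intro smooth_intros)

lemma
  shows Cinf_const [simp, smooth_intros]: "(\<lambda>x. c) \<in> Cinf M"
    and Cinf_add [smooth_intros]: "g \<in> Cinf M \<Longrightarrow> h \<in> Cinf M \<Longrightarrow> (\<lambda>y. g y + h y) \<in> Cinf M"
    and Cinf_diff [smooth_intros]: "g \<in> Cinf M \<Longrightarrow> h \<in> Cinf M \<Longrightarrow> (\<lambda>y. g y - h y) \<in> Cinf M"
    and Cinf_mult [smooth_intros]: "g \<in> Cinf M \<Longrightarrow> h \<in> Cinf M \<Longrightarrow> (\<lambda>y. g y * h y) \<in> Cinf M"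
    and Cinf_sum [smooth_intros]: "\<forall>i\<in>I. k i \<in> Cinf M \<Longrightarrow> (\<lambda>y. \<Sum>i\<in>I. k i y) \<in> Cinf M"
  unfolding Cinf_iff by (auto intro!: smooth_intros)

text \<open>Vanishing is asserted near every point outside W, including the boundary points of W.
  This is what makes the product with a function that is smooth only on W smooth on all of
  M.\<close>

lemma bump_exists:
  assumes W: "open W" "x \<in> W"
  obtains \<theta> where "\<theta> \<in> Cinf M" "eventually (\<lambda>y. \<theta> y = 1) (nhds x)"
    "\<And>y. y \<notin> W \<Longrightarrow> eventually (\<lambda>z. \<theta> z = 0) (nhds y)"
proof -
  obtain U \<phi> where c: "(U, \<phi>) \<in> charts M" "x \<in> U" using chart_exists .
  have h: "homeomorphism U (\<phi> ` U) \<phi> (inv_into U \<phi>)" by (rule chart_homeo[OF c(1)])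
  obtain O' where O': "open O'" "\<phi> ` (U \<inter> W) = model M \<inter> O'"
    using chart_open_image[OF c(1) W(1)] by (auto simp: openin_open)
  have "\<phi> x \<in> O'" using O' c W by auto
  then obtain e where e: "e > 0" "cball (\<phi> x) e \<subseteq> O'" using O'(1) open_contains_cball by blast
  obtain \<beta> :: "'e \<Rightarrow> real" where \<beta>: "\<And>S. openin (top_of_set (model M)) S \<Longrightarrow> smooth_on (model M) S \<beta>"
    "\<And>q. dist (\<phi> x) q \<le> e / 2 \<Longrightarrow> \<beta> q = 1" "\<And>q. dist (\<phi> x) q \<ge> 2 * (e / 2) \<Longrightarrow> \<beta> q = 0"
    using smooth_bump[OF subspace_model, of "e / 2" "\<phi> x"] e(1) by auto
  \<comment> \<open>K is compact, hence closed in the Hausdorff space M. A set that is merely closed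
    in U could accumulate at the boundary of U, and the extension by 0 need not be smooth
    there.\<close>
  define K where "K = inv_into U \<phi> ` (cball (\<phi> x) e \<inter> model M)"
  have sub: "cball (\<phi> x) e \<inter> model M \<subseteq> \<phi> ` (U \<inter> W)" using e(2) O'(2) by auto
  then have "continuous_on (cball (\<phi> x) e \<inter> model M) (inv_into U \<phi>)"
    using h by (auto simp: homeomorphism_def elim!: continuous_on_subset)
  moreover have "compact (cball (\<phi> x) e \<inter> model M)"
    by (simp add: closed_subspace compact_Int_closed subspace_model)
  ultimately have "compact K" unfolding K_def by (rule compact_continuous_image)
  then have K: "closed K" by (rule compact_imp_closed)
  have KW: "K \<subseteq> U \<inter> W" using sub chart_inv[OF c(1)] unfolding K_def by force
  define \<theta> where "\<theta> y = (if y \<in> U then \<beta> (\<phi> y) else 0)" for y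
  have out: "\<theta> y = 0" if "y \<notin> K" for y
  proof (cases "y \<in> U")
    case True
    have "\<phi> y \<in> model M" using chart_image_open[OF c(1)] True openin_imp_subset by blast
    then have "\<phi> y \<notin> cball (\<phi> x) e" using that True chart_inv[OF c(1) True] unfolding K_def by force
    then show ?thesis using \<beta>(3) by (simp add: \<theta>_def)
  qed (simp add: \<theta>_def)
  have ev0: "eventually (\<lambda>z. \<theta> z = 0) (nhds y)" if "y \<notin> K" for y
    unfolding eventually_nhds using K that out by (intro exI[of _ "- K"]) auto
  have inU: "smooth_at \<theta> y" if "y \<in> U" for y
  proof -
    have "smooth_on (model M) (\<phi> ` U) (\<theta> \<circ> inv_into U \<phi>)"
      by (rule smooth_on_cong[THEN iffD1, OF _ \<beta>(1)[OF chart_image_open[OF c(1)]]])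
        (auto simp: chart_inv[OF c(1)] \<theta>_def)
    then have "\<theta> \<in> Cinf_on M U" by (rule Cinf_on_chartI[OF c(1) chart_open[OF c(1)] order_refl])
    then show ?thesis using that chart_open[OF c(1)] by (auto simp: Cinf_on_iff)
  qed
  have "smooth_at \<theta> y" for y
  proof (cases "y \<in> U")
    case False
    then have "eventually (\<lambda>z. \<theta> z = 0) (nhds y)" using ev0 KW by auto
    from smooth_at_cong[OF this] show ?thesis by simp
  qed (rule inU)
  moreover have "eventually (\<lambda>y. \<theta> y = 1) (nhds x)"
  proof -
    have "open (U \<inter> \<phi> -` ball (\<phi> x) (e / 2))"
      by (rule continuous_open_preimage) (use h chart_open[OF c(1)] in \<open>auto simp: homeomorphism_def\<close>)
    then show ?thesis unfolding eventually_nhds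
      using c(2) e(1) \<beta>(2) by (intro exI[of _ "U \<inter> \<phi> -` ball (\<phi> x) (e / 2)"]) (auto simp: \<theta>_def)
  qed
  ultimately show ?thesis using that[of \<theta>] ev0 KW by (auto simp: Cinf_iff)
qed

text \<open>Every germ of a smooth function comes from a global one. Derivations act on global
  functions only, so local coordinates and coefficients are passed through this lemma.\<close>

lemma smooth_at_extend:
  assumes "smooth_at g x"
  obtains h where "h \<in> Cinf M" "eventually (\<lambda>y. h y = g y) (nhds x)"
proof -
  obtain W where W: "open W" "x \<in> W" "g \<in> Cinf_on M W" by (rule smooth_atE[OF assms])
  obtain \<theta> where \<theta>: "\<theta> \<in> Cinf M" "eventually (\<lambda>y. \<theta> y = 1) (nhds x)"
    "\<And>y. y \<notin> W \<Longrightarrow> eventually (\<lambda>z. \<theta> z = 0) (nhds y)" by (rule bump_exists[OF W(1,2)]) blast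
  have "smooth_at (\<lambda>y. \<theta> y * g y) y" for y
  proof (cases "y \<in> W")
    case True
    then have "smooth_at \<theta> y" "smooth_at g y" using W \<theta>(1) by (simp_all add: Cinf_on_iff Cinf_iff)
    then show ?thesis by (rule smooth_at_mult)
  next
    case False
    have "eventually (\<lambda>z. \<theta> z * g z = 0) (nhds y)" using \<theta>(3)[OF False] by eventually_elim simp
    from smooth_at_cong[OF this] show ?thesis by simp
  qed
  moreover have "eventually (\<lambda>y. \<theta> y * g y = g y) (nhds x)" using \<theta>(2) by eventually_elim simp
  ultimately show ?thesis using that[of "\<lambda>y. \<theta> y * g y"] by (simp add: Cinf_iff)
qed

section \<open>Derivations at a point\<close>

lemma tangent_comb:
  "v \<in> tangent M x \<Longrightarrow> g \<in> Cinf M \<Longrightarrow> h \<in> Cinf M \<Longrightarrow> v (\<lambda>y. a * g y + b * h y) = a * v g + b * v h"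
  unfolding tangent_def by auto

lemma tangent_mult:
  "v \<in> tangent M x \<Longrightarrow> g \<in> Cinf M \<Longrightarrow> h \<in> Cinf M \<Longrightarrow> v (\<lambda>y. g y * h y) = g x * v h + h x * v g"
  unfolding tangent_def by auto

lemma tangent_outside: "v \<in> tangent M x \<Longrightarrow> g \<notin> Cinf M \<Longrightarrow> v g = 0"
  unfolding tangent_def by auto

lemma tangent_const: "v \<in> tangent M x \<Longrightarrow> v (\<lambda>y. c) = 0"
  using tangent_mult[of v x "\<lambda>y. 1" "\<lambda>y. 1"] tangent_comb[of v x "\<lambda>y. 1" "\<lambda>y. 1" c 0] by simp

lemma tangent_add: "v \<in> tangent M x \<Longrightarrow> g \<in> Cinf M \<Longrightarrow> h \<in> Cinf M \<Longrightarrow> v (\<lambda>y. g y + h y) = v g + v h"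
  using tangent_comb[of v x g h 1 1] by simp

lemma tangent_diff: "v \<in> tangent M x \<Longrightarrow> g \<in> Cinf M \<Longrightarrow> h \<in> Cinf M \<Longrightarrow> v (\<lambda>y. g y - h y) = v g - v h"
  using tangent_comb[of v x g h 1 "-1"] by simp

lemma tangent_minus: "v \<in> tangent M x \<Longrightarrow> g \<in> Cinf M \<Longrightarrow> v (\<lambda>y. - g y) = - v g"
  using tangent_comb[of v x g g "-1" 0] by simp

lemma tangent_sum:
  assumes "v \<in> tangent M x" "\<And>i. i \<in> I \<Longrightarrow> g i \<in> Cinf M"
  shows "v (\<lambda>y. \<Sum>i\<in>I. g i y) = (\<Sum>i\<in>I. v (g i))"
  using assms(2)
proof (induction I rule: infinite_finite_induct)
  case (insert i I)
  have "v (\<lambda>y. g i y + (\<Sum>i\<in>I. g i y)) = v (g i) + v (\<lambda>y. \<Sum>i\<in>I. g i y)"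
    by (rule tangent_add[OF assms(1)]) (use insert in \<open>auto intro!: smooth_intros\<close>)
  then show ?case using insert by simp
qed (simp_all add: tangent_const[OF assms(1)])

text \<open>The difference d vanishes near x. For a cut-off \<theta> supported there, \<theta> d is
  identically 0, and the Leibniz rule turns v (\<theta> d) into v d, because \<theta> x = 1 and d x
  = 0.\<close>

lemma tangent_local:
  assumes v: "v \<in> tangent M x" and g: "g \<in> Cinf M" "h \<in> Cinf M" and e: "eventually (\<lambda>y. g y = h y) (nhds x)"
  shows "v g = v h"
proof -
  define d where "d y = g y - h y" for y
  have d: "d \<in> Cinf M" unfolding d_def[abs_def] using g by (rule Cinf_diff)
  obtain W where W: "open W" "x \<in> W" "\<And>y. y \<in> W \<Longrightarrow> g y = h y" using e unfolding eventually_nhds by blast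
  obtain \<theta> where \<theta>: "\<theta> \<in> Cinf M" "eventually (\<lambda>y. \<theta> y = 1) (nhds x)"
    "\<And>y. y \<notin> W \<Longrightarrow> eventually (\<lambda>z. \<theta> z = 0) (nhds y)" by (rule bump_exists[OF W(1,2)]) blast
  have z: "\<theta> y * d y = 0" for y
    using W(3)[of y] eventually_nhds_x_imp_x[OF \<theta>(3)[of y]] by (cases "y \<in> W") (auto simp: d_def)
  have "v (\<lambda>y. \<theta> y * d y) = \<theta> x * v d + d x * v \<theta>" by (rule tangent_mult[OF v \<theta>(1) d])
  moreover have "v (\<lambda>y. \<theta> y * d y) = 0" unfolding z by (rule tangent_const[OF v])
  moreover have "\<theta> x = 1" "d x = 0" using eventually_nhds_x_imp_x[OF \<theta>(2)] W by (auto simp: d_def)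
  ultimately have "v d = 0" by simp
  then show ?thesis using tangent_diff[OF v g] by (simp add: d_def[abs_def])
qed

section \<open>Coordinates and coordinate vector fields\<close>

lemma CinfI: "(\<And>x. smooth_at g x) \<Longrightarrow> g \<in> Cinf M"
  by (simp add: Cinf_iff)

lemma smooth_at_chart:
  assumes c: "(U, \<phi>) \<in> charts M" and T: "openin (top_of_set (model M)) T" "T \<subseteq> \<phi> ` U" "\<phi> x \<in> T" "x \<in> U"
    and K: "smooth_on (model M) T K"
  shows "smooth_at (\<lambda>y. K (\<phi> y)) x"
proof -
  have h: "homeomorphism U (\<phi> ` U) \<phi> (inv_into U \<phi>)" by (rule chart_homeo[OF c])
  obtain O' where O': "open O'" "T = model M \<inter> O'" using T(1) by (auto simp: openin_open)
  define W where "W = U \<inter> \<phi> -` O'"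
  have W: "open W" unfolding W_def
    by (rule continuous_open_preimage) (use h chart_open[OF c] O' in \<open>auto simp: homeomorphism_def\<close>)
  have im: "\<phi> ` W \<subseteq> T"
    using chart_image_open[OF c] O' openin_imp_subset unfolding W_def by blast
  have "smooth_on (model M) (\<phi> ` W) ((\<lambda>y. K (\<phi> y)) \<circ> inv_into U \<phi>)"
    by (rule smooth_on_cong[THEN iffD1, OF _ smooth_on_subset[OF K im]]) (auto simp: chart_inv[OF c] W_def)
  then have "(\<lambda>y. K (\<phi> y)) \<in> Cinf_on M W"
    by (rule Cinf_on_chartI[OF c W, rotated]) (simp add: W_def)
  then show ?thesis by (rule smooth_atI[OF W, rotated]) (use T O' in \<open>simp add: W_def\<close>)
qed

lemma vfieldsD: "X \<in> vfields M \<Longrightarrow> X x \<in> tangent M x"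
  "X \<in> vfields M \<Longrightarrow> g \<in> Cinf M \<Longrightarrow> (\<lambda>x. X x g) \<in> Cinf M"
  by (auto simp: vfields_def)

text \<open>Only first-order information is recorded: on U the y k behave as coordinates and the E k
  as the dual fields. Both are defined on all of M and no chart appears, so later arguments stay
  inside the algebra of derivations.\<close>

definition coordinates_on :: "'m set \<Rightarrow> (nat \<Rightarrow> 'm \<Rightarrow> real) \<Rightarrow> (nat \<Rightarrow> 'm \<Rightarrow> 'm tvec) \<Rightarrow> bool" where
  "coordinates_on U y E \<longleftrightarrow> open U \<and>
     (\<forall>k<dim (model M). y k \<in> Cinf M \<and> E k \<in> vfields M) \<and>
     (\<forall>z\<in>U. \<forall>v\<in>tangent M z. \<forall>g\<in>Cinf M. v g = (\<Sum>k<dim (model M). v (y k) * E k z g)) \<and>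
     (\<forall>z\<in>U. \<forall>j<dim (model M). \<forall>k<dim (model M). E j z (y k) = (if j = k then 1 else 0))"

lemma coordinates_onD:
  assumes "coordinates_on U y E"
  shows "open U" "k < dim (model M) \<Longrightarrow> y k \<in> Cinf M" "k < dim (model M) \<Longrightarrow> E k \<in> vfields M"
    "z \<in> U \<Longrightarrow> v \<in> tangent M z \<Longrightarrow> g \<in> Cinf M \<Longrightarrow> v g = (\<Sum>k<dim (model M). v (y k) * E k z g)"
    "z \<in> U \<Longrightarrow> j < dim (model M) \<Longrightarrow> k < dim (model M) \<Longrightarrow> E j z (y k) = (if j = k then 1 else 0)"
  using assms unfolding coordinates_on_def by simp_all

theorem coordinates_exist:
  obtains U y E where "coordinates_on U y E" "x \<in> U"
proof -
  let ?V = "model M"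
  obtain U0 \<phi> where c: "(U0, \<phi>) \<in> charts M" "x \<in> U0" using chart_exists .
  obtain b where b: "orthonormal_frame ?V b" using orthonormal_frame_exists[OF subspace_model] .
  have bV: "k < dim ?V \<Longrightarrow> b k \<in> ?V" for k using b by (simp add: orthonormal_frame_def)
  let ?i = "inv_into U0 \<phi>"
  let ?S = "\<phi> ` U0"
  have S: "openin (top_of_set ?V) ?S" by (rule chart_image_open[OF c(1)])
  have oU0: "open U0" by (rule chart_open[OF c(1)])
  have G: "smooth_on ?V ?S (g \<circ> ?i)" if "g \<in> Cinf M" for g using Cinf_onD[OF that c(1)] by simp
  note Gd = smooth_on_has_derivative[OF subspace_model S G b]
  have dd: "dir_deriv (b k) G p = A (b k)" if "k < dim ?V" "p \<in> ?S" "(G has_derivative A) (at p within ?S)"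
    for G :: "'e \<Rightarrow> real" and A k p
    by (rule dir_deriv_eq[OF subspace_model S that(2) bV[OF that(1)] that(3)])
  have "\<exists>h\<in>Cinf M. eventually (\<lambda>z. h z = \<phi> z \<bullet> b k) (nhds x)" for k
  proof -
    have "smooth_at (\<lambda>z. \<phi> z \<bullet> b k) x"
      by (rule smooth_at_chart[OF c(1) S order_refl _ c(2), where K = "\<lambda>p. p \<bullet> b k"])
        (use c(2) in \<open>auto intro!: smooth_on_linear bounded_linear_inner_left\<close>)
    then show ?thesis by (rule smooth_at_extend) blast
  qed
  then obtain y where y: "\<And>k. y k \<in> Cinf M" "\<And>k. eventually (\<lambda>z. y k z = \<phi> z \<bullet> b k) (nhds x)" by metis
  obtain \<theta> where \<theta>: "\<theta> \<in> Cinf M" "eventually (\<lambda>y. \<theta> y = 1) (nhds x)"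
    "\<And>y. y \<notin> U0 \<Longrightarrow> eventually (\<lambda>z. \<theta> z = 0) (nhds y)" using bump_exists[OF oU0 c(2)] by blast
  \<comment> \<open>U is shrunk until the cut-off is 1 and the globally extended y k are the chart
    coordinates; the asserted formulas concern points of U only.\<close>
  have "eventually (\<lambda>z. z \<in> U0 \<and> \<theta> z = 1 \<and> (\<forall>k\<in>{..<dim ?V}. y k z = \<phi> z \<bullet> b k)) (nhds x)"
    using \<theta>(2) y(2) oU0 c(2) by (intro eventually_conj eventually_ball_finite) (auto intro: eventually_nhds_in_open)
  then obtain U where U: "open U" "x \<in> U" "U \<subseteq> U0" "\<And>z. z \<in> U \<Longrightarrow> \<theta> z = 1"
    "\<And>z k. z \<in> U \<Longrightarrow> k < dim ?V \<Longrightarrow> y k z = \<phi> z \<bullet> b k"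
    unfolding eventually_nhds by blast
  \<comment> \<open>The coordinate field in direction \<open>b k\<close>, cut off by \<theta>. The
    value 0 on functions outside \<open>Cinf M\<close> is forced by the normalisation of tangent
    vectors.\<close>
  define E where "E k z g = (if g \<in> Cinf M \<and> z \<in> U0 then \<theta> z * dir_deriv (b k) (g \<circ> ?i) (\<phi> z) else 0)"
    for k :: nat and z g
  have Etan: "E k z \<in> tangent M z" if k: "k < dim ?V" for k z
  proof (cases "z \<in> U0")
    case True
    then have p: "\<phi> z \<in> ?S" by simp
    have iz: "?i (\<phi> z) = z" by (rule chart_inv[OF c(1) True])
    have "E k z (\<lambda>y. a * g y + d * h y) = a * E k z g + d * E k z h" if gh: "g \<in> Cinf M" "h \<in> Cinf M" for g h a d
    proof -
      have "((\<lambda>q. a * (g \<circ> ?i) q + d * (h \<circ> ?i) q) has_derivative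
         (\<lambda>w. a * (\<Sum>k<dim ?V. (w \<bullet> b k) *\<^sub>R dir_deriv (b k) (g \<circ> ?i) (\<phi> z)) +
              d * (\<Sum>k<dim ?V. (w \<bullet> b k) *\<^sub>R dir_deriv (b k) (h \<circ> ?i) (\<phi> z)))) (at (\<phi> z) within ?S)"
        by (intro has_derivative_add has_derivative_mult_right Gd gh p)
      from dd[OF k p this] dd[OF k p Gd[OF gh(1) p]] dd[OF k p Gd[OF gh(2) p]]
      have "dir_deriv (b k) (\<lambda>q. a * (g \<circ> ?i) q + d * (h \<circ> ?i) q) (\<phi> z) =
         a * dir_deriv (b k) (g \<circ> ?i) (\<phi> z) + d * dir_deriv (b k) (h \<circ> ?i) (\<phi> z)" by simp
      moreover have "(\<lambda>y. a * g y + d * h y) \<in> Cinf M" by (intro smooth_intros gh)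
      ultimately show ?thesis using True gh by (simp add: E_def o_def algebra_simps)
    qed
    moreover have "E k z (\<lambda>y. g y * h y) = g z * E k z h + h z * E k z g" if gh: "g \<in> Cinf M" "h \<in> Cinf M" for g h
    proof -
      have "((\<lambda>q. (g \<circ> ?i) q * (h \<circ> ?i) q) has_derivative
         (\<lambda>w. (g \<circ> ?i) (\<phi> z) * (\<Sum>k<dim ?V. (w \<bullet> b k) *\<^sub>R dir_deriv (b k) (h \<circ> ?i) (\<phi> z)) +
              (\<Sum>k<dim ?V. (w \<bullet> b k) *\<^sub>R dir_deriv (b k) (g \<circ> ?i) (\<phi> z)) * (h \<circ> ?i) (\<phi> z))) (at (\<phi> z) within ?S)"
        by (intro has_derivative_mult Gd gh p)
      from dd[OF k p this] dd[OF k p Gd[OF gh(1) p]] dd[OF k p Gd[OF gh(2) p]]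
      have "dir_deriv (b k) (\<lambda>q. (g \<circ> ?i) q * (h \<circ> ?i) q) (\<phi> z) =
         g z * dir_deriv (b k) (h \<circ> ?i) (\<phi> z) + dir_deriv (b k) (g \<circ> ?i) (\<phi> z) * h z" by (simp add: iz)
      moreover have "(\<lambda>y. g y * h y) \<in> Cinf M" by (intro smooth_intros gh)
      ultimately show ?thesis using True gh by (simp add: E_def o_def algebra_simps)
    qed
    ultimately show ?thesis unfolding tangent_def by (simp add: E_def)
  qed (simp add: tangent_def E_def)
  have Evf: "E k \<in> vfields M" if k: "k < dim ?V" for k
  proof -
    have *: "smooth_at (\<lambda>z. E k z g) z" if g: "g \<in> Cinf M" for g z
    proof (cases "z \<in> U0")
      case True
      have "smooth_at (\<lambda>z. dir_deriv (b k) (g \<circ> ?i) (\<phi> z)) z"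
        by (rule smooth_at_chart[OF c(1) S order_refl _ True
            smooth_on_dir_deriv[OF subspace_model S G[OF g] bV[OF k]]]) (use True in simp)
      then have "smooth_at (\<lambda>z. \<theta> z * dir_deriv (b k) (g \<circ> ?i) (\<phi> z)) z"
        by (rule smooth_at_mult[OF Cinf_smooth_at[OF \<theta>(1)]])
      moreover have "eventually (\<lambda>z. E k z g = \<theta> z * dir_deriv (b k) (g \<circ> ?i) (\<phi> z)) (nhds z)"
        using eventually_nhds_in_open[OF oU0 True] by eventually_elim (simp add: E_def g)
      ultimately show ?thesis by (simp add: smooth_at_cong)
    next
      case False
      have "eventually (\<lambda>z. E k z g = 0) (nhds z)" using \<theta>(3)[OF False]
        by eventually_elim (simp add: E_def)
      then show ?thesis by (simp add: smooth_at_cong)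
    qed
    have "(\<lambda>z. E k z g) \<in> Cinf M" if "g \<in> Cinf M" for g
      by (rule CinfI) (rule *[OF that])
    then show ?thesis using Etan[OF k] by (simp add: vfields_def)
  qed
  have delta: "E j z (y k) = (if j = k then 1 else 0)" if z: "z \<in> U" and jk: "j < dim ?V" "k < dim ?V" for z j k
  proof -
    have zU0: "z \<in> U0" "\<phi> z \<in> ?S" using z U(3) by auto
    let ?T = "\<phi> ` (U0 \<inter> U)"
    have T: "openin (top_of_set ?V) ?T" by (rule chart_open_image[OF c(1) U(1)])
    have pT: "\<phi> z \<in> ?T" using z zU0 by simp
    have "((\<lambda>q. q \<bullet> b k) has_derivative (\<lambda>w. w \<bullet> b k)) (at (\<phi> z) within ?T)"
      by (intro bounded_linear_imp_has_derivative bounded_linear_inner_left)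
    then have "((y k \<circ> ?i) has_derivative (\<lambda>w. w \<bullet> b k)) (at (\<phi> z) within ?T)"
      by (rule has_derivative_transform[OF pT, rotated]) (use U(5) jk chart_inv[OF c(1)] in auto)
    from dir_deriv_eq[OF subspace_model T pT bV[OF jk(1)] this]
    show ?thesis using b jk zU0 U(4)[OF z] y(1) by (simp add: E_def orthonormal_frame_def)
  qed
  have expand: "v g = (\<Sum>k<dim ?V. v (y k) * E k z g)"
    if z: "z \<in> U" and v: "v \<in> tangent M z" and g: "g \<in> Cinf M" for z v g
  proof -
    have zU0: "z \<in> U0" "\<phi> z \<in> ?S" using z U(3) by auto
    have iz: "?i (\<phi> z) = z" by (rule chart_inv[OF c(1) zU0(1)])
    obtain O' where O': "open O'" "\<phi> ` (U0 \<inter> U) = ?V \<inter> O'"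
      using chart_open_image[OF c(1) U(1)] by (auto simp: openin_open)
    then have "\<phi> z \<in> O'" using zU0 z by blast
    then obtain e where e: "e > 0" "ball (\<phi> z) e \<subseteq> O'" using O'(1) open_contains_ball by blast
    define T where "T = ?V \<inter> ball (\<phi> z) e"
    have T: "openin (top_of_set ?V) T" unfolding T_def by (simp add: openin_open_Int)
    have Tc: "convex T" unfolding T_def
      by (intro convex_Int subspace_imp_convex subspace_model convex_ball)
    have pV: "\<phi> z \<in> ?V" using O'(2) zU0 z by blast
    have pT: "\<phi> z \<in> T" using pV e unfolding T_def by simp
    have TS: "T \<subseteq> \<phi> ` (U0 \<inter> U)" using O'(2) e(2) unfolding T_def by blast
    \<comment> \<open>Hadamard's lemma based at z itself, on a ball in the chart: its coefficients
      at z are the partial derivatives of g.\<close>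
    obtain H where H: "\<And>k. k < dim ?V \<Longrightarrow> smooth_on ?V T (H k)"
      "\<And>k. k < dim ?V \<Longrightarrow> H k (\<phi> z) = dir_deriv (b k) (g \<circ> ?i) (\<phi> z)"
      "\<And>q. q \<in> T \<Longrightarrow> (g \<circ> ?i) q = (g \<circ> ?i) (\<phi> z) + (\<Sum>k<dim ?V. ((q - \<phi> z) \<bullet> b k) * H k q)"
      by (rule hadamard[OF subspace_model T Tc pT smooth_on_subset[OF G[OF g]] b]) (use TS in auto)
    have "\<exists>h\<in>Cinf M. eventually (\<lambda>w. h w = H k (\<phi> w)) (nhds z)" if k: "k < dim ?V" for k
    proof -
      have "smooth_at (\<lambda>w. H k (\<phi> w)) z"
        by (rule smooth_at_chart[OF c(1) T _ pT zU0(1) H(1)[OF k]]) (use TS in auto)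
      then show ?thesis by (rule smooth_at_extend) blast
    qed
    then obtain h where h: "\<And>k. k < dim ?V \<Longrightarrow> h k \<in> Cinf M"
      "\<And>k. k < dim ?V \<Longrightarrow> eventually (\<lambda>w. h k w = H k (\<phi> w)) (nhds z)" by metis
    have homeo: "homeomorphism U0 ?S \<phi> ?i" by (rule chart_homeo[OF c(1)])
    have "open (U0 \<inter> \<phi> -` ball (\<phi> z) e)"
      by (rule continuous_open_preimage) (use homeo oU0 in \<open>auto simp: homeomorphism_def\<close>)
    then have "eventually (\<lambda>w. w \<in> U0 \<inter> \<phi> -` ball (\<phi> z) e) (nhds z)"
      using zU0 e by (intro eventually_nhds_in_open) auto
    moreover have "eventually (\<lambda>w. \<forall>k\<in>{..<dim ?V}. h k w = H k (\<phi> w)) (nhds z)"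
      using h(2) by (intro eventually_ball_finite) auto
    moreover have "eventually (\<lambda>w. w \<in> U) (nhds z)" by (rule eventually_nhds_in_open[OF U(1) z])
    ultimately have ev: "eventually (\<lambda>w. g w = g z + (\<Sum>k<dim ?V. (y k w - y k z) * h k w)) (nhds z)"
    proof eventually_elim
      case (elim w)
      have "\<phi> w \<in> ?V" using elim chart_image_open[OF c(1)] openin_imp_subset by blast
      then have "\<phi> w \<in> T" using elim unfolding T_def by auto
      from H(3)[OF this] have "g w = g z + (\<Sum>k<dim ?V. ((\<phi> w - \<phi> z) \<bullet> b k) * H k (\<phi> w))"
        using elim chart_inv[OF c(1)] by (simp add: iz)
      then show ?case using elim U(5) z by (simp add: inner_diff_left)
    qed
    have yd: "(\<lambda>w. y k w - y k z) \<in> Cinf M" for k by (intro smooth_intros y)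
    have rC: "(\<lambda>w. \<Sum>k<dim ?V. (y k w - y k z) * h k w) \<in> Cinf M"
      by (intro smooth_intros) (auto intro!: smooth_intros y h)
    have "v g = v (\<lambda>w. g z + (\<Sum>k<dim ?V. (y k w - y k z) * h k w))"
      by (rule tangent_local[OF v g _ ev]) (intro Cinf_add Cinf_const rC)
    also have "\<dots> = v (\<lambda>w. \<Sum>k<dim ?V. (y k w - y k z) * h k w)"
      using tangent_add[OF v Cinf_const rC] tangent_const[OF v] by simp
    also have "\<dots> = (\<Sum>k<dim ?V. v (\<lambda>w. (y k w - y k z) * h k w))"
      by (rule tangent_sum[OF v]) (auto intro!: smooth_intros y h)
    also have "\<dots> = (\<Sum>k<dim ?V. v (y k) * E k z g)"
    proof (rule sum.cong[OF refl])
      fix k assume "k \<in> {..<dim ?V}"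
      then have k: "k < dim ?V" by simp
      \<comment> \<open>The first factor vanishes at z, so the Leibniz rule leaves a single
        term.\<close>
      have "v (\<lambda>w. (y k w - y k z) * h k w) = h k z * v (\<lambda>w. y k w - y k z)"
        using tangent_mult[OF v yd h(1)[OF k]] by simp
      also have "v (\<lambda>w. y k w - y k z) = v (y k)"
        using tangent_diff[OF v y(1) Cinf_const] tangent_const[OF v] by simp
      also have "h k z = E k z g"
        using eventually_nhds_x_imp_x[OF h(2)[OF k]] H(2)[OF k] U(4)[OF z] zU0 g by (simp add: E_def)
      finally show "v (\<lambda>w. (y k w - y k z) * h k w) = v (y k) * E k z g" by simp
    qed
    finally show ?thesis .
  qed
  have "coordinates_on U y E"
    unfolding coordinates_on_def using U(1) y(1) Evf expand delta by simp
  then show ?thesis using U(2) by (rule that)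
qed

end

lemma smooth_map_Cinf:
  fixes B :: "('b::{t2_space, second_countable_topology}, 'd::euclidean_space) manifold"
    and M :: "('m::{t2_space, second_countable_topology}, 'e::euclidean_space) manifold"
  assumes B: "smooth_manifold B" and M: "smooth_manifold M" and f: "smooth_map B M f" and g: "g \<in> Cinf M"
  shows "g \<circ> f \<in> Cinf B"
proof -
  interpret B: smooth_mfd B by standard (rule B)
  interpret M: smooth_mfd M by standard (rule M)
  have cf: "continuous_on UNIV f" using f by (simp add: smooth_map_def)
  have "B.smooth_at (g \<circ> f) x" for x
  proof -
    obtain U \<phi> where c: "(U, \<phi>) \<in> charts B" "x \<in> U" using B.chart_exists .
    obtain W \<psi> where d: "(W, \<psi>) \<in> charts M" "f x \<in> W" using M.chart_exists .
    let ?N = "U \<inter> f -` W"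
    have oN: "open ?N" using B.chart_open[OF c(1)] M.chart_open[OF d(1)] cf
      by (intro open_Int open_vimage) auto
    have s: "smooth_on (model B) (\<phi> ` ?N) (\<psi> \<circ> f \<circ> inv_into U \<phi>)"
      using f c(1) d(1) unfolding smooth_map_def by fast
    have "smooth_on (model B) (\<phi> ` ?N) (\<lambda>q. (g \<circ> inv_into W \<psi>) ((\<psi> \<circ> f \<circ> inv_into U \<phi>) q))"
    proof (rule smooth_on_compose[OF B.subspace_model M.subspace_model _ M.chart_image_open[OF d(1)] _ s])
      show "openin (top_of_set (model B)) (\<phi> ` ?N)"
        using B.chart_open_image[OF c(1) oN] by (simp add: Int_assoc[symmetric])
      show "(\<psi> \<circ> f \<circ> inv_into U \<phi>) ` \<phi> ` ?N \<subseteq> \<psi> ` W" using B.chart_inv[OF c(1)] by auto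
      show "smooth_on (model M) (\<psi> ` W) (g \<circ> inv_into W \<psi>)" using M.Cinf_onD[OF g d(1)] by simp
    qed
    then have "smooth_on (model B) (\<phi> ` ?N) ((g \<circ> f) \<circ> inv_into U \<phi>)"
      by (rule smooth_on_cong[THEN iffD1, rotated]) (auto simp: B.chart_inv[OF c(1)] M.chart_inv[OF d(1)])
    then have "g \<circ> f \<in> Cinf_on B ?N" by (rule B.Cinf_on_chartI[OF c(1) oN, rotated]) simp
    then show ?thesis by (rule B.smooth_atI[OF oN, rotated]) (use c d in simp)
  qed
  then show ?thesis by (simp add: B.Cinf_iff)
qed

section \<open>Cartan calculus and the Courant bracket\<close>

lemma fun_plus_apply: "(f + g) x = f x + g x" by (simp add: plus_fun_def)
lemma fun_scaleR_apply: "(c *\<^sub>R f) x = c *\<^sub>R f x" by (simp add: scaleR_fun_def)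
lemma fun_sum_apply: "(\<Sum>i\<in>I. f i) x = (\<Sum>i\<in>I. f i x)"
  by (induction I rule: infinite_finite_induct) (auto simp: plus_fun_def zero_fun_def)
lemmas fun_apply = fun_plus_apply fun_scaleR_apply fun_sum_apply uminus_apply minus_apply zero_fun_def[THEN fun_cong]

context smooth_mfd begin

section \<open>Vector fields and their bracket\<close>

lemma tangentI:
  assumes "\<And>g h a b. g \<in> Cinf M \<Longrightarrow> h \<in> Cinf M \<Longrightarrow> v (\<lambda>y. a * g y + b * h y) = a * v g + b * v h"
    "\<And>g h. g \<in> Cinf M \<Longrightarrow> h \<in> Cinf M \<Longrightarrow> v (\<lambda>y. g y * h y) = g x * v h + h x * v g"
    "\<And>g. g \<notin> Cinf M \<Longrightarrow> v g = 0"
  shows "v \<in> tangent M x"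
  unfolding tangent_def using assms by blast

lemma subspace_tangent: "subspace (tangent M x)"
  unfolding subspace_def
proof (intro conjI ballI allI)
  show "0 \<in> tangent M x" by (rule tangentI) (simp_all add: fun_apply)
  show "v + w \<in> tangent M x" if "v \<in> tangent M x" "w \<in> tangent M x" for v w
    by (rule tangentI)
      (simp_all add: fun_apply tangent_comb[OF that(1)] tangent_comb[OF that(2)] tangent_mult[OF that(1)]
        tangent_mult[OF that(2)] tangent_outside[OF that(1)] tangent_outside[OF that(2)] algebra_simps)
  show "c *\<^sub>R v \<in> tangent M x" if "v \<in> tangent M x" for c v
    by (rule tangentI)
      (simp_all add: fun_apply tangent_comb[OF that] tangent_mult[OF that] tangent_outside[OF that] algebra_simps)
qed

lemma tangent_eqI:
  assumes "v \<in> tangent M x" "w \<in> tangent M x" "\<And>g. g \<in> Cinf M \<Longrightarrow> v g = w g"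
  shows "v = w"
proof
  show "v g = w g" for g
    using assms(3)[of g] tangent_outside[OF assms(1), of g] tangent_outside[OF assms(2), of g]
    by (cases "g \<in> Cinf M") simp_all
qed

lemma vfieldsI:
  assumes "\<And>x. X x \<in> tangent M x" "\<And>g. g \<in> Cinf M \<Longrightarrow> (\<lambda>x. X x g) \<in> Cinf M"
  shows "X \<in> vfields M"
  using assms by (simp add: vfields_def)

lemma vfields_zero: "(\<lambda>x. 0) \<in> vfields M"
  by (rule vfieldsI) (simp_all add: fun_apply subspace_0[OF subspace_tangent])

lemma vfields_add: "X \<in> vfields M \<Longrightarrow> Y \<in> vfields M \<Longrightarrow> (\<lambda>x. X x + Y x) \<in> vfields M"
  by (rule vfieldsI, rule subspace_add[OF subspace_tangent vfieldsD(1) vfieldsD(1)], assumption, assumption,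
      unfold fun_apply, rule Cinf_add[OF vfieldsD(2) vfieldsD(2)])

lemma vfields_scale: "h \<in> Cinf M \<Longrightarrow> X \<in> vfields M \<Longrightarrow> (\<lambda>x. h x *\<^sub>R X x) \<in> vfields M"
  by (rule vfieldsI, rule subspace_mul[OF subspace_tangent vfieldsD(1)], assumption,
      unfold fun_apply real_scaleR_def, rule Cinf_mult[OF _ vfieldsD(2)])

lemma vfields_sum: "(\<And>i. i \<in> I \<Longrightarrow> X i \<in> vfields M) \<Longrightarrow> (\<lambda>x. \<Sum>i\<in>I. X i x) \<in> vfields M"
  by (induction I rule: infinite_finite_induct) (simp_all add: vfields_zero vfields_add)

lemma tangent_expand:
  assumes c: "coordinates_on U y E" and z: "z \<in> U" and v: "v \<in> tangent M z"
  shows "v = (\<Sum>k<dim (model M). v (y k) *\<^sub>R E k z)"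
proof (rule tangent_eqI[OF v])
  show "(\<Sum>k<dim (model M). v (y k) *\<^sub>R E k z) \<in> tangent M z"
    by (intro subspace_sum[OF subspace_tangent] subspace_mul[OF subspace_tangent] vfieldsD(1) coordinates_onD(3)[OF c]) simp
  show "v g = (\<Sum>k<dim (model M). v (y k) *\<^sub>R E k z) g" if "g \<in> Cinf M" for g
    unfolding fun_apply real_scaleR_def by (rule coordinates_onD(4)[OF c z v that])
qed

text \<open>The witness behind the choice operator is the combination of coordinate fields with the
  constant coefficients v (y k); these fields already live on all of M.\<close>

lemma extension:
  assumes v: "v \<in> tangent M x"
  shows "extension M x v \<in> vfields M" "extension M x v x = v"
proof -
  obtain U y E where c: "coordinates_on U y E" "x \<in> U" by (rule coordinates_exist)
  define X where "X z = (\<Sum>k<dim (model M). v (y k) *\<^sub>R E k z)" for z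
  have X: "X \<in> vfields M" unfolding X_def[abs_def]
    by (intro vfields_sum vfields_scale Cinf_const coordinates_onD(3)[OF c(1)]) simp
  have "X x = v" using tangent_expand[OF c v] by (simp add: X_def)
  with X have "\<exists>X. X \<in> vfields M \<and> X x = v" by blast
  from someI_ex[OF this] show "extension M x v \<in> vfields M" "extension M x v x = v"
    unfolding extension_def by blast+
qed

lemma vf_bracket_vfields:
  assumes X: "X \<in> vfields M" and Y: "Y \<in> vfields M"
  shows "vf_bracket X Y \<in> vfields M"
proof (rule vfieldsI)
  note tX = vfieldsD(1)[OF X] and tY = vfieldsD(1)[OF Y] and sX = vfieldsD(2)[OF X] and sY = vfieldsD(2)[OF Y]
  show "vf_bracket X Y x \<in> tangent M x" for x
  proof (rule tangentI)
    fix g h a b assume gh: "g \<in> Cinf M" "h \<in> Cinf M"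
    show "vf_bracket X Y x (\<lambda>y. a * g y + b * h y) = a * vf_bracket X Y x g + b * vf_bracket X Y x h"
      unfolding vf_bracket_def tangent_comb[OF tX gh] tangent_comb[OF tY gh]
        tangent_comb[OF tX sY[OF gh(1)] sY[OF gh(2)]] tangent_comb[OF tY sX[OF gh(1)] sX[OF gh(2)]]
      by (simp add: algebra_simps)
    have m: "(\<lambda>y. g y * X y h) \<in> Cinf M" "(\<lambda>y. h y * X y g) \<in> Cinf M" "(\<lambda>y. g y * Y y h) \<in> Cinf M" "(\<lambda>y. h y * Y y g) \<in> Cinf M"
      by (intro smooth_intros gh sX sY)+
    show "vf_bracket X Y x (\<lambda>y. g y * h y) = g x * vf_bracket X Y x h + h x * vf_bracket X Y x g"
      unfolding vf_bracket_def tangent_mult[OF tX gh] tangent_mult[OF tY gh]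
        tangent_add[OF tX m(3,4)] tangent_add[OF tY m(1,2)]
        tangent_mult[OF tX gh(1) sY[OF gh(2)]] tangent_mult[OF tX gh(2) sY[OF gh(1)]]
        tangent_mult[OF tY gh(1) sX[OF gh(2)]] tangent_mult[OF tY gh(2) sX[OF gh(1)]]
      by (simp add: algebra_simps)
  next
    fix g assume g: "g \<notin> Cinf M"
    show "vf_bracket X Y x g = 0"
      by (simp add: vf_bracket_def tangent_outside[OF tX g] tangent_outside[OF tY g]
          tangent_const[OF tX] tangent_const[OF tY])
  qed
  show "(\<lambda>x. vf_bracket X Y x g) \<in> Cinf M" if "g \<in> Cinf M" for g
    unfolding vf_bracket_def by (intro smooth_intros sX sY that)
qed

lemma vf_bracket_jacobi:
  assumes X: "X \<in> vfields M" and Y: "Y \<in> vfields M" and Z: "Z \<in> vfields M"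
  shows "vf_bracket X (vf_bracket Y Z) x = vf_bracket (vf_bracket X Y) Z x + vf_bracket Y (vf_bracket X Z) x"
proof (rule tangent_eqI)
  note b = vf_bracket_vfields
  note s = vfieldsD(2)
  show "vf_bracket X (vf_bracket Y Z) x \<in> tangent M x"
    "vf_bracket (vf_bracket X Y) Z x + vf_bracket Y (vf_bracket X Z) x \<in> tangent M x"
    by (intro vfieldsD(1) b subspace_add[OF subspace_tangent] assms)+
  fix g assume g: "g \<in> Cinf M"
  show "vf_bracket X (vf_bracket Y Z) x g = (vf_bracket (vf_bracket X Y) Z x + vf_bracket Y (vf_bracket X Z) x) g"
    unfolding fun_apply vf_bracket_def
      tangent_diff[OF vfieldsD(1)[OF X] s[OF Y s[OF Z g]] s[OF Z s[OF Y g]]]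
      tangent_diff[OF vfieldsD(1)[OF Y] s[OF X s[OF Z g]] s[OF Z s[OF X g]]]
      tangent_diff[OF vfieldsD(1)[OF Z] s[OF X s[OF Y g]] s[OF Y s[OF X g]]]
    by simp
qed

lemma vf_bracket_antisym: "vf_bracket X Y x = - vf_bracket Y X x"
  by (simp add: vf_bracket_def fun_eq_iff fun_apply)

lemma vf_bracket_comb:
  assumes "X \<in> vfields M" "Y \<in> vfields M" "Z \<in> vfields M"
  shows "vf_bracket (\<lambda>x. a *\<^sub>R X x + b *\<^sub>R Y x) Z x = a *\<^sub>R vf_bracket X Z x + b *\<^sub>R vf_bracket Y Z x"
proof (rule tangent_eqI)
  show "vf_bracket (\<lambda>x. a *\<^sub>R X x + b *\<^sub>R Y x) Z x \<in> tangent M x"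
    "a *\<^sub>R vf_bracket X Z x + b *\<^sub>R vf_bracket Y Z x \<in> tangent M x"
    by (intro vfieldsD(1) vf_bracket_vfields vfields_add vfields_scale Cinf_const assms
        subspace_add[OF subspace_tangent] subspace_mul[OF subspace_tangent])+
  fix g assume g: "g \<in> Cinf M"
  show "vf_bracket (\<lambda>x. a *\<^sub>R X x + b *\<^sub>R Y x) Z x g = (a *\<^sub>R vf_bracket X Z x + b *\<^sub>R vf_bracket Y Z x) g"
    unfolding vf_bracket_def fun_apply real_scaleR_def
      tangent_comb[OF vfieldsD(1)[OF assms(3)] vfieldsD(2)[OF assms(1) g] vfieldsD(2)[OF assms(2) g]]
    by (simp add: algebra_simps)
qed

lemma vf_bracket_leibniz:
  assumes h: "h \<in> Cinf M" and X: "X \<in> vfields M" and Y: "Y \<in> vfields M"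
  shows "vf_bracket X (\<lambda>x. h x *\<^sub>R Y x) x = h x *\<^sub>R vf_bracket X Y x + X x h *\<^sub>R Y x"
proof (rule tangent_eqI)
  show "vf_bracket X (\<lambda>x. h x *\<^sub>R Y x) x \<in> tangent M x"
    "h x *\<^sub>R vf_bracket X Y x + X x h *\<^sub>R Y x \<in> tangent M x"
    by (intro vfieldsD(1) vf_bracket_vfields vfields_scale assms
        subspace_add[OF subspace_tangent] subspace_mul[OF subspace_tangent])+
  fix g assume g: "g \<in> Cinf M"
  show "vf_bracket X (\<lambda>x. h x *\<^sub>R Y x) x g = (h x *\<^sub>R vf_bracket X Y x + X x h *\<^sub>R Y x) g"
    unfolding vf_bracket_def fun_apply real_scaleR_def
      tangent_mult[OF vfieldsD(1)[OF X] h vfieldsD(2)[OF Y g]]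
    by (simp add: algebra_simps)
qed

section \<open>Covectors and one-forms\<close>

lemma cotangent_comb:
  "\<xi> \<in> cotangent M x \<Longrightarrow> v \<in> tangent M x \<Longrightarrow> w \<in> tangent M x \<Longrightarrow> \<xi> (a *\<^sub>R v + b *\<^sub>R w) = a * \<xi> v + b * \<xi> w"
  unfolding cotangent_def by blast

lemma cotangent_outside: "\<xi> \<in> cotangent M x \<Longrightarrow> v \<notin> tangent M x \<Longrightarrow> \<xi> v = 0"
  unfolding cotangent_def by blast

lemma cotangentI:
  assumes "\<And>v w a b. v \<in> tangent M x \<Longrightarrow> w \<in> tangent M x \<Longrightarrow> \<xi> (a *\<^sub>R v + b *\<^sub>R w) = a * \<xi> v + b * \<xi> w"
    "\<And>v. v \<notin> tangent M x \<Longrightarrow> \<xi> v = 0"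
  shows "\<xi> \<in> cotangent M x"
  unfolding cotangent_def using assms by blast

lemma cotangent_add:
  "\<xi> \<in> cotangent M x \<Longrightarrow> v \<in> tangent M x \<Longrightarrow> w \<in> tangent M x \<Longrightarrow> \<xi> (v + w) = \<xi> v + \<xi> w"
  using cotangent_comb[of \<xi> x v w 1 1] by simp

lemma cotangent_scale: "\<xi> \<in> cotangent M x \<Longrightarrow> v \<in> tangent M x \<Longrightarrow> \<xi> (a *\<^sub>R v) = a * \<xi> v"
  using cotangent_comb[of \<xi> x v v a 0] by simp

lemma cotangent_sum:
  assumes "\<xi> \<in> cotangent M x" "\<And>i. i \<in> I \<Longrightarrow> v i \<in> tangent M x"
  shows "\<xi> (\<Sum>i\<in>I. c i *\<^sub>R v i) = (\<Sum>i\<in>I. c i * \<xi> (v i))"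
proof -
  have z: "\<xi> 0 = 0" using cotangent_scale[OF assms(1) subspace_0[OF subspace_tangent], of 0] by simp
  show ?thesis using assms(2)
  proof (induction I rule: infinite_finite_induct)
    case (insert i I)
    have "(\<Sum>i\<in>I. c i *\<^sub>R v i) \<in> tangent M x"
      using insert by (intro subspace_sum[OF subspace_tangent] subspace_mul[OF subspace_tangent]) auto
    moreover have "c i *\<^sub>R v i \<in> tangent M x" "v i \<in> tangent M x"
      using insert by (auto intro: subspace_mul[OF subspace_tangent])
    ultimately have "\<xi> (c i *\<^sub>R v i + (\<Sum>i\<in>I. c i *\<^sub>R v i)) = c i * \<xi> (v i) + (\<Sum>i\<in>I. c i * \<xi> (v i))"
      using insert by (subst cotangent_add[OF assms(1)]) (auto simp: cotangent_scale[OF assms(1)])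
    then show ?case by (simp only: sum.insert[OF insert(1,2)])
  qed (simp_all add: z)
qed

lemma subspace_cotangent: "subspace (cotangent M x)"
  unfolding subspace_def
proof (intro conjI ballI allI)
  show "0 \<in> cotangent M x" by (rule cotangentI) (simp_all add: fun_apply)
  show "v + w \<in> cotangent M x" if "v \<in> cotangent M x" "w \<in> cotangent M x" for v w
    by (rule cotangentI)
      (simp_all add: fun_apply cotangent_comb[OF that(1)] cotangent_comb[OF that(2)]
        cotangent_outside[OF that(1)] cotangent_outside[OF that(2)] algebra_simps)
  show "c *\<^sub>R v \<in> cotangent M x" if "v \<in> cotangent M x" for c v
    by (rule cotangentI)
      (simp_all add: fun_apply cotangent_comb[OF that] cotangent_outside[OF that] algebra_simps)
qed

text \<open>Covectors are tested on vector fields instead of single vectors because the Cartan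
  formulas are available for fields; as every tangent vector extends to a field, nothing is
  lost.\<close>

lemma cotangent_eqI:
  assumes "\<xi> \<in> cotangent M x" "\<eta> \<in> cotangent M x" "\<And>W. W \<in> vfields M \<Longrightarrow> \<xi> (W x) = \<eta> (W x)"
  shows "\<xi> = \<eta>"
proof
  fix v
  show "\<xi> v = \<eta> v"
  proof (cases "v \<in> tangent M x")
    case True
    then show ?thesis using assms(3)[OF extension(1)[OF True]] extension(2)[OF True] by simp
  qed (simp add: cotangent_outside[OF assms(1)] cotangent_outside[OF assms(2)])
qed

lemma formsD: "\<xi> \<in> forms M \<Longrightarrow> \<xi> x \<in> cotangent M x"
  "\<xi> \<in> forms M \<Longrightarrow> X \<in> vfields M \<Longrightarrow> (\<lambda>x. \<xi> x (X x)) \<in> Cinf M"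
  by (auto simp: forms_def)

lemma formsI:
  assumes "\<And>x. \<xi> x \<in> cotangent M x" "\<And>X. X \<in> vfields M \<Longrightarrow> (\<lambda>x. \<xi> x (X x)) \<in> Cinf M"
  shows "\<xi> \<in> forms M"
  using assms by (simp add: forms_def)

lemma forms_add:
  assumes "\<xi> \<in> forms M" "\<eta> \<in> forms M"
  shows "(\<lambda>x. \<xi> x + \<eta> x) \<in> forms M"
proof (rule formsI)
  show "\<xi> x + \<eta> x \<in> cotangent M x" for x
    by (intro subspace_add[OF subspace_cotangent] formsD(1) assms)
  show "(\<lambda>x. (\<xi> x + \<eta> x) (X x)) \<in> Cinf M" if "X \<in> vfields M" for X
    unfolding fun_apply by (rule Cinf_add[OF formsD(2)[OF assms(1) that] formsD(2)[OF assms(2) that]])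
qed

lemma forms_scale:
  assumes "h \<in> Cinf M" "\<xi> \<in> forms M"
  shows "(\<lambda>x. h x *\<^sub>R \<xi> x) \<in> forms M"
proof (rule formsI)
  show "h x *\<^sub>R \<xi> x \<in> cotangent M x" for x
    by (intro subspace_mul[OF subspace_cotangent] formsD(1) assms)
  show "(\<lambda>x. (h x *\<^sub>R \<xi> x) (X x)) \<in> Cinf M" if "X \<in> vfields M" for X
    unfolding fun_apply real_scaleR_def by (rule Cinf_mult[OF assms(1) formsD(2)[OF assms(2) that]])
qed

text \<open>Near \<open>x\<close>, the form \<open>\<xi>\<close> is \<open>\<Sum>\<^sub>i p\<^sub>i dq\<^sub>i\<close>.\<close>

definition presents_form :: "('m \<Rightarrow> 'm cotvec) \<Rightarrow> 'm \<Rightarrow> 'i set \<Rightarrow> ('i \<Rightarrow> 'm \<Rightarrow> real) \<Rightarrow> ('i \<Rightarrow> 'm \<Rightarrow> real) \<Rightarrow> bool" where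
  "presents_form \<xi> x I p q \<longleftrightarrow> (\<forall>i\<in>I. p i \<in> Cinf M \<and> q i \<in> Cinf M) \<and>
     eventually (\<lambda>z. \<forall>v\<in>tangent M z. \<xi> z v = (\<Sum>i\<in>I. p i z * v (q i))) (nhds x)"

lemma presents_formD:
  assumes "presents_form \<xi> x I p q"
  shows "i \<in> I \<Longrightarrow> p i \<in> Cinf M" "i \<in> I \<Longrightarrow> q i \<in> Cinf M"
    and "eventually (\<lambda>z. \<forall>v\<in>tangent M z. \<xi> z v = (\<Sum>i\<in>I. p i z * v (q i))) (nhds x)"
    and "v \<in> tangent M x \<Longrightarrow> \<xi> x v = (\<Sum>i\<in>I. p i x * v (q i))"
proof -
  show *: "eventually (\<lambda>z. \<forall>v\<in>tangent M z. \<xi> z v = (\<Sum>i\<in>I. p i z * v (q i))) (nhds x)"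
    and "i \<in> I \<Longrightarrow> p i \<in> Cinf M" "i \<in> I \<Longrightarrow> q i \<in> Cinf M"
    using assms unfolding presents_form_def by simp_all
  show "v \<in> tangent M x \<Longrightarrow> \<xi> x v = (\<Sum>i\<in>I. p i x * v (q i))"
    using eventually_nhds_x_imp_x[OF *] by blast
qed

section \<open>Lie derivative and exterior derivative of a presented form\<close>

lemma presents_form_deriv:
  assumes r: "presents_form \<xi> x I p q" and \<xi>: "\<xi> \<in> forms M" and Z: "Z \<in> vfields M" and v: "v \<in> tangent M x"
  shows "v (\<lambda>z. \<xi> z (Z z)) = (\<Sum>i\<in>I. p i x * v (\<lambda>z. Z z (q i)) + v (p i) * Z x (q i))"
proof -
  note p = presents_formD(1)[OF r] and q = presents_formD(2)[OF r]
  have pq: "(\<lambda>z. p i z * Z z (q i)) \<in> Cinf M" if "i \<in> I" for i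
    by (intro smooth_intros p vfieldsD(2)[OF Z] q that)
  have "eventually (\<lambda>z. \<xi> z (Z z) = (\<Sum>i\<in>I. p i z * Z z (q i))) (nhds x)"
    using presents_formD(3)[OF r] by eventually_elim (simp add: vfieldsD(1)[OF Z])
  then have "v (\<lambda>z. \<xi> z (Z z)) = v (\<lambda>z. \<Sum>i\<in>I. p i z * Z z (q i))"
    by (rule tangent_local[OF v formsD(2)[OF \<xi> Z], rotated]) (use pq in \<open>intro Cinf_sum ballI; simp\<close>)
  also have "\<dots> = (\<Sum>i\<in>I. v (\<lambda>z. p i z * Z z (q i)))"
    by (rule tangent_sum[OF v pq])
  also have "\<dots> = (\<Sum>i\<in>I. p i x * v (\<lambda>z. Z z (q i)) + v (p i) * Z x (q i))"
    by (rule sum.cong[OF refl]) (simp add: tangent_mult[OF v p vfieldsD(2)[OF Z q]])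
  finally show ?thesis .
qed

text \<open>The terms X(Z q) cancel against those of the bracket, and on the right only the value of
  Z at x is left. This is the tensoriality that makes \<open>lie_derivative\<close> independent of
  the extension chosen in its definition.\<close>

lemma lie_formula:
  assumes r: "presents_form \<xi> x I p q" and \<xi>: "\<xi> \<in> forms M" and X: "X \<in> vfields M" and Z: "Z \<in> vfields M"
  shows "X x (\<lambda>y. \<xi> y (Z y)) - \<xi> x (vf_bracket X Z x) =
    (\<Sum>i\<in>I. X x (p i) * Z x (q i) + p i x * Z x (\<lambda>z. X z (q i)))"
  unfolding presents_form_deriv[OF r \<xi> Z vfieldsD(1)[OF X]]
    presents_formD(4)[OF r vfieldsD(1)[OF vf_bracket_vfields[OF X Z]]]
  by (simp add: vf_bracket_def sum_subtractf[symmetric] algebra_simps)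

lemma d_formula:
  assumes r: "presents_form \<xi> x I p q" and \<xi>: "\<xi> \<in> forms M" and X: "X \<in> vfields M" and Z: "Z \<in> vfields M"
  shows "X x (\<lambda>y. \<xi> y (Z y)) - Z x (\<lambda>y. \<xi> y (X y)) - \<xi> x (vf_bracket X Z x) =
    (\<Sum>i\<in>I. X x (p i) * Z x (q i) - Z x (p i) * X x (q i))"
  unfolding presents_form_deriv[OF r \<xi> Z vfieldsD(1)[OF X]] presents_form_deriv[OF r \<xi> X vfieldsD(1)[OF Z]]
    presents_formD(4)[OF r vfieldsD(1)[OF vf_bracket_vfields[OF X Z]]]
  by (simp add: vf_bracket_def sum_subtractf[symmetric] algebra_simps)

text \<open>The familiar L_X(p dq) = X(p) dq + p d(Xq); the next lemma is its counterpart d(p dq) =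
  dp ^ dq.\<close>

lemma lie_derivative_presented:
  assumes "presents_form \<xi> x I p q" "\<xi> \<in> forms M" "X \<in> vfields M" "v \<in> tangent M x"
  shows "lie_derivative M X \<xi> x v = (\<Sum>i\<in>I. X x (p i) * v (q i) + p i x * v (\<lambda>z. X z (q i)))"
  using lie_formula[OF assms(1-3) extension(1)[OF assms(4)]] assms(4) extension(2)[OF assms(4)]
  by (simp add: lie_derivative_def)

lemma ext_derivative_presented:
  assumes "presents_form \<xi> x I p q" "\<xi> \<in> forms M" "u \<in> tangent M x" "v \<in> tangent M x"
  shows "ext_derivative M \<xi> x u v = (\<Sum>i\<in>I. u (p i) * v (q i) - v (p i) * u (q i))"
  using d_formula[OF assms(1,2) extension(1)[OF assms(3)] extension(1)[OF assms(4)]] assms(3,4)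
    extension(2)[OF assms(3)] extension(2)[OF assms(4)]
  by (simp add: ext_derivative_def)

lemma form_coordinates:
  assumes \<xi>: "\<xi> \<in> forms M"
    and c: "coordinates_on U y E" "x \<in> U"
  shows "presents_form \<xi> x {..<dim (model M)} (\<lambda>k z. \<xi> z (E k z)) y"
  unfolding presents_form_def
proof (intro conjI ballI)
  show "(\<lambda>z. \<xi> z (E k z)) \<in> Cinf M" "y k \<in> Cinf M" if "k \<in> {..<dim (model M)}" for k
    using that coordinates_onD(2,3)[OF c(1)] formsD(2)[OF \<xi>] by auto
  have "\<xi> z v = (\<Sum>k<dim (model M). \<xi> z (E k z) * v (y k))" if z: "z \<in> U" and v: "v \<in> tangent M z" for z v
  proof -
    have E: "E k z \<in> tangent M z" if "k \<in> {..<dim (model M)}" for k using that vfieldsD(1) coordinates_onD(3)[OF c(1)] by simp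
    have "\<xi> z v = \<xi> z (\<Sum>k<dim (model M). v (y k) *\<^sub>R E k z)" using tangent_expand[OF c(1) z v] by simp
    also have "\<dots> = (\<Sum>k<dim (model M). v (y k) * \<xi> z (E k z))"
      by (rule cotangent_sum[OF formsD(1)[OF \<xi>] E])
    finally show ?thesis by (simp add: mult.commute)
  qed
  then show "eventually (\<lambda>z. \<forall>v\<in>tangent M z. \<xi> z v = (\<Sum>k<dim (model M). \<xi> z (E k z) * v (y k))) (nhds x)"
    using eventually_nhds_in_open[OF coordinates_onD(1)[OF c(1)] c(2)] by (auto elim: eventually_mono)
qed

lemma form_presentation_exists:
  assumes "\<xi> \<in> forms M"
  obtains p q where "presents_form \<xi> x {..<dim (model M)} p q"
proof -
  obtain U y E where c: "coordinates_on U y E" "x \<in> U" by (rule coordinates_exist)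
  show ?thesis by (rule that[OF form_coordinates[OF assms c]])
qed

text \<open>Both sides equal the same presented expression at x, so any vector field with the given
  value may replace the chosen \<open>extension\<close>.\<close>

lemma lie_derivative_global:
  assumes "\<xi> \<in> forms M" "X \<in> vfields M" "W \<in> vfields M"
  shows "lie_derivative M X \<xi> x (W x) = X x (\<lambda>y. \<xi> y (W y)) - \<xi> x (vf_bracket X W x)"
proof -
  obtain p q where r: "presents_form \<xi> x {..<dim (model M)} p q" using form_presentation_exists[OF assms(1)] .
  show ?thesis unfolding lie_formula[OF r assms] lie_derivative_presented[OF r assms(1,2) vfieldsD(1)[OF assms(3)]] ..
qed

lemma ext_derivative_global:
  assumes "\<xi> \<in> forms M" "X \<in> vfields M" "W \<in> vfields M"
  shows "ext_derivative M \<xi> x (X x) (W x) =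
    X x (\<lambda>y. \<xi> y (W y)) - W x (\<lambda>y. \<xi> y (X y)) - \<xi> x (vf_bracket X W x)"
proof -
  obtain p q where r: "presents_form \<xi> x {..<dim (model M)} p q" using form_presentation_exists[OF assms(1)] .
  show ?thesis
    unfolding d_formula[OF r assms] ext_derivative_presented[OF r assms(1) vfieldsD(1)[OF assms(2)] vfieldsD(1)[OF assms(3)]] ..
qed

text \<open>The covector part L_X eta - i_Y d xi of the Courant bracket in its non-skew (Dorfman)
  form. The four components are separate arguments so that the rules for vector fields and forms
  apply directly.\<close>

definition dorfman ::
  "('m \<Rightarrow> 'm tvec) \<Rightarrow> ('m \<Rightarrow> 'm cotvec) \<Rightarrow> ('m \<Rightarrow> 'm tvec) \<Rightarrow> ('m \<Rightarrow> 'm cotvec) \<Rightarrow> 'm \<Rightarrow> 'm cotvec" where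
  "dorfman X \<xi> Y \<eta> x = (\<lambda>v. lie_derivative M X \<eta> x v - ext_derivative M \<xi> x (Y x) v)"

lemma dorfman_presented:
  assumes "X \<in> vfields M" "\<xi> \<in> forms M" "Y \<in> vfields M" "\<eta> \<in> forms M" "v \<in> tangent M x"
    and "presents_form \<xi> x I p q" "presents_form \<eta> x J p' q'"
  shows "dorfman X \<xi> Y \<eta> x v = (\<Sum>j\<in>J. X x (p' j) * v (q' j) + p' j x * v (\<lambda>z. X z (q' j)))
     - (\<Sum>i\<in>I. Y x (p i) * v (q i) - v (p i) * Y x (q i))"
  unfolding dorfman_def lie_derivative_presented[OF assms(7,4,1,5)]
    ext_derivative_presented[OF assms(6,2) vfieldsD(1)[OF assms(3)] assms(5)] ..

text \<open>Evaluated on a vector field, the bracket becomes an expression in iterated derivatives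
  and brackets of fields; the identities that follow are algebra with such expressions.\<close>

lemma dorfman_apply:
  assumes "X \<in> vfields M" "\<xi> \<in> forms M" "Y \<in> vfields M" "\<eta> \<in> forms M" "W \<in> vfields M"
  shows "dorfman X \<xi> Y \<eta> x (W x) = X x (\<lambda>y. \<eta> y (W y)) - \<eta> x (vf_bracket X W x)
     - Y x (\<lambda>y. \<xi> y (W y)) + W x (\<lambda>y. \<xi> y (Y y)) + \<xi> x (vf_bracket Y W x)"
  unfolding dorfman_def lie_derivative_global[OF assms(4,1,5)] ext_derivative_global[OF assms(2,3,5)] by simp

text \<open>Linearity in v is invisible in the definition, where the extension of a combination need
  not be the combination of the extensions; it is read off from presentations of the two
  forms.\<close>

lemma dorfman_cotangent:
  assumes X: "X \<in> vfields M" and \<xi>: "\<xi> \<in> forms M" and Y: "Y \<in> vfields M" and \<eta>: "\<eta> \<in> forms M"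
  shows "dorfman X \<xi> Y \<eta> x \<in> cotangent M x"
proof (rule cotangentI)
  obtain p q where r: "presents_form \<xi> x {..<dim (model M)} p q" using form_presentation_exists[OF \<xi>] .
  obtain p' q' where r': "presents_form \<eta> x {..<dim (model M)} p' q'" using form_presentation_exists[OF \<eta>] .
  note f = dorfman_presented[OF assms _ r r']
  fix v w a b assume v: "v \<in> tangent M x" and w: "w \<in> tangent M x"
  have "a *\<^sub>R v + b *\<^sub>R w \<in> tangent M x"
    by (intro subspace_add[OF subspace_tangent] subspace_mul[OF subspace_tangent] v w)
  from f[OF this] show "dorfman X \<xi> Y \<eta> x (a *\<^sub>R v + b *\<^sub>R w) = a * dorfman X \<xi> Y \<eta> x v + b * dorfman X \<xi> Y \<eta> x w"
    unfolding f[OF v] f[OF w] fun_apply real_scaleR_def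
    by (simp add: sum_distrib_left sum.distrib sum_subtractf algebra_simps)
next
  fix v assume "v \<notin> tangent M x"
  then show "dorfman X \<xi> Y \<eta> x v = 0"
    by (simp add: dorfman_def lie_derivative_def ext_derivative_def)
qed

lemma dorfman_forms:
  assumes X: "X \<in> vfields M" and \<xi>: "\<xi> \<in> forms M" and Y: "Y \<in> vfields M" and \<eta>: "\<eta> \<in> forms M"
  shows "dorfman X \<xi> Y \<eta> \<in> forms M"
proof (rule formsI)
  show "dorfman X \<xi> Y \<eta> x \<in> cotangent M x" for x by (rule dorfman_cotangent[OF assms])
  fix W assume W: "W \<in> vfields M"
  note b = vf_bracket_vfields
  show "(\<lambda>x. dorfman X \<xi> Y \<eta> x (W x)) \<in> Cinf M"
    unfolding dorfman_apply[OF assms W]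
    by (intro Cinf_add Cinf_diff vfieldsD(2)[OF X formsD(2)[OF \<eta> W]] formsD(2)[OF \<eta> b[OF X W]]
        vfieldsD(2)[OF Y formsD(2)[OF \<xi> W]] vfieldsD(2)[OF W formsD(2)[OF \<xi> Y]] formsD(2)[OF \<xi> b[OF Y W]])
qed

lemma dorfman_comb:
  assumes X: "X \<in> vfields M" "\<xi> \<in> forms M" and Y: "Y \<in> vfields M" "\<eta> \<in> forms M" and Z: "Z \<in> vfields M" "\<zeta> \<in> forms M"
  shows "dorfman (\<lambda>x. a *\<^sub>R X x + b *\<^sub>R Y x) (\<lambda>x. a *\<^sub>R \<xi> x + b *\<^sub>R \<eta> x) Z \<zeta> x =
    a *\<^sub>R dorfman X \<xi> Z \<zeta> x + b *\<^sub>R dorfman Y \<eta> Z \<zeta> x"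
proof (rule cotangent_eqI)
  let ?X = "\<lambda>x. a *\<^sub>R X x + b *\<^sub>R Y x" and ?\<xi> = "\<lambda>x. a *\<^sub>R \<xi> x + b *\<^sub>R \<eta> x"
  have s: "?X \<in> vfields M" "?\<xi> \<in> forms M"
    by (intro vfields_add vfields_scale forms_add forms_scale Cinf_const assms)+
  show "dorfman ?X ?\<xi> Z \<zeta> x \<in> cotangent M x" by (rule dorfman_cotangent[OF s Z])
  show "a *\<^sub>R dorfman X \<xi> Z \<zeta> x + b *\<^sub>R dorfman Y \<eta> Z \<zeta> x \<in> cotangent M x"
    by (intro subspace_add[OF subspace_cotangent] subspace_mul[OF subspace_cotangent] dorfman_cotangent assms)
  fix W assume W: "W \<in> vfields M"
  note b = vf_bracket_vfields
  show "dorfman ?X ?\<xi> Z \<zeta> x (W x) = (a *\<^sub>R dorfman X \<xi> Z \<zeta> x + b *\<^sub>R dorfman Y \<eta> Z \<zeta> x) (W x)"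
    unfolding fun_apply real_scaleR_def dorfman_apply[OF s Z W] dorfman_apply[OF X Z W] dorfman_apply[OF Y Z W]
      vf_bracket_comb[OF X(1) Y(1) W]
      cotangent_comb[OF formsD(1)[OF Z(2)] vfieldsD(1)[OF b[OF X(1) W]] vfieldsD(1)[OF b[OF Y(1) W]]]
      tangent_comb[OF vfieldsD(1)[OF Z(1)] formsD(2)[OF X(2) W] formsD(2)[OF Y(2) W]]
      tangent_comb[OF vfieldsD(1)[OF W] formsD(2)[OF X(2) Z(1)] formsD(2)[OF Y(2) Z(1)]]
    by (simp add: algebra_simps)
qed

text \<open>Multiplying Y by h creates the term W(h) xi(Y) twice with opposite signs, from W(xi(h
  Y)) and from xi([h Y, W]); what survives is X(h) eta.\<close>

lemma dorfman_leibniz: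
  assumes h: "h \<in> Cinf M" and X: "X \<in> vfields M" "\<xi> \<in> forms M" and Y: "Y \<in> vfields M" "\<eta> \<in> forms M"
  shows "dorfman X \<xi> (\<lambda>x. h x *\<^sub>R Y x) (\<lambda>x. h x *\<^sub>R \<eta> x) x = h x *\<^sub>R dorfman X \<xi> Y \<eta> x + X x h *\<^sub>R \<eta> x"
proof (rule cotangent_eqI)
  let ?Y = "\<lambda>x. h x *\<^sub>R Y x" and ?\<eta> = "\<lambda>x. h x *\<^sub>R \<eta> x"
  have s: "?Y \<in> vfields M" "?\<eta> \<in> forms M"
    by (intro vfields_scale forms_scale assms)+
  show "dorfman X \<xi> ?Y ?\<eta> x \<in> cotangent M x" by (rule dorfman_cotangent[OF X s])
  show "h x *\<^sub>R dorfman X \<xi> Y \<eta> x + X x h *\<^sub>R \<eta> x \<in> cotangent M x"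
    by (intro subspace_add[OF subspace_cotangent] subspace_mul[OF subspace_cotangent] dorfman_cotangent formsD(1) assms)
  fix W assume W: "W \<in> vfields M"
  note b = vf_bracket_vfields and t = vfieldsD(1)
  have "vf_bracket ?Y W x = - (h x *\<^sub>R vf_bracket W Y x + W x h *\<^sub>R Y x)"
    using vf_bracket_antisym[of ?Y W x] vf_bracket_leibniz[OF h W Y(1)] by simp
  also have "\<dots> = h x *\<^sub>R vf_bracket Y W x + (- W x h) *\<^sub>R Y x"
    using vf_bracket_antisym[of Y W x] by simp
  finally have br': "vf_bracket ?Y W x = h x *\<^sub>R vf_bracket Y W x + (- W x h) *\<^sub>R Y x" .
  have br: "\<xi> x (vf_bracket ?Y W x) = h x * \<xi> x (vf_bracket Y W x) - W x h * \<xi> x (Y x)"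
    unfolding br' cotangent_comb[OF formsD(1)[OF X(2)] t[OF b[OF Y(1) W]] t[OF Y(1)]] by simp
  have \<xi>Y: "\<xi> y (h y *\<^sub>R Y y) = h y * \<xi> y (Y y)" for y
    by (rule cotangent_scale[OF formsD(1)[OF X(2)] t[OF Y(1)]])
  show "dorfman X \<xi> ?Y ?\<eta> x (W x) = (h x *\<^sub>R dorfman X \<xi> Y \<eta> x + X x h *\<^sub>R \<eta> x) (W x)"
    unfolding fun_apply real_scaleR_def dorfman_apply[OF X s W] dorfman_apply[OF X Y W] br \<xi>Y
      tangent_mult[OF t[OF X(1)] h formsD(2)[OF Y(2) W]] tangent_mult[OF t[OF W] h formsD(2)[OF X(2) Y(1)]]
    by (simp add: algebra_simps)
qed

text \<open>The symmetric part of the Dorfman bracket is the differential of the pairing, which is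
  why \<open>iso\<close> is assumed along M and not at x alone.\<close>

lemma dorfman_antisym:
  assumes X: "X \<in> vfields M" "\<xi> \<in> forms M" and Y: "Y \<in> vfields M" "\<eta> \<in> forms M"
    and iso: "\<And>x. \<xi> x (Y x) + \<eta> x (X x) = 0"
  shows "dorfman X \<xi> Y \<eta> x = - dorfman Y \<eta> X \<xi> x"
proof (rule cotangent_eqI)
  show "dorfman X \<xi> Y \<eta> x \<in> cotangent M x" by (rule dorfman_cotangent[OF X Y])
  show "- dorfman Y \<eta> X \<xi> x \<in> cotangent M x"
    by (intro subspace_neg[OF subspace_cotangent] dorfman_cotangent assms)
  fix W assume W: "W \<in> vfields M"
  have e: "\<xi> y (Y y) = - \<eta> y (X y)" for y using iso[of y] by simp
  show "dorfman X \<xi> Y \<eta> x (W x) = (- dorfman Y \<eta> X \<xi> x) (W x)"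
    unfolding fun_apply dorfman_apply[OF X Y W] dorfman_apply[OF Y X W] e
      tangent_minus[OF vfieldsD(1)[OF W] formsD(2)[OF Y(2) X(1)]] by simp
qed

text \<open>The Jacobi identity in Leibniz form: bracketing with a section is a derivation of the
  bracket. It holds for arbitrary generalised sections; on an isotropic bundle skew-symmetry turns
  it into the cyclic form.\<close>

lemma dorfman_jacobi:
  assumes X: "X \<in> vfields M" "\<alpha> \<in> forms M" and Y: "Y \<in> vfields M" "\<beta> \<in> forms M" and Z: "Z \<in> vfields M" "\<gamma> \<in> forms M"
  shows "dorfman X \<alpha> (vf_bracket Y Z) (dorfman Y \<beta> Z \<gamma>) x =
    dorfman (vf_bracket X Y) (dorfman X \<alpha> Y \<beta>) Z \<gamma> x + dorfman Y \<beta> (vf_bracket X Z) (dorfman X \<alpha> Z \<gamma>) x"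
proof (rule cotangent_eqI)
  note b = vf_bracket_vfields and t = vfieldsD(1) and e = formsD(2) and a = vfieldsD(2) and d = dorfman_forms
  show "dorfman X \<alpha> (vf_bracket Y Z) (dorfman Y \<beta> Z \<gamma>) x \<in> cotangent M x"
    "dorfman (vf_bracket X Y) (dorfman X \<alpha> Y \<beta>) Z \<gamma> x + dorfman Y \<beta> (vf_bracket X Z) (dorfman X \<alpha> Z \<gamma>) x \<in> cotangent M x"
    by (intro dorfman_cotangent b d assms subspace_add[OF subspace_cotangent])+
  fix W assume W: "W \<in> vfields M"
  note XY = b[OF X(1) Y(1)] and XZ = b[OF X(1) Z(1)] and YZ = b[OF Y(1) Z(1)]
    and XW = b[OF X(1) W] and YW = b[OF Y(1) W] and ZW = b[OF Z(1) W]
  \<comment> \<open>Nested brackets put Dorfman evaluations under a derivation v, and D expands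
    these. With B and J everything becomes a linear relation between iterated derivatives and values
    on double brackets, for which three instances of the Jacobi identity for fields suffice.\<close>
  have D: "v (\<lambda>y. dorfman X' \<xi>' Y' \<eta>' y (W' y)) = v (\<lambda>y. X' y (\<lambda>z. \<eta>' z (W' z))) - v (\<lambda>y. \<eta>' y (vf_bracket X' W' y))
      - v (\<lambda>y. Y' y (\<lambda>z. \<xi>' z (W' z))) + v (\<lambda>y. W' y (\<lambda>z. \<xi>' z (Y' z))) + v (\<lambda>y. \<xi>' y (vf_bracket Y' W' y))"
    if v: "v \<in> tangent M x" and "X' \<in> vfields M" "\<xi>' \<in> forms M" "Y' \<in> vfields M" "\<eta>' \<in> forms M" "W' \<in> vfields M"
    for v X' \<xi>' Y' \<eta>' W'
  proof -
    note that = that(2-)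
    have c: "(\<lambda>y. X' y (\<lambda>z. \<eta>' z (W' z))) \<in> Cinf M" "(\<lambda>y. \<eta>' y (vf_bracket X' W' y)) \<in> Cinf M"
      "(\<lambda>y. Y' y (\<lambda>z. \<xi>' z (W' z))) \<in> Cinf M" "(\<lambda>y. W' y (\<lambda>z. \<xi>' z (Y' z))) \<in> Cinf M"
      "(\<lambda>y. \<xi>' y (vf_bracket Y' W' y)) \<in> Cinf M"
      by (rule a[OF that(1) e[OF that(4,5)]], rule e[OF that(4) b[OF that(1,5)]],
          rule a[OF that(3) e[OF that(2,5)]], rule a[OF that(5) e[OF that(2,3)]], rule e[OF that(2) b[OF that(3,5)]])
    note c1 = Cinf_diff[OF c(1,2)] note c2 = Cinf_diff[OF c1 c(3)] note c3 = Cinf_add[OF c2 c(4)]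
    show ?thesis
      unfolding dorfman_apply[OF that] tangent_add[OF v c3 c(5)] tangent_add[OF v c2 c(4)]
        tangent_diff[OF v c1 c(3)] tangent_diff[OF v c(1,2)] ..
  qed
  have B: "vf_bracket X' Y' x (\<lambda>z. \<xi>' z (Z' z)) =
      X' x (\<lambda>y. Y' y (\<lambda>z. \<xi>' z (Z' z))) - Y' x (\<lambda>y. X' y (\<lambda>z. \<xi>' z (Z' z)))" for X' Y' \<xi>' Z'
    by (simp add: vf_bracket_def)
  have J: "\<xi>' x (vf_bracket X' (vf_bracket Y' Z') x) =
      \<xi>' x (vf_bracket (vf_bracket X' Y') Z' x) + \<xi>' x (vf_bracket Y' (vf_bracket X' Z') x)"
    if "\<xi>' \<in> forms M" "X' \<in> vfields M" "Y' \<in> vfields M" "Z' \<in> vfields M" for \<xi>' X' Y' Z'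
    unfolding vf_bracket_jacobi[OF that(2-4)]
    by (rule cotangent_add[OF formsD(1)[OF that(1)]]) (intro t b that)+
  show "dorfman X \<alpha> (vf_bracket Y Z) (dorfman Y \<beta> Z \<gamma>) x (W x) =
    (dorfman (vf_bracket X Y) (dorfman X \<alpha> Y \<beta>) Z \<gamma> x + dorfman Y \<beta> (vf_bracket X Z) (dorfman X \<alpha> Z \<gamma>) x) (W x)"
    unfolding fun_apply
      dorfman_apply[OF X YZ d[OF Y Z] W] dorfman_apply[OF XY d[OF X Y] Z W] dorfman_apply[OF Y XZ d[OF X Z] W]
      D[OF t[OF X(1)] Y Z W] D[OF t[OF Z(1)] X Y W] D[OF t[OF W] X Y Z(1)] D[OF t[OF Y(1)] X Z W]
      dorfman_apply[OF Y Z XW] dorfman_apply[OF X Y ZW] dorfman_apply[OF X Z YW]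
      B[of Y Z \<alpha> W] B[of X W \<beta> Z] B[of X Y \<gamma> W] B[of Z W \<alpha> Y] B[of X Z \<beta> W] B[of Y W \<alpha> Z]
    using J[OF Z(2) X(1) Y(1) W] J[OF Y(2) X(1) Z(1) W] J[OF X(2) Y(1) Z(1) W]
    by linarith
qed

section \<open>The Courant bracket and the Lie algebroids it defines\<close>

lemma courant_eq: "courant M s t x = (vf_bracket (fst \<circ> s) (fst \<circ> t) x, dorfman (fst \<circ> s) (snd \<circ> s) (fst \<circ> t) (snd \<circ> t) x)"
  by (simp add: courant_def dorfman_def Let_def)

lemma courant_comp:
  "fst \<circ> courant M s t = vf_bracket (fst \<circ> s) (fst \<circ> t)"
  "snd \<circ> courant M s t = dorfman (fst \<circ> s) (snd \<circ> s) (fst \<circ> t) (snd \<circ> t)"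
  by (simp_all add: fun_eq_iff courant_eq)

lemma gen_sectionsD: "s \<in> gen_sections M \<Longrightarrow> fst \<circ> s \<in> vfields M" "s \<in> gen_sections M \<Longrightarrow> snd \<circ> s \<in> forms M"
  by (auto simp: gen_sections_def)

lemma courant_gen_sections: "s \<in> gen_sections M \<Longrightarrow> t \<in> gen_sections M \<Longrightarrow> courant M s t \<in> gen_sections M"
  by (simp add: gen_sections_def courant_comp vf_bracket_vfields dorfman_forms)

lemma courant_jacobi:
  assumes "s \<in> gen_sections M" "t \<in> gen_sections M" "u \<in> gen_sections M"
  shows "courant M s (courant M t u) = courant M (courant M s t) u + courant M t (courant M s u)"
proof
  fix x
  show "courant M s (courant M t u) x = (courant M (courant M s t) u + courant M t (courant M s u)) x"
    unfolding fun_apply courant_eq courant_comp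
      vf_bracket_jacobi[OF assms[THEN gen_sectionsD(1)]]
      dorfman_jacobi[OF gen_sectionsD[OF assms(1)] gen_sectionsD[OF assms(2)] gen_sectionsD[OF assms(3)]]
    by (simp add: fun_apply fun_eq_iff)
qed

lemma courant_antisym:
  assumes "s \<in> gen_sections M" "t \<in> gen_sections M" "\<And>x. pairing (s x) (t x) = 0"
  shows "courant M s t = - courant M t s"
proof
  fix x
  have "dorfman (fst \<circ> s) (snd \<circ> s) (fst \<circ> t) (snd \<circ> t) x = - dorfman (fst \<circ> t) (snd \<circ> t) (fst \<circ> s) (snd \<circ> s) x"
    using assms(3) by (intro dorfman_antisym gen_sectionsD assms(1,2)) (simp add: pairing_def)
  then show "courant M s t x = (- courant M t s) x"
    using vf_bracket_antisym[of "fst \<circ> s" "fst \<circ> t" x] by (simp add: fun_apply courant_eq)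
qed

lemma courant_comb:
  assumes "s \<in> gen_sections M" "t \<in> gen_sections M" "u \<in> gen_sections M"
  shows "courant M (a *\<^sub>R s + b *\<^sub>R t) u = a *\<^sub>R courant M s u + b *\<^sub>R courant M t u"
proof
  fix x
  have "fst \<circ> (a *\<^sub>R s + b *\<^sub>R t) = (\<lambda>x. a *\<^sub>R (fst \<circ> s) x + b *\<^sub>R (fst \<circ> t) x)"
    "snd \<circ> (a *\<^sub>R s + b *\<^sub>R t) = (\<lambda>x. a *\<^sub>R (snd \<circ> s) x + b *\<^sub>R (snd \<circ> t) x)"
    by (simp_all add: fun_eq_iff fun_apply)
  then show "courant M (a *\<^sub>R s + b *\<^sub>R t) u x = (a *\<^sub>R courant M s u + b *\<^sub>R courant M t u) x"
    using assms by (simp only: courant_eq fun_apply vf_bracket_comb dorfman_comb gen_sectionsD)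
      (simp add: scaleR_prod_def plus_prod_def o_def)
qed

lemma courant_leibniz:
  assumes "s \<in> gen_sections M" "t \<in> gen_sections M" "h \<in> Cinf M"
  shows "courant M s (\<lambda>x. h x *\<^sub>R t x) x = h x *\<^sub>R courant M s t x + fst (s x) h *\<^sub>R t x"
proof -
  have "fst \<circ> (\<lambda>x. h x *\<^sub>R t x) = (\<lambda>x. h x *\<^sub>R (fst \<circ> t) x)"
    "snd \<circ> (\<lambda>x. h x *\<^sub>R t x) = (\<lambda>x. h x *\<^sub>R (snd \<circ> t) x)"
    by (simp_all add: fun_eq_iff)
  then show ?thesis
    using assms by (simp only: courant_eq vf_bracket_leibniz dorfman_leibniz gen_sectionsD)
      (simp add: prod_eq_iff o_def)
qed

theorem dirac_lie_algebroid:
  assumes vb: "vector_bundle M L (dirac_sections M L)"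
    and sub: "\<And>x. L x \<subseteq> gen_tangent M x" and iso: "\<And>x. isotropic (L x)"
    and inv: "\<And>s t. s \<in> dirac_sections M L \<Longrightarrow> t \<in> dirac_sections M L \<Longrightarrow> courant M s t \<in> dirac_sections M L"
  shows "lie_algebroid M (dirac_algebroid M L)"
proof -
  have gen: "s \<in> gen_sections M" if "s \<in> dirac_sections M L" for s
    using that by (simp add: dirac_sections_def)
  have anti: "courant M s t = - courant M t s" if s: "s \<in> dirac_sections M L" "t \<in> dirac_sections M L" for s t
  proof (rule courant_antisym[OF gen[OF s(1)] gen[OF s(2)]])
    show "pairing (s x) (t x) = 0" for x
      using s iso[of x] unfolding dirac_sections_def isotropic_def by blast
  qed
  have jac: "courant M s (courant M t u) + courant M t (courant M u s) + courant M u (courant M s t) = 0"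
    if s: "s \<in> dirac_sections M L" and t: "t \<in> dirac_sections M L" and u: "u \<in> dirac_sections M L" for s t u
  proof -
    \<comment> \<open>Skew-symmetry is written as a linear combination, the shape in which
      \<open>courant_comb\<close> moves the sign out of the first slot.\<close>
    have us: "courant M u s = (-1) *\<^sub>R courant M s u + 0 *\<^sub>R courant M s u" using anti[OF u s] by simp
    have "courant M t (courant M u s) = - courant M (courant M u s) t" by (intro anti inv s t u)
    also have "\<dots> = courant M (courant M s u) t"
      unfolding us courant_comb[OF gen[OF inv[OF s u]] gen[OF inv[OF s u]] gen[OF t]] by simp
    also have "\<dots> = - courant M t (courant M s u)" by (intro anti inv s t u)
    finally have 1: "courant M t (courant M u s) = - courant M t (courant M s u)" .
    have 2: "courant M u (courant M s t) = - courant M (courant M s t) u" by (intro anti inv s t u)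
    show ?thesis unfolding 1 2 courant_jacobi[OF gen[OF s] gen[OF t] gen[OF u]] by simp
  qed
  have lin: "linear_between (L x) (tangent M x) fst" for x
    using sub[of x] by (auto simp: linear_between_def gen_tangent_def)
  have anc: "(\<lambda>x. fst (s x)) \<in> vfields M" if "s \<in> dirac_sections M L" for s
    using gen_sectionsD(1)[OF gen[OF that]] by (simp add: comp_def)
  show ?thesis
    unfolding lie_algebroid_def dirac_algebroid_def lie_algebroid_data.simps
  proof (intro conjI)
    show "\<forall>s\<in>dirac_sections M L. \<forall>t\<in>dirac_sections M L. \<forall>h\<in>Cinf M.
        courant M s (\<lambda>x. h x *\<^sub>R t x) = (\<lambda>x. h x *\<^sub>R courant M s t x + fst (s x) h *\<^sub>R t x)"
    proof (intro ballI ext)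
      fix s t h x assume s: "s \<in> dirac_sections M L" "t \<in> dirac_sections M L" and h: "h \<in> Cinf M"
      show "courant M s (\<lambda>x. h x *\<^sub>R t x) x = h x *\<^sub>R courant M s t x + fst (s x) h *\<^sub>R t x"
        by (rule courant_leibniz[OF gen[OF s(1)] gen[OF s(2)] h])
    qed
    show "vector_bundle M L (dirac_sections M L)" by (rule vb)
    show "\<forall>x. linear_between (L x) (tangent M x) fst" using lin by blast
    show "\<forall>s\<in>dirac_sections M L. (\<lambda>x. fst (s x)) \<in> vfields M" by (intro ballI anc)
    show "\<forall>s\<in>dirac_sections M L. \<forall>t\<in>dirac_sections M L. courant M s t \<in> dirac_sections M L"
      by (intro ballI inv)
    show "\<forall>s\<in>dirac_sections M L. \<forall>t\<in>dirac_sections M L. \<forall>u\<in>dirac_sections M L. \<forall>a b.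
        courant M (a *\<^sub>R s + b *\<^sub>R t) u = a *\<^sub>R courant M s u + b *\<^sub>R courant M t u"
      by (intro ballI allI courant_comb gen)
    show "\<forall>s\<in>dirac_sections M L. \<forall>t\<in>dirac_sections M L. courant M s t = - courant M t s"
      by (intro ballI anti)
    show "\<forall>s\<in>dirac_sections M L. \<forall>t\<in>dirac_sections M L. \<forall>u\<in>dirac_sections M L.
        courant M s (courant M t u) + courant M t (courant M u s) + courant M u (courant M s t) = 0"
      by (intro ballI jac)
  qed
qed

end

section \<open>Local frames\<close>

text \<open>Coefficient families indexed by i < r are the form in which frames are modified by
  elimination and transported by linear maps. The injectivity clause of \<open>local_frame\<close>
  is absorbed: it distinguishes independence of the family from that of its image set.\<close>

lemma local_frame_iff:
  "local_frame F \<Gamma> r U e \<longleftrightarrow> open U \<and> (\<forall>i<r. e i \<in> \<Gamma>) \<and>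
    (\<forall>x\<in>U. (\<forall>c. (\<Sum>i<r. c i *\<^sub>R e i x) = 0 \<longrightarrow> (\<forall>i<r. c i = 0)) \<and> F x = range (\<lambda>c. \<Sum>i<r. c i *\<^sub>R e i x))"
proof -
  have ind: "inj_on f {..<r} \<and> independent (f ` {..<r}) \<longleftrightarrow> (\<forall>c. (\<Sum>i<r. c i *\<^sub>R f i) = 0 \<longrightarrow> (\<forall>i<r. c i = 0))"
    for f :: "nat \<Rightarrow> 'b::real_vector"
  proof (intro iffI conjI allI impI)
    fix c i assume f: "inj_on f {..<r} \<and> independent (f ` {..<r})" and 0: "(\<Sum>i<r. c i *\<^sub>R f i) = 0" and i: "i < r"
    let ?u = "\<lambda>v. c (the_inv_into {..<r} f v)"
    have "(\<Sum>v\<in>f ` {..<r}. ?u v *\<^sub>R v) = 0"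
      using f 0 by (subst sum.reindex) (auto simp: the_inv_into_f_f)
    then have "?u (f i) = 0"
      using f i by (intro independentD[where s = "f ` {..<r}" and t = "f ` {..<r}" and u = ?u]) auto
    then show "c i = 0" using f i by (simp add: the_inv_into_f_f)
  next
    assume c: "\<forall>c. (\<Sum>i<r. c i *\<^sub>R f i) = 0 \<longrightarrow> (\<forall>i<r. c i = 0)"
    show inj: "inj_on f {..<r}"
    proof (rule inj_onI, rule ccontr)
      fix i j assume ij: "i \<in> {..<r}" "j \<in> {..<r}" "f i = f j" "i \<noteq> j"
      let ?c = "\<lambda>k. (if k = i then 1 else 0) - (if k = j then 1 else 0) :: real"
      have "(\<Sum>k<r. ?c k *\<^sub>R f k) = 0"
        using ij by (simp add: scaleR_left_diff_distrib sum_subtractf if_distrib[of "\<lambda>a. a *\<^sub>R _"] cong: if_cong)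
      then have "?c i = 0" using c[rule_format, of ?c i] ij(1) by blast
      then show False using ij by simp
    qed
    show "independent (f ` {..<r})"
    proof (rule independent_if_scalars_zero)
      fix u v assume "(\<Sum>v\<in>f ` {..<r}. u v *\<^sub>R v) = 0" "v \<in> f ` {..<r}"
      then show "u v = 0" using c inj by (auto simp: sum.reindex dest: spec[of _ "\<lambda>i. u (f i)"])
    qed simp
  qed
  have sp: "span (f ` {..<r}) = range (\<lambda>c. \<Sum>i<r. c i *\<^sub>R f i)"
    if inj: "inj_on f {..<r}" for f :: "nat \<Rightarrow> 'b::real_vector"
  proof -
    have 1: "(\<Sum>v\<in>f ` {..<r}. u v *\<^sub>R v) = (\<Sum>i<r. u (f i) *\<^sub>R f i)" for u
      using inj by (subst sum.reindex) auto
    have "(\<Sum>i<r. c i *\<^sub>R f i) \<in> range (\<lambda>u. \<Sum>i<r. u (f i) *\<^sub>R f i)" for c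
      by (rule range_eqI[of _ _ "\<lambda>v. c (the_inv_into {..<r} f v)"]) (simp add: the_inv_into_f_f[OF inj])
    then show ?thesis unfolding span_finite[OF finite_imageI[OF finite_lessThan]] 1 by auto
  qed
  have "inj_on (\<lambda>i. e i x) {..<r} \<and> independent ((\<lambda>i. e i x) ` {..<r}) \<and> span ((\<lambda>i. e i x) ` {..<r}) = F x \<longleftrightarrow>
      (\<forall>c. (\<Sum>i<r. c i *\<^sub>R e i x) = 0 \<longrightarrow> (\<forall>i<r. c i = 0)) \<and> F x = range (\<lambda>c. \<Sum>i<r. c i *\<^sub>R e i x)" for x
    unfolding ind[of "\<lambda>i. e i x", symmetric] using sp[of "\<lambda>i. e i x"] by auto
  then show ?thesis unfolding local_frame_def by (simp only:)
qed

lemma local_frameD: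
  assumes "local_frame F \<Gamma> r U e"
  shows "open U" "i < r \<Longrightarrow> e i \<in> \<Gamma>" "x \<in> U \<Longrightarrow> (\<Sum>i<r. c i *\<^sub>R e i x) = 0 \<Longrightarrow> i < r \<Longrightarrow> c i = 0"
    "x \<in> U \<Longrightarrow> F x = range (\<lambda>c. \<Sum>i<r. c i *\<^sub>R e i x)"
  using assms unfolding local_frame_iff by blast+

lemma local_frame_member:
  assumes "local_frame F \<Gamma> r U e" "i < r" "x \<in> U"
  shows "e i x \<in> F x"
proof -
  have "span ((\<lambda>i. e i x) ` {..<r}) = F x" using assms(1,3) by (simp add: local_frame_def)
  moreover have "e i x \<in> span ((\<lambda>i. e i x) ` {..<r})" using assms(2) by (intro span_base) simp
  ultimately show ?thesis by simp
qed

lemma local_frame_permute: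
  assumes \<pi>: "bij_betw \<pi> {..<r} {..<r}" and e: "local_frame F \<Gamma> r U e"
  shows "local_frame F \<Gamma> r U (\<lambda>i. e (\<pi> i))"
proof -
  have im: "(\<lambda>i. e (\<pi> i) x) ` {..<r} = (\<lambda>i. e i x) ` {..<r}" for x
    using \<pi> by (auto simp: bij_betw_def image_image[of "\<lambda>i. e i x" \<pi>, symmetric])
  have inj: "inj_on (\<lambda>i. e (\<pi> i) x) {..<r}" if "inj_on (\<lambda>i. e i x) {..<r}" for x
    using comp_inj_on[of \<pi> "{..<r}" "\<lambda>i. e i x"] \<pi> that by (simp add: bij_betw_def comp_def)
  show ?thesis using e \<pi> inj unfolding local_frame_def im by (auto simp: bij_betw_def)
qed

context smooth_mfd begin

section \<open>Smooth solutions of linear systems\<close>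

lemma smooth_at_isCont: "smooth_at g x \<Longrightarrow> isCont g x"
  by (erule smooth_atE) (meson Cinf_on_continuous continuous_on_eq_continuous_at)

lemma smooth_at_nonzero: "smooth_at g x \<Longrightarrow> g x \<noteq> 0 \<Longrightarrow> eventually (\<lambda>z. g z \<noteq> 0) (nhds x)"
  using smooth_at_isCont tendsto_imp_eventually_ne[of g "g x" "nhds x" 0]
  by (simp add: continuous_within tendsto_nhds_iff)

text \<open>Gaussian elimination of the last unknown.\<close>

lemma linear_system_smooth:
  fixes P :: "'k \<Rightarrow> nat \<Rightarrow> 'm \<Rightarrow> real" and r :: nat
  assumes "\<And>k i. k \<in> K \<Longrightarrow> i < r \<Longrightarrow> smooth_at (P k i) x" "\<And>k. k \<in> K \<Longrightarrow> smooth_at (b k) x"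
    and "eventually (\<lambda>z. \<forall>k\<in>K. (\<Sum>i<r. P k i z * c i z) = b k z) (nhds x)"
    and "\<And>d. (\<And>k. k \<in> K \<Longrightarrow> (\<Sum>i<r. P k i x * d i) = 0) \<Longrightarrow> (\<And>i. i < r \<Longrightarrow> d i = 0)"
  shows "i < r \<Longrightarrow> smooth_at (c i) x"
  using assms
proof (induction r arbitrary: P b i)
  case 0
  then show ?case by simp
next
  case (Suc r)
  note P = Suc.prems(2) and b = Suc.prems(3) and eq = Suc.prems(4) and inj = Suc.prems(5)
  \<comment> \<open>A pivot for the last unknown: if the whole last column vanished at x, the last
    unit vector would contradict injectivity.\<close>
  have "\<exists>k0\<in>K. P k0 r x \<noteq> 0"
  proof (rule ccontr)
    assume "\<not> ?thesis"
    then have "(\<Sum>i<Suc r. P k i x * (if i = r then 1 else 0)) = 0" if "k \<in> K" for k using that by simp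
    from inj[of "\<lambda>i. if i = r then 1 else 0", OF this, of r] show False by simp
  qed
  then obtain k0 where k0: "k0 \<in> K" "P k0 r x \<noteq> 0" by blast
  have Pk0: "smooth_at (P k0 r) x" by (rule P[OF k0(1)]) simp
  have nz: "eventually (\<lambda>z. P k0 r z \<noteq> 0) (nhds x)" by (rule smooth_at_nonzero[OF Pk0 k0(2)])
  \<comment> \<open>Row k minus the multiple of row k0 that removes the last unknown. Near x row k0
    itself turns into 0 = 0, so the index set K can be kept.\<close>
  define P' where "P' k i z = P k i z - P k r z * (P k0 i z / P k0 r z)" for k i z
  define b' where "b' k z = b k z - P k r z * (b k0 z / P k0 r z)" for k z
  have c: "smooth_at (c i) x" if i: "i < r" for i
  proof (rule Suc.IH[of i P' b', OF i])
    show "smooth_at (P' k i) x" if "k \<in> K" "i < r" for k i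
      unfolding P'_def[abs_def] using that k0 by (intro smooth_intros P) auto
    show "smooth_at (b' k) x" if "k \<in> K" for k
      unfolding b'_def[abs_def] using that k0 by (intro smooth_intros b P) auto
    show "eventually (\<lambda>z. \<forall>k\<in>K. (\<Sum>i<r. P' k i z * c i z) = b' k z) (nhds x)"
      using eq nz
    proof eventually_elim
      case (elim z)
      show ?case
      proof
        fix k assume k: "k \<in> K"
        have 1: "(\<Sum>i<r. P' k i z * c i z) =
            (\<Sum>i<r. P k i z * c i z) - P k r z * ((\<Sum>i<r. P k0 i z * c i z) / P k0 r z)"
          by (simp add: P'_def algebra_simps sum_subtractf sum_distrib_left sum_divide_distrib)
        have 2: "(\<Sum>i<r. P k i z * c i z) = b k z - P k r z * c r z" if "k \<in> K" for k
          using elim(1)[rule_format, OF that] by simp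
        have 3: "(\<Sum>i<r. P k0 i z * c i z) / P k0 r z = b k0 z / P k0 r z - c r z"
          unfolding 2[OF k0(1)] using elim(2) by (simp add: diff_divide_distrib)
        show "(\<Sum>i<r. P' k i z * c i z) = b' k z"
          unfolding 1 3 2[OF k] b'_def by (simp add: algebra_simps)
      qed
    qed
    fix d j assume d: "\<And>k. k \<in> K \<Longrightarrow> (\<Sum>i<r. P' k i x * d i) = 0" and j: "j < r"
    \<comment> \<open>A kernel vector of the reduced system is completed by the last entry that row
      k0 forces; then injectivity of the full system applies.\<close>
    define d' where "d' i = (if i = r then - (\<Sum>i<r. P k0 i x * d i) / P k0 r x else d i)" for i
    have "(\<Sum>i<Suc r. P k i x * d' i) = 0" if "k \<in> K" for k
    proof -
      have "(\<Sum>i<r. P' k i x * d i) =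
          (\<Sum>i<r. P k i x * d i) - P k r x * ((\<Sum>i<r. P k0 i x * d i) / P k0 r x)"
        by (simp add: P'_def algebra_simps sum_subtractf sum_distrib_left sum_divide_distrib)
      then show ?thesis using d[OF that] by (simp add: d'_def)
    qed
    from inj[OF this, of j] show "d j = 0" using j by (simp add: d'_def)
  qed
  show ?case
  proof (cases "i = r")
    case True
    have ev: "eventually (\<lambda>z. c r z = (b k0 z - (\<Sum>i<r. P k0 i z * c i z)) / P k0 r z) (nhds x)"
      using eq nz
    proof eventually_elim
      case (elim z)
      then show ?case using elim(1)[rule_format, OF k0(1)] by (simp add: field_simps)
    qed
    have "smooth_at (\<lambda>z. (b k0 z - (\<Sum>i<r. P k0 i z * c i z)) / P k0 r z) x"
      using k0 c P by (intro smooth_intros b Pk0) auto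
    then show ?thesis unfolding True smooth_at_cong[OF ev] .
  next
    case False
    then show ?thesis using Suc.prems(1) c by simp
  qed
qed

text \<open>A substitute for a smooth structure on the ambient space of the fibres: functionals that
  are smooth along the given sections and jointly injective on the fibre at x. In the index, a flag
  can distinguish tests of vectors on coordinate functions from tests of covectors on coordinate
  fields.\<close>

definition smoothly_separated :: "('m \<Rightarrow> 'a::real_vector set) \<Rightarrow> ('m \<Rightarrow> 'a) set \<Rightarrow> bool" where
  "smoothly_separated F \<Gamma> \<longleftrightarrow> (\<forall>x. \<exists>(K::(bool \<times> nat) set) l.
     (\<forall>k\<in>K. (\<forall>z. linear (l k z)) \<and> (\<forall>s\<in>\<Gamma>. smooth_at (\<lambda>z. l k z (s z)) x)) \<and>
     (\<forall>u\<in>F x. (\<forall>k\<in>K. l k x u = 0) \<longrightarrow> u = 0))"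

text \<open>Applying the separating functionals to s = sum c_i e_i gives a linear system for the c_i
  with smooth entries. It is injective at x, since the functionals separate the fibre and the e_i
  are independent there, so elimination shows the solution to be smooth.\<close>

lemma frame_coefficients:
  fixes F :: "'m \<Rightarrow> 'a::real_vector set" and \<Gamma> :: "('m \<Rightarrow> 'a) set"
  assumes sub: "\<forall>s\<in>\<Gamma>. \<forall>x. s x \<in> F x"
    and sep: "smoothly_separated F \<Gamma>"
    and s: "s \<in> \<Gamma>" and e: "local_frame F \<Gamma> r U e"
  obtains c where "\<And>i. i < r \<Longrightarrow> c i \<in> Cinf_on M U" "\<And>x. x \<in> U \<Longrightarrow> s x = (\<Sum>i<r. c i x *\<^sub>R e i x)"
proof -
  have "\<forall>x\<in>U. \<exists>c. s x = (\<Sum>i<r. c i *\<^sub>R e i x)"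
  proof
    fix x assume x: "x \<in> U"
    have "s x \<in> F x" using sub s by simp
    then show "\<exists>c. s x = (\<Sum>i<r. c i *\<^sub>R e i x)" unfolding local_frameD(4)[OF e x] by (simp add: image_iff)
  qed
  then obtain c where c: "\<And>x. x \<in> U \<Longrightarrow> s x = (\<Sum>i<r. c x i *\<^sub>R e i x)" by metis
  have "smooth_at (\<lambda>z. c z i) x" if i: "i < r" and x: "x \<in> U" for i x
  proof -
    obtain K :: "(bool \<times> nat) set" and l where
      l0: "(\<forall>k\<in>K. (\<forall>z. linear (l k z)) \<and> (\<forall>s\<in>\<Gamma>. smooth_at (\<lambda>z. l k z (s z)) x)) \<and>
       (\<forall>u\<in>F x. (\<forall>k\<in>K. l k x u = 0) \<longrightarrow> u = 0)" using sep[unfolded smoothly_separated_def, rule_format, of x] by (elim exE)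
    then have l: "\<And>k z. k \<in> K \<Longrightarrow> linear (l k z)"
      "\<And>k s. k \<in> K \<Longrightarrow> s \<in> \<Gamma> \<Longrightarrow> smooth_at (\<lambda>z. l k z (s z)) x"
      "\<And>u. u \<in> F x \<Longrightarrow> \<forall>k\<in>K. l k x u = 0 \<Longrightarrow> u = 0" by simp_all
    have lsum: "l k z (\<Sum>i<r. d i *\<^sub>R e i z) = (\<Sum>i<r. l k z (e i z) * d i)" if "k \<in> K" for k z d
      using l(1)[OF that] by (simp add: linear_sum linear_cmul mult.commute)
    show ?thesis
    proof (rule linear_system_smooth[where K = K and c = "\<lambda>i z. c z i" and P = "\<lambda>k i z. l k z (e i z)" and b = "\<lambda>k z. l k z (s z)", OF _ _ _ _ i])
      show "smooth_at (\<lambda>z. l k z (e i z)) x" if "k \<in> K" "i < r" for k i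
        by (rule l(2)[OF that(1) local_frameD(2)[OF e that(2)]])
      show "smooth_at (\<lambda>z. l k z (s z)) x" if "k \<in> K" for k by (rule l(2)[OF that s])
      show "eventually (\<lambda>z. \<forall>k\<in>K. (\<Sum>i<r. l k z (e i z) * c z i) = l k z (s z)) (nhds x)"
        using eventually_nhds_in_open[OF local_frameD(1)[OF e] x]
        by eventually_elim (simp add: c lsum)
      fix d j assume d: "\<And>k. k \<in> K \<Longrightarrow> (\<Sum>i<r. l k x (e i x) * d i) = 0" and j: "j < r"
      have "(\<Sum>i<r. d i *\<^sub>R e i x) = 0"
        by (rule l(3)) (use local_frameD(4)[OF e x] d lsum in auto)
      then show "d j = 0" by (rule local_frameD(3)[OF e x _ j])
    qed
  qed
  then have "(\<lambda>z. c z i) \<in> Cinf_on M U" if "i < r" for i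
    using that Cinf_on_iff[OF local_frameD(1)[OF e]] by blast
  then show ?thesis using c by (intro that[of "\<lambda>i z. c z i"]) auto
qed

text \<open>The definition asks for smooth coefficients in every frame, which separation provides.
  Conversely, smooth coefficients in one frame around each point suffice by \<open>loc\<close>; they
  are first replaced near the point by global functions, the form in which closure properties are
  easy to verify.\<close>

lemma vector_bundle_criterion:
  fixes F :: "'m \<Rightarrow> 'a::real_vector set" and \<Gamma> :: "('m \<Rightarrow> 'a) set"
  assumes frames: "\<And>x. \<exists>U e. x \<in> U \<and> local_frame F \<Gamma> r U e"
    and sub: "\<And>s x. s \<in> \<Gamma> \<Longrightarrow> s x \<in> F x"
    and sep: "smoothly_separated F \<Gamma>"
    and loc: "\<And>s. (\<And>x. s x \<in> F x) \<Longrightarrow>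
       (\<And>x. \<exists>e c. (\<forall>i<r. e i \<in> \<Gamma> \<and> c i \<in> Cinf M) \<and> eventually (\<lambda>z. s z = (\<Sum>i<r. c i z *\<^sub>R e i z)) (nhds x)) \<Longrightarrow>
       s \<in> \<Gamma>"
  shows "vector_bundle M F \<Gamma>"
  unfolding vector_bundle_def
proof (intro exI[of _ r] conjI allI iffI impI)
  show "\<exists>U e. x \<in> U \<and> local_frame F \<Gamma> r U e" for x by (rule frames)
  show "s x \<in> F x" if "s \<in> \<Gamma>" for s x by (rule sub[OF that])
  show "\<exists>c. (\<forall>i<r. c i \<in> Cinf_on M U) \<and> (\<forall>x\<in>U. s x = (\<Sum>i<r. c i x *\<^sub>R e i x))"
    if s: "s \<in> \<Gamma>" and e: "local_frame F \<Gamma> r U e" for s U e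
  proof -
    have "\<forall>s\<in>\<Gamma>. \<forall>x. s x \<in> F x" using sub by blast
    then obtain c where "\<And>i. i < r \<Longrightarrow> c i \<in> Cinf_on M U" "\<And>x. x \<in> U \<Longrightarrow> s x = (\<Sum>i<r. c i x *\<^sub>R e i x)"
      using frame_coefficients[OF _ sep s e] by metis
    then show ?thesis by (intro exI[of _ c]) simp
  qed
next
  fix s assume s: "(\<forall>x. s x \<in> F x) \<and> (\<forall>U e. local_frame F \<Gamma> r U e \<longrightarrow>
      (\<exists>c. (\<forall>i<r. c i \<in> Cinf_on M U) \<and> (\<forall>x\<in>U. s x = (\<Sum>i<r. c i x *\<^sub>R e i x))))"
  show "s \<in> \<Gamma>"
  proof (rule loc)
    show "s x \<in> F x" for x using s by blast
    fix x
    obtain U e where e: "x \<in> U" "local_frame F \<Gamma> r U e" using frames by blast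
    then obtain c where c: "\<And>i. i < r \<Longrightarrow> c i \<in> Cinf_on M U" "\<And>x. x \<in> U \<Longrightarrow> s x = (\<Sum>i<r. c i x *\<^sub>R e i x)"
      using s by blast
    note U = local_frameD(1)[OF e(2)]
    have "\<exists>h\<in>Cinf M. eventually (\<lambda>z. h z = c i z) (nhds x)" if "i < r" for i
      using smooth_at_extend[OF smooth_atI[OF U e(1) c(1)[OF that]]] by blast
    then obtain h where h: "\<And>i. i < r \<Longrightarrow> h i \<in> Cinf M" "\<And>i. i < r \<Longrightarrow> eventually (\<lambda>z. h i z = c i z) (nhds x)"
      by metis
    have "eventually (\<lambda>z. \<forall>i\<in>{..<r}. h i z = c i z) (nhds x)"
      using h(2) by (intro eventually_ball_finite) auto
    then have "eventually (\<lambda>z. s z = (\<Sum>i<r. h i z *\<^sub>R e i z)) (nhds x)"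
      using eventually_nhds_in_open[OF U e(1)] by eventually_elim (simp add: c(2))
    then show "\<exists>e c. (\<forall>i<r. e i \<in> \<Gamma> \<and> c i \<in> Cinf M) \<and> eventually (\<lambda>z. s z = (\<Sum>i<r. c i z *\<^sub>R e i z)) (nhds x)"
      using h(1) local_frameD(2)[OF e(2)] by blast
  qed
qed

text \<open>Elimination on frames: an element on which l is nonzero near x is moved to the last
  index, and subtracting multiples of it makes l vanish on the other r elements.\<close>

lemma kernel_frame_step:
  fixes F :: "'m \<Rightarrow> 'a::real_vector set"
  assumes e: "local_frame F \<Gamma> (Suc r) U e" and x: "x \<in> U"
    and \<Gamma>: "\<And>s t h. s \<in> \<Gamma> \<Longrightarrow> t \<in> \<Gamma> \<Longrightarrow> h \<in> Cinf M \<Longrightarrow> (\<lambda>z. s z + h z *\<^sub>R t z) \<in> \<Gamma>"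
    and lin: "\<And>z. linear (l z)" and sm: "\<And>s. s \<in> \<Gamma> \<Longrightarrow> (\<lambda>z. l z (s z)) \<in> Cinf M"
    and u: "u \<in> F x" "l x u \<noteq> 0"
  obtains U' e' where "x \<in> U'" "local_frame (\<lambda>z. {u \<in> F z. l z u = 0}) \<Gamma> r U' e'"
proof -
  have lsum: "l z (\<Sum>i\<in>I. c i *\<^sub>R e i z) = (\<Sum>i\<in>I. c i * l z (e i z))" for z c I and e :: "nat \<Rightarrow> 'm \<Rightarrow> 'a"
    using lin[of z] by (simp add: linear_sum linear_cmul)
  obtain c0 where c0: "u = (\<Sum>i<Suc r. c0 i *\<^sub>R e i x)" using u(1) local_frameD(4)[OF e x] by auto
  have "\<exists>j<Suc r. l x (e j x) \<noteq> 0"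
  proof (rule ccontr)
    assume "\<not> ?thesis"
    then have "l x u = 0" unfolding c0 lsum by (intro sum.neutral) auto
    then show False using u by simp
  qed
  then obtain j where j: "j < Suc r" "l x (e j x) \<noteq> 0" by blast
  define e1 where "e1 i = e (Transposition.transpose j r i)" for i
  have "bij_betw (Transposition.transpose j r) {..<Suc r} {..<Suc r}"
    using j by (intro bij_betw_transpose_iff) auto
  from local_frame_permute[OF this e] have e1: "local_frame F \<Gamma> (Suc r) U e1" by (simp add: e1_def[abs_def])
  note e1D = local_frameD[OF e1]
  define g where "g z = l z (e1 r z)" for z
  have gC: "g \<in> Cinf M" unfolding g_def[abs_def] by (rule sm[OF e1D(2)]) simp
  have gx: "g x \<noteq> 0" using j by (simp add: g_def e1_def)
  \<comment> \<open>The quotient is smooth only where g does not vanish, but \<Gamma> is known to be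
    closed under global factors; hence the passage to a global function with the same germ at
    x.\<close>
  have "\<exists>q\<in>Cinf M. eventually (\<lambda>z. q z = - l z (e1 i z) / g z) (nhds x)" if "i < r" for i
  proof -
    have "smooth_at (\<lambda>z. - l z (e1 i z) / g z) x"
      by (intro smooth_at_divide smooth_at_minus Cinf_smooth_at sm e1D(2) gC gx) (use that in simp)
    then show ?thesis by (rule smooth_at_extend) blast
  qed
  then obtain q where q: "\<And>i. i < r \<Longrightarrow> q i \<in> Cinf M"
    "\<And>i. i < r \<Longrightarrow> eventually (\<lambda>z. q i z = - l z (e1 i z) / g z) (nhds x)" by metis
  have "eventually (\<lambda>z. z \<in> U \<and> g z \<noteq> 0 \<and> (\<forall>i\<in>{..<r}. q i z = - l z (e1 i z) / g z)) (nhds x)"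
    using q(2) by (intro eventually_conj eventually_nhds_in_open[OF e1D(1) x] eventually_ball_finite
        smooth_at_nonzero[OF Cinf_smooth_at[OF gC] gx]) auto
  then obtain U' where U': "open U'" "x \<in> U'" "U' \<subseteq> U" "\<And>z. z \<in> U' \<Longrightarrow> g z \<noteq> 0"
    "\<And>z i. z \<in> U' \<Longrightarrow> i < r \<Longrightarrow> q i z = - l z (e1 i z) / g z"
    unfolding eventually_nhds by blast
  define e' where "e' i z = e1 i z + q i z *\<^sub>R e1 r z" for i z
  have sum': "(\<Sum>i<r. c i *\<^sub>R e' i z) = (\<Sum>i<Suc r. (if i = r then \<Sum>i<r. c i * q i z else c i) *\<^sub>R e1 i z)" for c z
    by (simp add: e'_def scaleR_add_right sum.distrib scaleR_sum_left)
  have "local_frame (\<lambda>z. {u \<in> F z. l z u = 0}) \<Gamma> r U' e'"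
    unfolding local_frame_iff
  proof (intro conjI ballI allI impI)
    show "open U'" by (rule U')
    show "e' i \<in> \<Gamma>" if "i < r" for i
      unfolding e'_def[abs_def] using that by (intro \<Gamma> e1D(2) q) auto
    fix z assume z: "z \<in> U'"
    then have zU: "z \<in> U" using U' by blast
    show "c i = 0" if "(\<Sum>i<r. c i *\<^sub>R e' i z) = 0" "i < r" for c i
      using e1D(3)[OF zU that(1)[unfolded sum'], of i] that(2) by simp
    have le': "l z (e' i z) = 0" if "i < r" for i
      using that lin[of z] U'(4)[OF z] U'(5)[OF z that] by (simp add: e'_def linear_add linear_diff linear_cmul g_def)
    show "{u \<in> F z. l z u = 0} = range (\<lambda>c. \<Sum>i<r. c i *\<^sub>R e' i z)"
    proof (intro equalityI subsetI)
      fix w assume w: "w \<in> {u \<in> F z. l z u = 0}"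
      then obtain c where c: "w = (\<Sum>i<Suc r. c i *\<^sub>R e1 i z)" using e1D(4)[OF zU] by auto
      then have "l z (\<Sum>i<Suc r. c i *\<^sub>R e1 i z) = 0" using w by simp
      then have "(\<Sum>i<r. c i * l z (e1 i z)) + c r * g z = 0" unfolding lsum by (simp add: g_def)
      then have "c r = - (\<Sum>i<r. c i * l z (e1 i z)) / g z" using U'(4)[OF z] by (simp add: field_simps)
      also have "\<dots> = (\<Sum>i<r. c i * q i z)"
        using U'(5)[OF z] by (simp add: sum_divide_distrib sum_negf)
      finally have "w = (\<Sum>i<r. c i *\<^sub>R e' i z)"
        unfolding sum' c by (intro sum.cong) auto
      then show "w \<in> range (\<lambda>c. \<Sum>i<r. c i *\<^sub>R e' i z)" by blast
    next
      fix w assume "w \<in> range (\<lambda>c. \<Sum>i<r. c i *\<^sub>R e' i z)"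
      then obtain c where c: "w = (\<Sum>i<r. c i *\<^sub>R e' i z)" by blast
      have "l z w = 0" unfolding c lsum by (simp add: le')
      moreover have "w \<in> F z" unfolding c sum' e1D(4)[OF zU] by (rule rangeI)
      ultimately show "w \<in> {u \<in> F z. l z u = 0}" by simp
    qed
  qed
  with U'(2) show ?thesis by (rule that)
qed

text \<open>The condition \<open>onto\<close> is surjectivity at x in triangular form: each
  functional is nonzero on the common kernel of its predecessors. So the elimination step can be
  iterated, each time lowering the rank by one.\<close>

lemma kernel_frame:
  fixes F :: "'m \<Rightarrow> 'a::real_vector set"
  assumes e: "local_frame F \<Gamma> (r + m) U e" and x: "x \<in> U"
    and \<Gamma>: "\<And>s t h. s \<in> \<Gamma> \<Longrightarrow> t \<in> \<Gamma> \<Longrightarrow> h \<in> Cinf M \<Longrightarrow> (\<lambda>z. s z + h z *\<^sub>R t z) \<in> \<Gamma>"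
    and lin: "\<And>k z. k < m \<Longrightarrow> linear (l k z)"
    and sm: "\<And>k s. k < m \<Longrightarrow> s \<in> \<Gamma> \<Longrightarrow> (\<lambda>z. l k z (s z)) \<in> Cinf M"
    and onto: "\<And>k. k < m \<Longrightarrow> \<exists>u\<in>F x. l k x u \<noteq> 0 \<and> (\<forall>j<k. l j x u = 0)"
  shows "\<exists>U' e'. x \<in> U' \<and> local_frame (\<lambda>z. {u \<in> F z. \<forall>k<m. l k z u = 0}) \<Gamma> r U' e'"
  using e lin sm onto
proof (induction m arbitrary: r)
  case 0
  then show ?case using x by auto
next
  case (Suc m)
  have "\<exists>U' e'. x \<in> U' \<and> local_frame (\<lambda>z. {u \<in> F z. \<forall>k<m. l k z u = 0}) \<Gamma> (Suc r) U' e'"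
    by (rule Suc.IH) (use Suc.prems in auto)
  then obtain U' e' where e': "x \<in> U'" "local_frame (\<lambda>z. {u \<in> F z. \<forall>k<m. l k z u = 0}) \<Gamma> (Suc r) U' e'" by blast
  obtain u where "u \<in> F x" "l m x u \<noteq> 0" "\<forall>j<m. l j x u = 0" using Suc.prems(4)[of m] by blast
  then have u: "u \<in> {u \<in> F x. \<forall>k<m. l k x u = 0}" "l m x u \<noteq> 0" by auto
  obtain U'' e'' where e'': "x \<in> U''"
    "local_frame (\<lambda>z. {u \<in> {u \<in> F z. \<forall>k<m. l k z u = 0}. l m z u = 0}) \<Gamma> r U'' e''"
  proof (rule kernel_frame_step[OF e'(2,1) \<Gamma> Suc.prems(2)[OF lessI] Suc.prems(3)[OF lessI] u])
  qed (assumption | rule that)+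
  have "{u \<in> {u \<in> F z. \<forall>k<m. l k z u = 0}. l m z u = 0} = {u \<in> F z. \<forall>k<Suc m. l k z u = 0}" for z
    by (auto simp: less_Suc_eq)
  then show ?case using e'' by auto
qed

end

section \<open>The pullback of a Dirac structure\<close>

lemma sum_lessThan_add: "(\<Sum>i<m + n. g i) = (\<Sum>i<m. g i) + (\<Sum>j<n. g (m + j))" for g :: "nat \<Rightarrow> 'a::comm_monoid_add"
  by (induction n) (simp_all add: add.assoc)

lemma sum_add_bilinear:
  fixes a :: "'k \<Rightarrow> real"
  shows "(\<Sum>k\<in>K. y * a k + (\<Sum>i\<in>I. c i * A i k + d i * E i k)) =
    y * (\<Sum>k\<in>K. a k) + (\<Sum>i\<in>I. c i * (\<Sum>k\<in>K. A i k) + d i * (\<Sum>k\<in>K. E i k))"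
  by (simp add: sum.distrib sum_distrib_left sum.swap[of _ I K])

lemma sum_diff_bilinear:
  fixes a :: "'k \<Rightarrow> real"
  shows "(\<Sum>k\<in>K. y * a k + (\<Sum>i\<in>I. c i * A i k - d i * E i k)) =
    y * (\<Sum>k\<in>K. a k) + (\<Sum>i\<in>I. c i * (\<Sum>k\<in>K. A i k) - d i * (\<Sum>k\<in>K. E i k))"
  by (simp add: sum.distrib sum_subtractf sum_distrib_left sum.swap[of _ I K])

locale dirac_pullback = B: smooth_mfd B + M: smooth_mfd M
  for B :: "('b::{t2_space, second_countable_topology}, 'd::euclidean_space) manifold"
    and M :: "('m::{t2_space, second_countable_topology}, 'e::euclidean_space) manifold" +
  fixes f :: "'b \<Rightarrow> 'm" and L :: "'m \<Rightarrow> ('m tvec \<times> 'm cotvec) set"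
  assumes f: "smooth_map B M f" and L: "dirac_structure M L" and transverse: "transverse B M f L"
begin

section \<open>The comparison map from the pullback algebroid to the pullback Dirac
  structure\<close>

abbreviation "pf \<equiv> pushforward M f"
abbreviation "pb \<equiv> pullback_cov B M f"
abbreviation "BL \<equiv> pullback_dirac B M f L"
abbreviation "A \<equiv> dirac_algebroid M L"
abbreviation "PF \<equiv> pullback_fibre B M f A"
abbreviation "PS \<equiv> pullback_sections B M f A"

lemma f_Cinf: "g \<in> Cinf M \<Longrightarrow> g \<circ> f \<in> Cinf B"
  by (rule smooth_map_Cinf[OF B.smooth_manifold M.smooth_manifold f])

lemma f_Cinf': "g \<in> Cinf M \<Longrightarrow> (\<lambda>x. g (f x)) \<in> Cinf B"
  using f_Cinf[of g] by (simp add: comp_def)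

lemma eventually_f: "eventually P (nhds (f x)) \<Longrightarrow> eventually (\<lambda>z. P (f z)) (nhds x)"
proof -
  have "isCont f x" using f by (simp add: smooth_map_def continuous_on_eq_continuous_at)
  then have "filterlim f (nhds (f x)) (nhds x)" by (simp add: continuous_at filterlim_at_within_not_equal tendsto_at_iff_tendsto_nhds)
  then show "eventually P (nhds (f x)) \<Longrightarrow> eventually (\<lambda>z. P (f z)) (nhds x)"
    by (simp add: filterlim_iff)
qed

lemma L_max: "maximal_isotropic M x (L x)"
  using L by (simp add: dirac_structure_def)

lemma L_subspace: "subspace (L x)" and L_sub: "L x \<subseteq> gen_tangent M x" and L_isotropic: "isotropic (L x)"
  using L_max[of x] by (simp_all add: maximal_isotropic_def)

lemma L_pairing: "a \<in> L x \<Longrightarrow> b \<in> L x \<Longrightarrow> snd a (fst b) + snd b (fst a) = 0"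
  using L_isotropic[of x] by (simp add: isotropic_def pairing_def)

lemma L_gen: "a \<in> L x \<Longrightarrow> fst a \<in> tangent M x" "a \<in> L x \<Longrightarrow> snd a \<in> cotangent M x"
  using L_sub[of x] by (auto simp: gen_tangent_def)

lemma L_courant: "s \<in> dirac_sections M L \<Longrightarrow> t \<in> dirac_sections M L \<Longrightarrow> courant M s t \<in> dirac_sections M L"
  using L by (simp add: dirac_structure_def)

lemma sections_L: "s \<in> dirac_sections M L \<Longrightarrow> s x \<in> L x" "s \<in> dirac_sections M L \<Longrightarrow> s \<in> gen_sections M"
  by (simp_all add: dirac_sections_def)

lemma pf_apply: "g \<in> Cinf M \<Longrightarrow> pf v g = v (g \<circ> f)"
  by (simp add: pushforward_def)

lemma pf_tangent: assumes v: "v \<in> tangent B x" shows "pf v \<in> tangent M (f x)"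
proof (rule M.tangentI)
  fix g h a b assume gh: "g \<in> Cinf M" "h \<in> Cinf M"
  have "(\<lambda>y. a * g y + b * h y) \<in> Cinf M" "(\<lambda>y. g y * h y) \<in> Cinf M" by (intro smooth_intros gh)+
  then show "pf v (\<lambda>y. a * g y + b * h y) = a * pf v g + b * pf v h"
    "pf v (\<lambda>y. g y * h y) = g (f x) * pf v h + h (f x) * pf v g"
    using B.tangent_comb[OF v f_Cinf[OF gh(1)] f_Cinf[OF gh(2)], of a b]
      B.tangent_mult[OF v f_Cinf[OF gh(1)] f_Cinf[OF gh(2)]] gh
    by (simp_all add: pf_apply comp_def)
qed (simp add: pushforward_def)

lemma linear_pf: "linear pf"
  by (rule linearI) (auto simp: pushforward_def fun_eq_iff fun_apply)

lemma pb_apply: "v \<in> tangent B x \<Longrightarrow> pb x \<eta> v = \<eta> (pf v)"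
  by (simp add: pullback_cov_def)

lemma pb_cotangent: assumes "\<eta> \<in> cotangent M (f x)" shows "pb x \<eta> \<in> cotangent B x"
proof (rule B.cotangentI)
  fix v w a b assume v: "v \<in> tangent B x" and w: "w \<in> tangent B x"
  have "a *\<^sub>R v + b *\<^sub>R w \<in> tangent B x"
    by (intro subspace_add[OF B.subspace_tangent] subspace_mul[OF B.subspace_tangent] v w)
  then show "pb x \<eta> (a *\<^sub>R v + b *\<^sub>R w) = a * pb x \<eta> v + b * pb x \<eta> w"
    by (simp only: pb_apply v w linear_add[OF linear_pf] linear_cmul[OF linear_pf]
        M.cotangent_comb[OF assms pf_tangent[OF v] pf_tangent[OF w]])
qed (simp add: pullback_cov_def)

lemma linear_pb: "linear (pb x)"
  by (rule linearI) (auto simp: pullback_cov_def fun_eq_iff fun_apply)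

definition forget :: "'b \<Rightarrow> ('m tvec \<times> 'm cotvec) \<times> 'b tvec \<Rightarrow> 'b tvec \<times> 'b cotvec" where
  "forget x u = (snd u, pb x (snd (fst u)))"

lemma fst_forget [simp]: "fst (forget x u) = snd u" and snd_forget: "snd (forget x u) = pb x (snd (fst u))"
  by (simp_all add: forget_def)

lemma linear_forget: "linear (forget x)"
  by (rule linearI) (auto simp: forget_def linear_add[OF linear_pb] linear_cmul[OF linear_pb])

lemma PF_iff: "u \<in> PF x \<longleftrightarrow> fst u \<in> L (f x) \<and> snd u \<in> tangent B x \<and> fst (fst u) = pf (snd u)"
  by (cases u) (simp add: pullback_fibre_def dirac_algebroid_def)

lemma subspace_PF: "subspace (PF x)"
  unfolding subspace_def
  by (auto simp: PF_iff linear_0[OF linear_pf] linear_add[OF linear_pf] linear_cmul[OF linear_pf]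
      intro!: subspace_0[OF L_subspace] subspace_add[OF L_subspace] subspace_mul[OF L_subspace]
      subspace_0[OF B.subspace_tangent] subspace_add[OF B.subspace_tangent] subspace_mul[OF B.subspace_tangent])

lemma forget_image: "forget x ` PF x = BL x"
proof
  show "forget x ` PF x \<subseteq> BL x"
  proof
    fix w assume "w \<in> forget x ` PF x"
    then obtain u where u: "u \<in> PF x" "w = forget x u" by blast
    then have "(pf (snd u), snd (fst u)) \<in> L (f x)" by (metis PF_iff prod.collapse)
    then show "w \<in> BL x" using u L_gen(2)[of "fst u"] unfolding pullback_dirac_def forget_def PF_iff by blast
  qed
  show "BL x \<subseteq> forget x ` PF x"
  proof
    fix w assume "w \<in> BL x"
    then obtain v \<eta> where w: "w = (v, pb x \<eta>)" "v \<in> tangent B x" "(pf v, \<eta>) \<in> L (f x)"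
      unfolding pullback_dirac_def by blast
    then have "((pf v, \<eta>), v) \<in> PF x" "w = forget x ((pf v, \<eta>), v)" by (simp_all add: PF_iff forget_def)
    then show "w \<in> forget x ` PF x" by blast
  qed
qed

text \<open>If \<open>(0, \<eta>) \<in> L\<close> then \<open>\<eta>\<close> annihilates \<open>\<rho>(L)\<close> by isotropy, so transversality leaves no
  room for a nonzero \<open>\<eta>\<close> with \<open>f\<^sup>*\<eta> = 0\<close>.\<close>

lemma forget_kernel:
  assumes u: "u \<in> PF x" and 0: "forget x u = 0"
  shows "u = 0"
proof -
  obtain w \<eta> v where [simp]: "u = ((w, \<eta>), v)" by (metis prod.collapse)
  have v: "v = 0" and pb0: "pb x \<eta> = 0" using 0 by (simp_all add: forget_def zero_prod_def)
  have L: "(w, \<eta>) \<in> L (f x)" "w = pf v" using u by (auto simp: PF_iff)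
  have w: "w = 0" using L(2) v linear_0[OF linear_pf] by simp
  have \<eta>: "\<eta> \<in> cotangent M (f x)" using L_gen(2)[OF L(1)] by simp
  have "\<eta> z = 0" for z
  proof (cases "z \<in> tangent M (f x)")
    case True
    then obtain a y where z: "z = fst a + pf y" "a \<in> L (f x)" "y \<in> tangent B x"
      using transverse unfolding transverse_def by blast
    have "snd a 0 = 0"
      using M.cotangent_scale[OF L_gen(2)[OF z(2)] L_gen(1)[OF z(2)], of 0] by simp
    then have "\<eta> (fst a) = 0" using L_pairing[OF L(1) z(2)] w by simp
    moreover have "\<eta> (pf y) = 0" using pb_apply[OF z(3), of \<eta>] pb0 by (simp add: fun_apply)
    ultimately show ?thesis
      unfolding z(1) M.cotangent_add[OF \<eta> L_gen(1)[OF z(2)] pf_tangent[OF z(3)]] by simp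
  qed (rule M.cotangent_outside[OF \<eta>])
  then have "\<eta> = 0" by (simp add: fun_eq_iff fun_apply)
  then show ?thesis using v w by (simp add: zero_prod_def)
qed

lemma forget_inj: "u \<in> PF x \<Longrightarrow> w \<in> PF x \<Longrightarrow> forget x u = forget x w \<Longrightarrow> u = w"
  using forget_kernel[of "u - w" x] subspace_diff[OF subspace_PF] linear_diff[OF linear_forget] by simp

lemma BL_gen: "BL x \<subseteq> gen_tangent B x"
  unfolding pullback_dirac_def gen_tangent_def using pb_cotangent by blast

text \<open>Because w' is the pushforward of v', the pullback of eta takes the value eta(w') on v';
  the pairing on \<open>BL\<close> is therefore the pairing of the corresponding elements of
  L.\<close>

lemma BL_isotropic: "isotropic (BL x)"
  unfolding isotropic_def
proof (intro ballI)
  fix a b assume "a \<in> BL x" "b \<in> BL x"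
  then obtain u w where u: "u \<in> PF x" "a = forget x u" and w: "w \<in> PF x" "b = forget x w"
    unfolding forget_image[symmetric] by blast
  have "pairing a b = snd (fst u) (fst (fst w)) + snd (fst w) (fst (fst u))"
    using u w by (simp add: pairing_def snd_forget PF_iff pb_apply)
  also have "\<dots> = 0" by (rule L_pairing[of _ "f x"]) (use u w in \<open>simp_all add: PF_iff\<close>)
  finally show "pairing a b = 0" .
qed

lemma subspace_BL: "subspace (BL x)"
  unfolding forget_image[symmetric] by (rule linear_subspace_image[OF linear_forget subspace_PF])

text \<open>A mere fibrewise inverse. That it respects smooth sections is not visible here; this
  takes frames and is the content of \<open>lift_section\<close>.\<close>

definition lift :: "'b \<Rightarrow> 'b tvec \<times> 'b cotvec \<Rightarrow> ('m tvec \<times> 'm cotvec) \<times> 'b tvec" where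
  "lift x = inv_into (PF x) (forget x)"

lemma lift_PF: "a \<in> BL x \<Longrightarrow> lift x a \<in> PF x" and forget_lift: "a \<in> BL x \<Longrightarrow> forget x (lift x a) = a"
  unfolding lift_def forget_image[symmetric] by (rule inv_into_into, assumption) (rule f_inv_into_f)

lemma forget_BL: "u \<in> PF x \<Longrightarrow> forget x u \<in> BL x"
  using forget_image by blast

lemma lift_forget: "u \<in> PF x \<Longrightarrow> lift x (forget x u) = u"
  by (rule forget_inj[OF lift_PF[OF forget_BL] _ forget_lift[OF forget_BL]])

lemma dirac_sections_BL_comb:
  assumes "s \<in> dirac_sections B BL" "t \<in> dirac_sections B BL" "g \<in> Cinf B" "h \<in> Cinf B"
  shows "(\<lambda>x. g x *\<^sub>R s x + h x *\<^sub>R t x) \<in> dirac_sections B BL"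
proof -
  have g: "s \<in> gen_sections B" "t \<in> gen_sections B" and i: "\<And>x. s x \<in> BL x" "\<And>x. t x \<in> BL x"
    using assms by (simp_all add: dirac_sections_def)
  have "(\<lambda>x. g x *\<^sub>R (fst \<circ> s) x + h x *\<^sub>R (fst \<circ> t) x) \<in> vfields B"
    "(\<lambda>x. g x *\<^sub>R (snd \<circ> s) x + h x *\<^sub>R (snd \<circ> t) x) \<in> forms B"
    by (intro B.vfields_add B.vfields_scale B.forms_add B.forms_scale B.gen_sectionsD g assms)+
  moreover have "g x *\<^sub>R s x + h x *\<^sub>R t x \<in> BL x" for x
    by (intro subspace_add[OF subspace_BL] subspace_mul[OF subspace_BL] i)
  ultimately show ?thesis by (simp add: dirac_sections_def gen_sections_def comp_def)
qed

section \<open>Sections with local presentations\<close>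

lemma PSD: "s \<in> PS \<Longrightarrow> s x \<in> PF x" "s \<in> PS \<Longrightarrow> snd \<circ> s \<in> vfields B"
  "s \<in> PS \<Longrightarrow> \<exists>n h a. presented_near B A f x (fst \<circ> s) n h a"
  by (simp_all add: pullback_sections_def)

lemma presented_nearD:
  assumes "presented_near B A f x \<sigma> n h a"
  shows "i < n \<Longrightarrow> h i \<in> Cinf B" "i < n \<Longrightarrow> a i \<in> dirac_sections M L"
    "eventually (\<lambda>z. \<sigma> z = (\<Sum>i<n. h i z *\<^sub>R a i (f z))) (nhds x)"
  using assms unfolding presented_near_def eventually_nhds by (auto simp: dirac_algebroid_def)

text \<open>If the form of a_i is sum_k p_ik dq_ik near f x, then the pullback of sum_i h_i a_i is
  the sum over pairs (i, k) of h_i (p_ik o f) d(q_ik o f): the pushforward inside the pullback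
  covector turns into composition of q_ik with f.\<close>

lemma presented_form:
  assumes s: "\<And>z. s z \<in> PF z" and p: "presented_near B A f x (fst \<circ> s) n h a"
    and r: "\<And>i. i < n \<Longrightarrow> M.presents_form (snd \<circ> a i) (f x) {..<m} (p i) (q i)"
  shows "B.presents_form (\<lambda>z. snd (forget z (s z))) x ({..<n} \<times> {..<m})
    (\<lambda>(i, k) z. h i z * p i k (f z)) (\<lambda>(i, k) z. q i k (f z))"
  unfolding B.presents_form_def
proof (intro conjI ballI)
  note pD = presented_nearD[OF p]
  fix j assume "j \<in> {..<n} \<times> {..<m}"
  then obtain i k where j: "j = (i, k)" "i < n" "k < m" by blast
  show "(case j of (i, k) \<Rightarrow> \<lambda>z. h i z * p i k (f z)) \<in> Cinf B" "(case j of (i, k) \<Rightarrow> \<lambda>z. q i k (f z)) \<in> Cinf B"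
    using j M.presents_formD(1,2)[OF r[OF j(2)], of k] pD(1)[OF j(2)] by (auto intro!: B.Cinf_mult f_Cinf')
next
  note pD = presented_nearD[OF p]
  have "eventually (\<lambda>z. \<forall>i\<in>{..<n}. \<forall>v\<in>tangent M (f z). (snd \<circ> a i) (f z) v = (\<Sum>k<m. p i k (f z) * v (q i k))) (nhds x)"
    using M.presents_formD(3)[OF r] by (intro eventually_ball_finite ballI eventually_f) auto
  then show "eventually (\<lambda>z. \<forall>v\<in>tangent B z. snd (forget z (s z)) v =
      (\<Sum>j\<in>{..<n} \<times> {..<m}. (case j of (i, k) \<Rightarrow> \<lambda>z. h i z * p i k (f z)) z * v (case j of (i, k) \<Rightarrow> \<lambda>z. q i k (f z)))) (nhds x)"
    using pD(3)
  proof eventually_elim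
    case (elim z)
    show ?case
    proof
      fix v assume v: "v \<in> tangent B z"
      have "snd (forget z (s z)) v = snd (fst (s z)) (pf v)" using pb_apply[OF v] by (simp add: snd_forget)
      also have "\<dots> = (\<Sum>i<n. h i z * snd (a i (f z)) (pf v))"
        using elim(2) by (simp add: snd_sum fun_apply)
      also have "\<dots> = (\<Sum>i<n. \<Sum>k<m. h i z * p i k (f z) * v (\<lambda>z. q i k (f z)))"
      proof (intro sum.cong refl)
        fix i assume i: "i \<in> {..<n}"
        have "snd (a i (f z)) (pf v) = (\<Sum>k<m. p i k (f z) * pf v (q i k))"
          using elim(1) i pf_tangent[OF v] by simp
        also have "\<dots> = (\<Sum>k<m. p i k (f z) * v (\<lambda>z. q i k (f z)))"
          using M.presents_formD(2)[OF r] i by (intro sum.cong) (auto simp: pf_apply comp_def)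
        finally show "h i z * snd (a i (f z)) (pf v) = (\<Sum>k<m. h i z * p i k (f z) * v (\<lambda>z. q i k (f z)))"
          by (simp add: sum_distrib_left mult.assoc)
      qed
      also have "\<dots> = (\<Sum>j\<in>{..<n} \<times> {..<m}. (case j of (i, k) \<Rightarrow> \<lambda>z. h i z * p i k (f z)) z * v (case j of (i, k) \<Rightarrow> \<lambda>z. q i k (f z)))"
        by (simp add: sum.cartesian_product split_def)
      finally show "snd (forget z (s z)) v = \<dots>" .
    qed
  qed
qed

lemma presented_form_exists:
  assumes s: "\<And>z. s z \<in> PF z" and p: "presented_near B A f x (fst \<circ> s) n h a"
  obtains p q where "\<And>i. i < n \<Longrightarrow> M.presents_form (snd \<circ> a i) (f x) {..<dim (model M)} (p i) (q i)"
    "B.presents_form (\<lambda>z. snd (forget z (s z))) x ({..<n} \<times> {..<dim (model M)})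
       (\<lambda>(i, k) z. h i z * p i k (f z)) (\<lambda>(i, k) z. q i k (f z))"
proof -
  have "\<forall>i. \<exists>p q. i < n \<longrightarrow> M.presents_form (snd \<circ> a i) (f x) {..<dim (model M)} p q"
  proof
    fix i
    show "\<exists>p q. i < n \<longrightarrow> M.presents_form (snd \<circ> a i) (f x) {..<dim (model M)} p q"
    proof (cases "i < n")
      case True
      have "snd \<circ> a i \<in> forms M"
        using presented_nearD(2)[OF p True] sections_L(2) M.gen_sectionsD(2) by blast
      then obtain p q where "M.presents_form (snd \<circ> a i) (f x) {..<dim (model M)} p q"
        by (rule M.form_presentation_exists)
      then show ?thesis by blast
    qed simp
  qed
  then obtain p q where r: "\<And>i. i < n \<Longrightarrow> M.presents_form (snd \<circ> a i) (f x) {..<dim (model M)} (p i) (q i)"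
    by metis
  show ?thesis by (rule that[OF r presented_form[OF s p r]])
qed

text \<open>Smoothness of the pulled-back form is a local matter and is read off from its expression
  as a sum of p dq near each point.\<close>

lemma forget_section:
  assumes s: "s \<in> PS"
  shows "(\<lambda>x. forget x (s x)) \<in> dirac_sections B BL"
proof -
  have i: "forget x (s x) \<in> BL x" for x by (rule forget_BL[OF PSD(1)[OF s]])
  have "(\<lambda>x. snd (forget x (s x))) \<in> forms B"
  proof (rule B.formsI)
    show "snd (forget x (s x)) \<in> cotangent B x" for x
      using i[of x] BL_gen[of x] by (auto simp: gen_tangent_def)
    fix Z assume Z: "Z \<in> vfields B"
    show "(\<lambda>x. snd (forget x (s x)) (Z x)) \<in> Cinf B"
    proof (rule B.CinfI)
      fix x
      obtain n h a where p: "presented_near B A f x (fst \<circ> s) n h a" using PSD(3)[OF s] by blast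
      obtain p q where r: "B.presents_form (\<lambda>z. snd (forget z (s z))) x ({..<n} \<times> {..<dim (model M)})
         (\<lambda>(i, k) z. h i z * p i k (f z)) (\<lambda>(i, k) z. q i k (f z))"
        by (rule presented_form_exists[OF PSD(1)[OF s] p])
      let ?p = "\<lambda>(i, k) z. h i z * p i k (f z)" and ?q = "\<lambda>(i, k) z. q i k (f z)"
      have ev: "eventually (\<lambda>z. snd (forget z (s z)) (Z z) =
          (\<Sum>j\<in>{..<n} \<times> {..<dim (model M)}. ?p j z * Z z (?q j))) (nhds x)"
        using B.presents_formD(3)[OF r] by eventually_elim (simp add: B.vfieldsD(1)[OF Z])
      have "B.smooth_at (\<lambda>z. \<Sum>j\<in>{..<n} \<times> {..<dim (model M)}. ?p j z * Z z (?q j)) x"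
        by (intro B.smooth_at_sum B.smooth_at_mult B.Cinf_smooth_at B.presents_formD(1)[OF r]
            B.vfieldsD(2)[OF Z] B.presents_formD(2)[OF r])
      then show "B.smooth_at (\<lambda>z. snd (forget z (s z)) (Z z)) x" unfolding B.smooth_at_cong[OF ev] .
    qed
  qed
  then show ?thesis using i PSD(2)[OF s] by (simp add: dirac_sections_def gen_sections_def comp_def)
qed

section \<open>Local frames of the pullback algebroid\<close>

abbreviation "dB \<equiv> dim (model B)"
abbreviation "dM \<equiv> dim (model M)"

text \<open>Near x the fibre \<open>PF z\<close> is the common kernel of \<open>dM\<close>
  functionals on the product of L (f z) and the tangent space of B, a bundle of rank
  \<open>rL + dB\<close>. The rank of the kernel is a difference of naturals, hence the separate
  inequality. All frame elements are combinations of one family \<open>a\<close> with coefficients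
  in \<open>Cinf B\<close>; this common presentation is what later makes lifted sections
  presentable.\<close>

lemma PF_frame:
  assumes rL: "\<And>y. \<exists>U a. y \<in> U \<and> local_frame L (dirac_sections M L) rL U a"
  shows "dM \<le> rL + dB" (is ?rank)
    and "\<exists>U e a. x \<in> U \<and> local_frame PF PS (rL + dB - dM) U e \<and> (\<forall>j<rL. a j \<in> dirac_sections M L) \<and>
      (\<forall>i<rL + dB - dM. \<exists>h. (\<forall>j<rL. h j \<in> Cinf B) \<and> (\<forall>z. fst (e i z) = (\<Sum>j<rL. h j z *\<^sub>R a j (f z))))"
      (is ?frame)
proof -
  obtain U a where a: "f x \<in> U" "local_frame L (dirac_sections M L) rL U a" using rL by blast
  note aD = local_frameD[OF a(2)]
  obtain UB yB EB where cB: "B.coordinates_on UB yB EB" "x \<in> UB" by (rule B.coordinates_exist)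
  obtain UM yM EM where cM: "M.coordinates_on UM yM EM" "f x \<in> UM" by (rule M.coordinates_exist)
  note cBD = B.coordinates_onD[OF cB(1)] and cMD = M.coordinates_onD[OF cM(1)]
  have cf: "continuous_on UNIV f" using f by (simp add: smooth_map_def)
  define F where "F z = L (f z) \<times> tangent B z" for z
  \<comment> \<open>Pairs whose first component is presented by the \<open>a j\<close> on all of B.
    What the elimination asks of \<Gamma> is closure under the module operations, and the
    coefficients can be followed through it.\<close>
  define \<Gamma> where "\<Gamma> = {s. (\<exists>h. (\<forall>j<rL. h j \<in> Cinf B) \<and> (\<forall>z. fst (s z) = (\<Sum>j<rL. h j z *\<^sub>R a j (f z)))) \<and> snd \<circ> s \<in> vfields B}"
  define e where "e i z = (if i < rL then (a i (f z), 0) else (0, EB (i - rL) z))" for i z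
  \<comment> \<open>The k-th coordinate of w minus the pushforward of v, as a functional on the
    whole ambient space.\<close>
  define l where "l k z u = fst (fst u) (yM k) - snd u (yM k \<circ> f)"
    for k :: nat and z :: 'b and u :: "('m tvec \<times> 'm cotvec) \<times> 'b tvec"
  have sum_e: "(\<Sum>i<rL + dB. c i *\<^sub>R e i z) = (\<Sum>i<rL. c i *\<^sub>R a i (f z), \<Sum>j<dB. c (rL + j) *\<^sub>R EB j z)" for c z
    by (simp add: sum_lessThan_add e_def prod_eq_iff fst_sum snd_sum)
  have frame: "local_frame F \<Gamma> (rL + dB) (f -` U \<inter> UB) e"
    unfolding local_frame_iff
  proof (intro conjI ballI allI impI)
    show "open (f -` U \<inter> UB)" using aD(1) cBD(1) cf by (intro open_Int open_vimage) auto
    fix i assume i: "i < rL + dB"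
    show "e i \<in> \<Gamma>"
    proof (cases "i < rL")
      case True
      have "(\<Sum>j<rL. (if j = i then 1 else 0) *\<^sub>R a j (f z)) = a i (f z)" for z
        using True by (simp add: if_distrib[of "\<lambda>c. c *\<^sub>R _"] cong: if_cong)
      then have "\<exists>h. (\<forall>j<rL. h j \<in> Cinf B) \<and> (\<forall>z. fst (e i z) = (\<Sum>j<rL. h j z *\<^sub>R a j (f z)))"
        using True by (intro exI[of _ "\<lambda>j z. if j = i then 1 else 0"]) (simp add: e_def)
      moreover have "snd \<circ> e i \<in> vfields B" using True B.vfields_zero by (simp add: e_def comp_def)
      ultimately show ?thesis by (simp add: \<Gamma>_def)
    next
      case False
      then have "\<exists>h. (\<forall>j<rL. h j \<in> Cinf B) \<and> (\<forall>z. fst (e i z) = (\<Sum>j<rL. h j z *\<^sub>R a j (f z)))"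
        by (intro exI[of _ "\<lambda>j z. 0"]) (simp add: e_def)
      moreover have "snd \<circ> e i = EB (i - rL)" using False by (simp add: e_def fun_eq_iff)
      moreover have "EB (i - rL) \<in> vfields B" using cBD(3) i False by simp
      ultimately show ?thesis by (simp add: \<Gamma>_def)
    qed
  next
    fix z c i assume z: "z \<in> f -` U \<inter> UB" and 0: "(\<Sum>i<rL + dB. c i *\<^sub>R e i z) = 0" and i: "i < rL + dB"
    have 1: "(\<Sum>i<rL. c i *\<^sub>R a i (f z)) = 0" and 2: "(\<Sum>j<dB. c (rL + j) *\<^sub>R EB j z) = 0"
      using 0 unfolding sum_e by (simp_all add: zero_prod_def)
    show "c i = 0"
    proof (cases "i < rL")
      case True
      then show ?thesis using aD(3)[OF _ 1] z by simp
    next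
      case False
      then have k: "i - rL < dB" using i by simp
      have "(\<Sum>j<dB. c (rL + j) *\<^sub>R EB j z) (yB (i - rL)) = (\<Sum>j<dB. if j = i - rL then c (rL + j) else 0)"
        unfolding fun_apply by (intro sum.cong refl) (use z k cBD(5) in auto)
      also have "\<dots> = c i" using k False by simp
      finally have "(\<Sum>j<dB. c (rL + j) *\<^sub>R EB j z) (yB (i - rL)) = c i" .
      then show ?thesis using 2 by (simp add: fun_apply)
    qed
  next
    fix z assume z: "z \<in> f -` U \<inter> UB"
    show "F z = range (\<lambda>c. \<Sum>i<rL + dB. c i *\<^sub>R e i z)"
    proof (intro equalityI subsetI)
      fix u assume "u \<in> F z"
      then have u: "fst u \<in> L (f z)" "snd u \<in> tangent B z" by (auto simp: F_def)
      then obtain c where c: "fst u = (\<Sum>i<rL. c i *\<^sub>R a i (f z))" using aD(4) z by auto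
      have "snd u = (\<Sum>j<dB. snd u (yB j) *\<^sub>R EB j z)"
        by (rule B.tangent_expand[OF cB(1)]) (use z u in auto)
      then have "u = (\<Sum>i<rL + dB. (if i < rL then c i else snd u (yB (i - rL))) *\<^sub>R e i z)"
        unfolding sum_e using c by (simp add: prod_eq_iff)
      then show "u \<in> range (\<lambda>c. \<Sum>i<rL + dB. c i *\<^sub>R e i z)"
        by (rule range_eqI[of _ _ "\<lambda>i. if i < rL then c i else snd u (yB (i - rL))"])
    next
      fix u assume "u \<in> range (\<lambda>c. \<Sum>i<rL + dB. c i *\<^sub>R e i z)"
      then obtain c where c: "u = (\<Sum>i<rL. c i *\<^sub>R a i (f z), \<Sum>j<dB. c (rL + j) *\<^sub>R EB j z)"
        unfolding sum_e by blast
      have "(\<Sum>j<dB. c (rL + j) *\<^sub>R EB j z) \<in> tangent B z"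
        by (intro subspace_sum[OF B.subspace_tangent] subspace_mul[OF B.subspace_tangent] B.vfieldsD(1) cBD(3)) simp
      moreover have "(\<Sum>i<rL. c i *\<^sub>R a i (f z)) \<in> L (f z)" using aD(4)[of "f z"] z by auto
      ultimately show "u \<in> F z" by (simp add: c F_def)
    qed
  qed
  have \<Gamma>_mod: "(\<lambda>z. s z + g z *\<^sub>R t z) \<in> \<Gamma>" if s: "s \<in> \<Gamma>" and t: "t \<in> \<Gamma>" and g: "g \<in> Cinf B" for s t g
  proof -
    obtain h where h: "\<And>j. j < rL \<Longrightarrow> h j \<in> Cinf B" "\<And>z. fst (s z) = (\<Sum>j<rL. h j z *\<^sub>R a j (f z))"
      using s unfolding \<Gamma>_def by blast
    obtain h' where h': "\<And>j. j < rL \<Longrightarrow> h' j \<in> Cinf B" "\<And>z. fst (t z) = (\<Sum>j<rL. h' j z *\<^sub>R a j (f z))"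
      using t unfolding \<Gamma>_def by blast
    have "(\<lambda>z. h j z + g z * h' j z) \<in> Cinf B" if "j < rL" for j
      by (intro B.Cinf_add B.Cinf_mult h(1) h'(1) that g)
    moreover have "fst (s z + g z *\<^sub>R t z) = (\<Sum>j<rL. (h j z + g z * h' j z) *\<^sub>R a j (f z))" for z
      by (simp add: h(2) h'(2) scaleR_sum_right sum.distrib scaleR_add_left)
    moreover have "snd \<circ> (\<lambda>z. s z + g z *\<^sub>R t z) \<in> vfields B"
    proof -
      have "snd \<circ> s \<in> vfields B" "snd \<circ> t \<in> vfields B" using s t by (simp_all add: \<Gamma>_def)
      then have "(\<lambda>z. (snd \<circ> s) z + g z *\<^sub>R (snd \<circ> t) z) \<in> vfields B"
        by (intro B.vfields_add B.vfields_scale g)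
      then show ?thesis by (simp add: comp_def)
    qed
    ultimately show ?thesis unfolding \<Gamma>_def by (intro CollectI conjI exI[of _ "\<lambda>j z. h j z + g z * h' j z"]) auto
  qed
  have lin: "linear (l k z)" for k z
    by (rule linearI) (simp_all add: l_def fun_apply algebra_simps)
  have sm: "(\<lambda>z. l k z (s z)) \<in> Cinf B" if k: "k < dM" and s: "s \<in> \<Gamma>" for k s
  proof -
    obtain h where h: "\<And>j. j < rL \<Longrightarrow> h j \<in> Cinf B" "\<And>z. fst (s z) = (\<Sum>j<rL. h j z *\<^sub>R a j (f z))"
      and v: "snd \<circ> s \<in> vfields B" using s unfolding \<Gamma>_def by blast
    have eq: "(\<lambda>z. l k z (s z)) = (\<lambda>z. (\<Sum>j<rL. h j z * (fst \<circ> a j) (f z) (yM k)) - (snd \<circ> s) z (yM k \<circ> f))"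
      by (simp add: fun_eq_iff l_def h(2) fst_sum fun_apply)
    have "(\<lambda>z. (fst \<circ> a j) (f z) (yM k)) \<in> Cinf B" if "j < rL" for j
      using f_Cinf'[OF M.vfieldsD(2)[OF M.gen_sectionsD(1)[OF sections_L(2)[OF aD(2)[OF that]]] cMD(2)[OF k]]] .
    then show ?thesis unfolding eq
      by (intro B.Cinf_diff B.Cinf_sum ballI B.Cinf_mult h(1) B.vfieldsD(2)[OF v f_Cinf[OF cMD(2)[OF k]]]) auto
  qed
  \<comment> \<open>Transversality enters here: the coordinate vector \<open>EM k\<close> at f x
    splits as \<open>fst b + pf w\<close>, and the element (b, - w) has value 1 under
    \<open>l k\<close> and 0 under the earlier functionals.\<close>
  have onto: "\<exists>u\<in>F x. l k x u \<noteq> 0 \<and> (\<forall>j<k. l j x u = 0)" if k: "k < dM" for k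
  proof -
    have "EM k (f x) \<in> tangent M (f x)" by (rule M.vfieldsD(1)[OF cMD(3)[OF k]])
    then obtain b w where bw: "EM k (f x) = fst b + pf w" "b \<in> L (f x)" "w \<in> tangent B x"
      using transverse unfolding transverse_def by blast
    have "l j x (b, - w) = (if j = k then 1 else 0)" if "j \<le> k" for j
    proof -
      have j: "j < dM" using that k by simp
      have "l j x (b, - w) = EM k (f x) (yM j)"
        unfolding bw(1) by (simp add: l_def fun_apply pf_apply[OF cMD(2)[OF j]])
      then show ?thesis using cMD(5)[OF cM(2) k j] by auto
    qed
    moreover have "(b, - w) \<in> F x" using bw subspace_neg[OF B.subspace_tangent] by (simp add: F_def)
    ultimately show ?thesis by (intro bexI[of _ "(b, - w)"]) auto
  qed
  have xU: "x \<in> f -` U \<inter> UB" using a cB by simp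
  \<comment> \<open>Stated for any number m of functionals up to \<open>dM\<close>, since the rank
    inequality applies it with m = rL + dB.\<close>
  have kernel: "\<exists>U' e'. x \<in> U' \<and> local_frame (\<lambda>z. {u \<in> F z. \<forall>k<m. l k z u = 0}) \<Gamma> r U' e'"
    if m: "m \<le> dM" and r: "r + m = rL + dB" for r m
  proof (rule B.kernel_frame[where e = e and U = "f -` U \<inter> UB"])
    show "local_frame F \<Gamma> (r + m) (f -` U \<inter> UB) e" unfolding r by (rule frame)
    show "x \<in> f -` U \<inter> UB" by (rule xU)
    show "(\<lambda>z. s z + g z *\<^sub>R t z) \<in> \<Gamma>" if "s \<in> \<Gamma>" "t \<in> \<Gamma>" "g \<in> Cinf B" for s t g
      by (rule \<Gamma>_mod[OF that])
    show "linear (l k z)" for k z by (rule lin)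
    show "(\<lambda>z. l k z (s z)) \<in> Cinf B" if "k < m" "s \<in> \<Gamma>" for k s
      by (rule sm[OF less_le_trans[OF that(1) m] that(2)])
    show "\<exists>u\<in>F x. l k x u \<noteq> 0 \<and> (\<forall>j<k. l j x u = 0)" if "k < m" for k
      by (rule onto[OF less_le_trans[OF that m]])
  qed
  show rank: ?rank
  proof (rule ccontr)
    \<comment> \<open>After rL + dB functionals the kernel would already be 0 at x, leaving nothing
      on which the next functional could be nonzero.\<close>
    assume n: "\<not> ?rank"
    have "\<exists>U' e'. x \<in> U' \<and> local_frame (\<lambda>z. {u \<in> F z. \<forall>k<rL + dB. l k z u = 0}) \<Gamma> 0 U' e'"
      by (rule kernel) (use n in auto)
    then obtain U' e' where e': "x \<in> U'" "local_frame (\<lambda>z. {u \<in> F z. \<forall>k<rL + dB. l k z u = 0}) \<Gamma> 0 U' e'" by blast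
    have 0: "{u \<in> F x. \<forall>k<rL + dB. l k x u = 0} = {0}" using local_frameD(4)[OF e'(2,1)] by simp
    obtain u where "u \<in> F x" "l (rL + dB) x u \<noteq> 0" "\<forall>j<rL + dB. l j x u = 0" using onto[of "rL + dB"] n by auto
    then have "u = 0" using 0 by blast
    then show False using \<open>l (rL + dB) x u \<noteq> 0\<close> linear_0[OF lin] by simp
  qed
  let ?r = "rL + dB - dM"
  have "\<exists>U' e'. x \<in> U' \<and> local_frame (\<lambda>z. {u \<in> F z. \<forall>k<dM. l k z u = 0}) \<Gamma> ?r U' e'"
    by (rule kernel) (use rank in simp_all)
  then obtain U' e' where e': "x \<in> U'" "local_frame (\<lambda>z. {u \<in> F z. \<forall>k<dM. l k z u = 0}) \<Gamma> ?r U' e'" by blast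
  note e'D = local_frameD[OF e'(2)]
  \<comment> \<open>The functions \<open>yM k\<close> determine tangent vectors over
    \<open>UM\<close>, so f z has to lie there.\<close>
  have ker: "{u \<in> F z. \<forall>k<dM. l k z u = 0} = PF z" if z: "f z \<in> UM" for z
  proof (intro equalityI subsetI)
    fix u assume "u \<in> PF z"
    then show "u \<in> {u \<in> F z. \<forall>k<dM. l k z u = 0}"
      using cMD(2) by (auto simp: PF_iff F_def l_def pf_apply mem_Times_iff)
  next
    fix u assume u: "u \<in> {u \<in> F z. \<forall>k<dM. l k z u = 0}"
    then have F: "fst u \<in> L (f z)" "snd u \<in> tangent B z" by (auto simp: F_def)
    have "fst (fst u) = pf (snd u)"
    proof (rule M.tangent_eqI[OF L_gen(1)[OF F(1)] pf_tangent[OF F(2)]])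
      fix g assume g: "g \<in> Cinf M"
      have "fst (fst u) (yM k) = pf (snd u) (yM k)" if "k < dM" for k
        using u that cMD(2)[OF that] by (simp add: l_def pf_apply)
      then show "fst (fst u) g = pf (snd u) g"
        unfolding cMD(4)[OF z L_gen(1)[OF F(1)] g] cMD(4)[OF z pf_tangent[OF F(2)] g] by simp
    qed
    then show "u \<in> PF z" using F by (simp add: PF_iff)
  qed
  define N where "N = U' \<inter> f -` UM"
  have N: "open N" "x \<in> N" unfolding N_def using e'(1) cM(2) e'D(1) cMD(1) cf
    by (auto intro: open_Int open_vimage)
  obtain \<theta> where \<theta>: "\<theta> \<in> Cinf B" "eventually (\<lambda>y. \<theta> y = 1) (nhds x)"
    "\<And>y. y \<notin> N \<Longrightarrow> eventually (\<lambda>z. \<theta> z = 0) (nhds y)" by (rule B.bump_exists[OF N]) blast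
  obtain W where W: "open W" "x \<in> W" "\<And>y. y \<in> W \<Longrightarrow> \<theta> y = 1" using \<theta>(2) unfolding eventually_nhds by blast
  have \<theta>0: "\<theta> z = 0" if "z \<notin> N" for z using eventually_nhds_x_imp_x[OF \<theta>(3)[OF that]] .
  have WN: "W \<subseteq> N" using W(3) \<theta>0 by force
  \<comment> \<open>Elements of \<open>PS\<close> must lie in the fibres over all of B, while e' is
    known to do so only over N. The cut-off leaves the frame unchanged on W, where \<theta> is
    1.\<close>
  define e'' where "e'' i z = \<theta> z *\<^sub>R e' i z" for i z
  have e'PF: "e' i z \<in> PF z" if "i < ?r" "z \<in> N" for i z
  proof -
    have "e' i z \<in> {u \<in> F z. \<forall>k<dM. l k z u = 0}"
      using local_frame_member[OF e'(2) that(1)] that(2) by (simp add: N_def)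
    moreover have "f z \<in> UM" using that(2) by (simp add: N_def)
    ultimately show ?thesis by (simp only: ker)
  qed
  have h: "\<exists>h. (\<forall>j<rL. h j \<in> Cinf B) \<and> (\<forall>z. fst (e'' i z) = (\<Sum>j<rL. h j z *\<^sub>R a j (f z)))" if i: "i < ?r" for i
  proof -
    obtain h where "\<And>j. j < rL \<Longrightarrow> h j \<in> Cinf B" "\<And>z. fst (e' i z) = (\<Sum>j<rL. h j z *\<^sub>R a j (f z))"
      using e'D(2)[OF i] unfolding \<Gamma>_def by blast
    then show ?thesis
      by (intro exI[of _ "\<lambda>j z. \<theta> z * h j z"]) (auto simp: e''_def scaleR_sum_right intro!: B.Cinf_mult \<theta>(1))
  qed
  have PS: "e'' i \<in> PS" if i: "i < ?r" for i
    unfolding pullback_sections_def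
  proof (intro CollectI conjI allI)
    show "e'' i z \<in> PF z" for z
    proof (cases "z \<in> N")
      case True
      then show ?thesis unfolding e''_def by (intro subspace_mul[OF subspace_PF] e'PF i)
    next
      case False
      then show ?thesis using \<theta>0 subspace_0[OF subspace_PF] by (simp add: e''_def)
    qed
    obtain h where h: "\<And>j. j < rL \<Longrightarrow> h j \<in> Cinf B" "\<And>z. fst (e'' i z) = (\<Sum>j<rL. h j z *\<^sub>R a j (f z))"
      using h[OF i] by blast
    show "\<exists>n h a. presented_near B A f z (fst \<circ> e'' i) n h a" for z
    proof (intro exI)
      show "presented_near B A f z (fst \<circ> e'' i) rL h a"
        unfolding presented_near_def using h aD(2) by (auto simp: dirac_algebroid_def intro!: exI[of _ UNIV])
    qed
    have "snd \<circ> e' i \<in> vfields B" using e'D(2)[OF i] by (simp add: \<Gamma>_def)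
    then have "(\<lambda>z. \<theta> z *\<^sub>R (snd \<circ> e' i) z) \<in> vfields B" by (rule B.vfields_scale[OF \<theta>(1)])
    then show "snd \<circ> e'' i \<in> vfields B" by (simp add: e''_def comp_def)
  qed
  have "local_frame PF PS ?r W e''"
    unfolding local_frame_iff
  proof (intro conjI ballI)
    show "open W" by (rule W)
    show "\<forall>i<?r. e'' i \<in> PS" using PS by blast
    fix z assume z: "z \<in> W"
    then have zN: "z \<in> U'" "f z \<in> UM" using WN by (auto simp: N_def)
    show "\<forall>c. (\<Sum>i<?r. c i *\<^sub>R e'' i z) = 0 \<longrightarrow> (\<forall>i<?r. c i = 0)"
      using e'D(3)[OF zN(1)] by (simp add: e''_def W(3)[OF z])
    show "PF z = range (\<lambda>c. \<Sum>i<?r. c i *\<^sub>R e'' i z)"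
      using e'D(4)[OF zN(1)] ker[OF zN(2)] by (simp add: e''_def W(3)[OF z])
  qed
  then show ?frame using W(2) aD(2) h by blast
qed

section \<open>The bracket computed from one pair of presentations\<close>

definition local_bracket where
  "local_bracket s s' x n h a n' h' a' =
     ((\<Sum>i<n. \<Sum>j<n'. (h i x * h' j x) *\<^sub>R courant M (a i) (a' j) (f x))
        + (\<Sum>j<n'. snd (s x) (h' j) *\<^sub>R a' j (f x))
        - (\<Sum>i<n. snd (s' x) (h i) *\<^sub>R a i (f x)),
      vf_bracket (snd \<circ> s) (snd \<circ> s') x)"

text \<open>Membership in the fibre says that the vector field of s acts on g o f as the anchor of
  the L-part acts on g. So derivatives of functions pulled back from M are expressed by the h_i and
  a_i, and differentiating once more along v gives the first formula.\<close>

lemma anchor_derivative: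
  assumes s: "s \<in> PS" and p: "presented_near B A f x (fst \<circ> s) n h a"
    and v: "v \<in> tangent B x" and g: "g \<in> Cinf M"
  shows "v (\<lambda>z. snd (s z) (g \<circ> f)) = (\<Sum>i<n. h i x * pf v (\<lambda>y. fst (a i y) g) + v (h i) * fst (a i (f x)) g)"
    and "snd (s x) (g \<circ> f) = (\<Sum>i<n. h i x * fst (a i (f x)) g)"
proof -
  note pD = presented_nearD[OF p]
  have aC: "(\<lambda>y. fst (a i y) g) \<in> Cinf M" if "i < n" for i
    using M.vfieldsD(2)[OF M.gen_sectionsD(1)[OF sections_L(2)[OF pD(2)[OF that]]] g] by (simp add: comp_def)
  note aB = f_Cinf'[OF aC]
  have ev: "eventually (\<lambda>z. snd (s z) (g \<circ> f) = (\<Sum>i<n. h i z * fst (a i (f z)) g)) (nhds x)"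
    using pD(3)
  proof eventually_elim
    case (elim z)
    have "snd (s z) (g \<circ> f) = fst (fst (s z)) g" using PSD(1)[OF s, of z] g by (simp add: PF_iff pf_apply)
    also have "\<dots> = (\<Sum>i<n. h i z * fst (a i (f z)) g)" using elim by (simp add: fst_sum fun_apply)
    finally show ?case .
  qed
  have c: "(\<lambda>z. h i z * fst (a i (f z)) g) \<in> Cinf B" if "i < n" for i
    by (rule B.Cinf_mult[OF pD(1)[OF that] aB[OF that]])
  have "(\<lambda>z. snd (s z) (g \<circ> f)) \<in> Cinf B"
    using B.vfieldsD(2)[OF PSD(2)[OF s] f_Cinf[OF g]] by (simp add: comp_def)
  then have "v (\<lambda>z. snd (s z) (g \<circ> f)) = v (\<lambda>z. \<Sum>i<n. h i z * fst (a i (f z)) g)"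
    by (rule B.tangent_local[OF v _ _ ev]) (intro B.Cinf_sum ballI c, simp)
  also have "\<dots> = (\<Sum>i<n. v (\<lambda>z. h i z * fst (a i (f z)) g))"
    by (rule B.tangent_sum[OF v c]) simp
  also have "\<dots> = (\<Sum>i<n. h i x * pf v (\<lambda>y. fst (a i y) g) + v (h i) * fst (a i (f x)) g)"
  proof (intro sum.cong refl)
    fix i assume "i \<in> {..<n}"
    then have i: "i < n" by simp
    show "v (\<lambda>z. h i z * fst (a i (f z)) g) = h i x * pf v (\<lambda>y. fst (a i y) g) + v (h i) * fst (a i (f x)) g"
      using B.tangent_mult[OF v pD(1)[OF i] aB[OF i]] by (simp add: pf_apply[OF aC[OF i]] comp_def)
  qed
  finally show "v (\<lambda>z. snd (s z) (g \<circ> f)) = (\<Sum>i<n. h i x * pf v (\<lambda>y. fst (a i y) g) + v (h i) * fst (a i (f x)) g)" .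
  show "snd (s x) (g \<circ> f) = (\<Sum>i<n. h i x * fst (a i (f x)) g)"
    using eventually_nhds_x_imp_x[OF ev] .
qed

text \<open>The L-part stays in L (f x) by involutivity. For the anchor condition both sides are
  tested on g: [X, X'](g o f) is expanded by \<open>anchor_derivative\<close>, and the terms without
  derivatives of the coefficients combine to the brackets of the anchors of a_i and a'_j.\<close>

lemma local_bracket_PF:
  assumes s: "s \<in> PS" and s': "s' \<in> PS"
    and p: "presented_near B A f x (fst \<circ> s) n h a" and p': "presented_near B A f x (fst \<circ> s') n' h' a'"
  shows "local_bracket s s' x n h a n' h' a' \<in> PF x"
  unfolding PF_iff
proof (intro conjI)
  note pD = presented_nearD[OF p] and pD' = presented_nearD[OF p']
  have br: "vf_bracket (snd \<circ> s) (snd \<circ> s') \<in> vfields B"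
    by (rule B.vf_bracket_vfields[OF PSD(2)[OF s] PSD(2)[OF s']])
  show "snd (local_bracket s s' x n h a n' h' a') \<in> tangent B x"
    using B.vfieldsD(1)[OF br] by (simp add: local_bracket_def)
  show Lx: "fst (local_bracket s s' x n h a n' h' a') \<in> L (f x)"
    unfolding local_bracket_def fst_conv
    by (intro subspace_diff[OF L_subspace] subspace_add[OF L_subspace] subspace_sum[OF L_subspace]
        subspace_mul[OF L_subspace] sections_L(1) L_courant pD(2) pD'(2)) simp_all
  have tx: "snd (s x) \<in> tangent B x" and tx': "snd (s' x) \<in> tangent B x"
    using PSD(1)[OF s, of x] PSD(1)[OF s', of x] by (simp_all add: PF_iff)
  have pfx: "pf (snd (s x)) g = (\<Sum>i<n. h i x * fst (a i (f x)) g)"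
    "pf (snd (s' x)) g = (\<Sum>j<n'. h' j x * fst (a' j (f x)) g)" if "g \<in> Cinf M" for g
    using anchor_derivative(2)[OF s p tx that] anchor_derivative(2)[OF s' p' tx that] that by (simp_all add: pf_apply)
  show "fst (fst (local_bracket s s' x n h a n' h' a')) = pf (snd (local_bracket s s' x n h a n' h' a'))"
  proof (rule M.tangent_eqI[OF L_gen(1)[OF Lx]])
    show "pf (snd (local_bracket s s' x n h a n' h' a')) \<in> tangent M (f x)"
      unfolding local_bracket_def snd_conv by (rule pf_tangent[OF B.vfieldsD(1)[OF br]])
    fix g assume g: "g \<in> Cinf M"
    have aC: "(\<lambda>y. fst (a i y) g) \<in> Cinf M" if "i < n" for i
      using M.vfieldsD(2)[OF M.gen_sectionsD(1)[OF sections_L(2)[OF pD(2)[OF that]]] g] by (simp add: comp_def)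
    have aC': "(\<lambda>y. fst (a' j y) g) \<in> Cinf M" if "j < n'" for j
      using M.vfieldsD(2)[OF M.gen_sectionsD(1)[OF sections_L(2)[OF pD'(2)[OF that]]] g] by (simp add: comp_def)
    have "pf (snd (local_bracket s s' x n h a n' h' a')) g =
        snd (s x) (\<lambda>z. snd (s' z) (g \<circ> f)) - snd (s' x) (\<lambda>z. snd (s z) (g \<circ> f))"
      unfolding local_bracket_def snd_conv pf_apply[OF g] by (simp add: vf_bracket_def)
    also have "\<dots> = (\<Sum>j<n'. h' j x * (\<Sum>i<n. h i x * fst (a i (f x)) (\<lambda>y. fst (a' j y) g)) + snd (s x) (h' j) * fst (a' j (f x)) g)
       - (\<Sum>i<n. h i x * (\<Sum>j<n'. h' j x * fst (a' j (f x)) (\<lambda>y. fst (a i y) g)) + snd (s' x) (h i) * fst (a i (f x)) g)"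
      unfolding anchor_derivative(1)[OF s' p' tx g] anchor_derivative(1)[OF s p tx' g]
      by (simp add: pfx aC aC')
    also have "\<dots> = (\<Sum>i<n. \<Sum>j<n'. h i x * h' j x * (fst (a i (f x)) (\<lambda>y. fst (a' j y) g) - fst (a' j (f x)) (\<lambda>y. fst (a i y) g)))
       + (\<Sum>j<n'. snd (s x) (h' j) * fst (a' j (f x)) g) - (\<Sum>i<n. snd (s' x) (h i) * fst (a i (f x)) g)"
      unfolding sum.distrib right_diff_distrib sum_subtractf sum_distrib_left
      by (subst sum.swap) (simp add: mult_ac)
    also have "\<dots> = fst (fst (local_bracket s s' x n h a n' h' a')) g"
      by (simp add: local_bracket_def fst_sum fun_apply M.courant_eq vf_bracket_def)
    finally show "fst (fst (local_bracket s s' x n h a n' h' a')) g = pf (snd (local_bracket s s' x n h a n' h' a')) g" by simp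
  qed
qed

text \<open>Both sides are compared after writing the forms as \<open>\<Sum> p dq\<close>. The terms in which the
  \<open>h\<^sub>i\<close> are differentiated along the test vector add up to \<open>\<Sum> h'\<^sub>j \<langle>a\<^sub>i, a'\<^sub>j\<rangle> dh\<^sub>i\<close>, which
  vanishes because \<open>L\<close> is isotropic.\<close>

lemma forget_local_bracket:
  assumes s: "s \<in> PS" and s': "s' \<in> PS"
    and p: "presented_near B A f x (fst \<circ> s) n h a" and p': "presented_near B A f x (fst \<circ> s') n' h' a'"
  shows "forget x (local_bracket s s' x n h a n' h' a') =
    courant B (\<lambda>z. forget z (s z)) (\<lambda>z. forget z (s' z)) x"
proof -
  note pD = presented_nearD[OF p] and pD' = presented_nearD[OF p']
  let ?t = "\<lambda>z. forget z (s z)" and ?t' = "\<lambda>z. forget z (s' z)"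
  let ?w = "local_bracket s s' x n h a n' h' a'"
  let ?X = "snd (s x)" and ?X' = "snd (s' x)"
  have gen: "?t \<in> gen_sections B" "?t' \<in> gen_sections B"
    using forget_section[OF s] forget_section[OF s'] by (simp_all add: dirac_sections_def)
  have fst_t: "fst \<circ> ?t = snd \<circ> s" "fst \<circ> ?t' = snd \<circ> s'" by (simp_all add: fun_eq_iff)
  have wPF: "?w \<in> PF x" by (rule local_bracket_PF[OF s s' p p'])
  have tx: "?X \<in> tangent B x" and tx': "?X' \<in> tangent B x"
    using PSD(1)[OF s, of x] PSD(1)[OF s', of x] by (simp_all add: PF_iff)
  obtain P Q where r: "\<And>i. i < n \<Longrightarrow> M.presents_form (snd \<circ> a i) (f x) {..<dM} (P i) (Q i)"
    and R: "B.presents_form (\<lambda>z. snd (forget z (s z))) x ({..<n} \<times> {..<dM})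
       (\<lambda>(i, k) z. h i z * P i k (f z)) (\<lambda>(i, k) z. Q i k (f z))"
    by (rule presented_form_exists[OF PSD(1)[OF s] p]) blast
  obtain P' Q' where r': "\<And>j. j < n' \<Longrightarrow> M.presents_form (snd \<circ> a' j) (f x) {..<dM} (P' j) (Q' j)"
    and R': "B.presents_form (\<lambda>z. snd (forget z (s' z))) x ({..<n'} \<times> {..<dM})
       (\<lambda>(j, k) z. h' j z * P' j k (f z)) (\<lambda>(j, k) z. Q' j k (f z))"
    by (rule presented_form_exists[OF PSD(1)[OF s'] p']) blast
  note rP = M.presents_formD(1)[OF r] and rQ = M.presents_formD(2)[OF r]
    and rP' = M.presents_formD(1)[OF r'] and rQ' = M.presents_formD(2)[OF r']
  have "pb x (snd (fst ?w)) = snd (courant B ?t ?t' x)"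
  proof
    fix v
    show "pb x (snd (fst ?w)) v = snd (courant B ?t ?t' x) v"
    proof (cases "v \<in> tangent B x")
      case False
      have "pb x (snd (fst ?w)) \<in> cotangent B x" using wPF by (intro pb_cotangent L_gen(2)) (simp add: PF_iff)
      moreover have "snd (courant B ?t ?t' x) \<in> cotangent B x"
        unfolding B.courant_eq snd_conv by (intro B.dorfman_cotangent B.gen_sectionsD gen)
      ultimately show ?thesis using False by (simp add: B.cotangent_outside)
    next
      case v: True
      let ?V = "pf v"
      have V: "?V \<in> tangent M (f x)" by (rule pf_tangent[OF v])
      let ?Y = "\<lambda>i. fst (a i (f x))" and ?Y' = "\<lambda>j. fst (a' j (f x))"
      have gY: "a i \<in> gen_sections M" if "i < n" for i by (rule sections_L(2)[OF pD(2)[OF that]])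
      have gY': "a' j \<in> gen_sections M" if "j < n'" for j by (rule sections_L(2)[OF pD'(2)[OF that]])
      have vf: "v (\<lambda>z. g (f z)) = ?V g" if "g \<in> Cinf M" for g using that by (simp add: pf_apply comp_def)
      have Xf: "?X (\<lambda>z. g (f z)) = (\<Sum>i<n. h i x * ?Y i g)" "?X' (\<lambda>z. g (f z)) = (\<Sum>j<n'. h' j x * ?Y' j g)"
        if "g \<in> Cinf M" for g
        using anchor_derivative(2)[OF s p tx that] anchor_derivative(2)[OF s' p' tx that] by (simp_all add: comp_def)
      have vXf: "v (\<lambda>z. snd (s z) (\<lambda>z. g (f z))) = (\<Sum>i<n. h i x * ?V (\<lambda>y. fst (a i y) g) + v (h i) * ?Y i g)"
        if "g \<in> Cinf M" for g
        using anchor_derivative(1)[OF s p v that] by (simp add: comp_def)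
      \<comment> \<open>Values at \<open>?V\<close> of the two halves of the covector part of the
        Courant bracket of a_i and a'_j: \<open>Aij\<close> is the Lie derivative of the form of
        a'_j along the anchor of a_i, and \<open>Cij\<close> contracts the differential of the form
        of a_i with the anchor of a'_j.\<close>
      define Aij where "Aij i j = (\<Sum>k<dM. ?Y i (P' j k) * ?V (Q' j k) + P' j k (f x) * ?V (\<lambda>y. fst (a i y) (Q' j k)))" for i j
      define Cij where "Cij i j = (\<Sum>k<dM. ?Y' j (P i k) * ?V (Q i k) - ?V (P i k) * ?Y' j (Q i k))" for i j
      have D: "snd (courant M (a i) (a' j) (f x)) ?V = Aij i j - Cij i j" if i: "i < n" and j: "j < n'" for i j
        unfolding M.courant_eq snd_conv Aij_def Cij_def
        using M.dorfman_presented[OF M.gen_sectionsD[OF gY[OF i]] M.gen_sectionsD[OF gY'[OF j]] V r[OF i] r'[OF j]]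
        by (simp add: comp_def)
      have \<eta>: "snd (a i (f x)) u = (\<Sum>k<dM. P i k (f x) * u (Q i k))" if "i < n" "u \<in> tangent M (f x)" for i u
        using M.presents_formD(4)[OF r[OF that(1)] that(2)] by simp
      have \<eta>': "snd (a' j (f x)) u = (\<Sum>k<dM. P' j k (f x) * u (Q' j k))" if "j < n'" "u \<in> tangent M (f x)" for j u
        using M.presents_formD(4)[OF r'[OF that(1)] that(2)] by simp
      have Yt: "i < n \<Longrightarrow> ?Y i \<in> tangent M (f x)" and Yt': "j < n' \<Longrightarrow> ?Y' j \<in> tangent M (f x)" for i j
        using L_gen(1)[OF sections_L(1)[OF pD(2)]] L_gen(1)[OF sections_L(1)[OF pD'(2)]] by blast+
      \<comment> \<open>The share of a'_j in the Lie derivative on B. The terms with v (h i) arise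
        because the function X(Q' o f), which equals the sum of the h_i Y_i(Q') along f, is
        differentiated along v.\<close>
      have T1: "(\<Sum>k<dM. ?X (\<lambda>z. h' j z * P' j k (f z)) * v (\<lambda>z. Q' j k (f z)) +
            h' j x * P' j k (f x) * v (\<lambda>z. snd (s z) (\<lambda>z. Q' j k (f z)))) =
          ?X (h' j) * snd (a' j (f x)) ?V + (\<Sum>i<n. h i x * h' j x * Aij i j + v (h i) * h' j x * snd (a' j (f x)) (?Y i))"
        if j: "j < n'" for j
      proof -
        have "?X (\<lambda>z. h' j z * P' j k (f z)) * v (\<lambda>z. Q' j k (f z)) +
            h' j x * P' j k (f x) * v (\<lambda>z. snd (s z) (\<lambda>z. Q' j k (f z))) =
           ?X (h' j) * (P' j k (f x) * ?V (Q' j k)) +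
           (\<Sum>i<n. h i x * h' j x * (?Y i (P' j k) * ?V (Q' j k) + P' j k (f x) * ?V (\<lambda>y. fst (a i y) (Q' j k)))
              + v (h i) * h' j x * (P' j k (f x) * ?Y i (Q' j k)))" if k: "k < dM" for k
        proof -
          have PC: "P' j k \<in> Cinf M" "Q' j k \<in> Cinf M" using rP'[OF j] rQ'[OF j] k by simp_all
          have "?X (\<lambda>z. h' j z * P' j k (f z)) = h' j x * (\<Sum>i<n. h i x * ?Y i (P' j k)) + P' j k (f x) * ?X (h' j)"
            using B.tangent_mult[OF tx pD'(1)[OF j] f_Cinf'[OF PC(1)]] Xf(1)[OF PC(1)] by simp
          then show ?thesis
            unfolding vXf[OF PC(2)] vf[OF PC(2)]
            by (simp add: sum.distrib sum_distrib_left sum_distrib_right algebra_simps)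
        qed
        then have "(\<Sum>k<dM. ?X (\<lambda>z. h' j z * P' j k (f z)) * v (\<lambda>z. Q' j k (f z)) +
            h' j x * P' j k (f x) * v (\<lambda>z. snd (s z) (\<lambda>z. Q' j k (f z)))) =
          (\<Sum>k<dM. ?X (h' j) * (P' j k (f x) * ?V (Q' j k)) +
           (\<Sum>i<n. h i x * h' j x * (?Y i (P' j k) * ?V (Q' j k) + P' j k (f x) * ?V (\<lambda>y. fst (a i y) (Q' j k)))
              + v (h i) * h' j x * (P' j k (f x) * ?Y i (Q' j k))))"
          by (intro sum.cong refl) simp
        also have "\<dots> = ?X (h' j) * (\<Sum>k<dM. P' j k (f x) * ?V (Q' j k)) +
           (\<Sum>i<n. h i x * h' j x * Aij i j + v (h i) * h' j x * (\<Sum>k<dM. P' j k (f x) * ?Y i (Q' j k)))"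
          unfolding Aij_def by (rule sum_add_bilinear)
        also have "\<dots> = ?X (h' j) * snd (a' j (f x)) ?V + (\<Sum>i<n. h i x * h' j x * Aij i j + v (h i) * h' j x * snd (a' j (f x)) (?Y i))"
          unfolding \<eta>'[OF j V] by (intro arg_cong2[where f = "(+)"] sum.cong refl) (simp add: \<eta>'[OF j Yt])
        finally show ?thesis .
      qed
      \<comment> \<open>The share of a_i in the contraction with the exterior derivative. Here v (h
        i) comes from the differential of the coefficient itself and brings the other half of the
        pairing.\<close>
      have T2: "(\<Sum>k<dM. ?X' (\<lambda>z. h i z * P i k (f z)) * v (\<lambda>z. Q i k (f z)) -
            v (\<lambda>z. h i z * P i k (f z)) * ?X' (\<lambda>z. Q i k (f z))) =
          ?X' (h i) * snd (a i (f x)) ?V + (\<Sum>j<n'. h i x * h' j x * Cij i j - v (h i) * h' j x * snd (a i (f x)) (?Y' j))"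
        if i: "i < n" for i
      proof -
        have "?X' (\<lambda>z. h i z * P i k (f z)) * v (\<lambda>z. Q i k (f z)) -
            v (\<lambda>z. h i z * P i k (f z)) * ?X' (\<lambda>z. Q i k (f z)) =
           ?X' (h i) * (P i k (f x) * ?V (Q i k)) +
           (\<Sum>j<n'. h i x * h' j x * (?Y' j (P i k) * ?V (Q i k) - ?V (P i k) * ?Y' j (Q i k))
              - v (h i) * h' j x * (P i k (f x) * ?Y' j (Q i k)))" if k: "k < dM" for k
        proof -
          have PC: "P i k \<in> Cinf M" "Q i k \<in> Cinf M" using rP[OF i] rQ[OF i] k by simp_all
          have "?X' (\<lambda>z. h i z * P i k (f z)) = h i x * (\<Sum>j<n'. h' j x * ?Y' j (P i k)) + P i k (f x) * ?X' (h i)"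
            using B.tangent_mult[OF tx' pD(1)[OF i] f_Cinf'[OF PC(1)]] Xf(2)[OF PC(1)] by simp
          moreover have "v (\<lambda>z. h i z * P i k (f z)) = h i x * ?V (P i k) + P i k (f x) * v (h i)"
            using B.tangent_mult[OF v pD(1)[OF i] f_Cinf'[OF PC(1)]] vf[OF PC(1)] by simp
          ultimately show ?thesis
            unfolding Xf(2)[OF PC(2)] vf[OF PC(2)]
            by (simp add: sum_subtractf sum.distrib sum_distrib_left sum_distrib_right algebra_simps)
        qed
        then have "(\<Sum>k<dM. ?X' (\<lambda>z. h i z * P i k (f z)) * v (\<lambda>z. Q i k (f z)) -
            v (\<lambda>z. h i z * P i k (f z)) * ?X' (\<lambda>z. Q i k (f z))) =
          (\<Sum>k<dM. ?X' (h i) * (P i k (f x) * ?V (Q i k)) +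
           (\<Sum>j<n'. h i x * h' j x * (?Y' j (P i k) * ?V (Q i k) - ?V (P i k) * ?Y' j (Q i k))
              - v (h i) * h' j x * (P i k (f x) * ?Y' j (Q i k))))"
          by (intro sum.cong refl) simp
        also have "\<dots> = ?X' (h i) * (\<Sum>k<dM. P i k (f x) * ?V (Q i k)) +
           (\<Sum>j<n'. h i x * h' j x * Cij i j - v (h i) * h' j x * (\<Sum>k<dM. P i k (f x) * ?Y' j (Q i k)))"
          unfolding Cij_def by (rule sum_diff_bilinear)
        also have "\<dots> = ?X' (h i) * snd (a i (f x)) ?V + (\<Sum>j<n'. h i x * h' j x * Cij i j - v (h i) * h' j x * snd (a i (f x)) (?Y' j))"
          unfolding \<eta>[OF i V] by (intro arg_cong2[where f = "(+)"] sum.cong refl) (simp add: \<eta>[OF i Yt'])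
        finally show ?thesis .
      qed
      have Rt: "B.presents_form (snd \<circ> ?t) x ({..<n} \<times> {..<dM}) (\<lambda>(i, k) z. h i z * P i k (f z)) (\<lambda>(i, k) z. Q i k (f z))"
        and Rt': "B.presents_form (snd \<circ> ?t') x ({..<n'} \<times> {..<dM}) (\<lambda>(j, k) z. h' j z * P' j k (f z)) (\<lambda>(j, k) z. Q' j k (f z))"
        unfolding comp_def by (rule R, rule R')
      have iso: "v (h i) * h' j x * snd (a' j (f x)) (?Y i) + v (h i) * h' j x * snd (a i (f x)) (?Y' j) = 0"
        if "i < n" "j < n'" for i j
        using L_pairing[OF sections_L(1)[OF pD(2)[OF that(1)]] sections_L(1)[OF pD'(2)[OF that(2)]], of "f x"]
        by (simp add: distrib_left[symmetric] add.commute)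
      have "snd (courant B ?t ?t' x) v =
         (\<Sum>j<n'. \<Sum>k<dM. ?X (\<lambda>z. h' j z * P' j k (f z)) * v (\<lambda>z. Q' j k (f z)) +
            h' j x * P' j k (f x) * v (\<lambda>z. snd (s z) (\<lambda>z. Q' j k (f z)))) -
         (\<Sum>i<n. \<Sum>k<dM. ?X' (\<lambda>z. h i z * P i k (f z)) * v (\<lambda>z. Q i k (f z)) -
            v (\<lambda>z. h i z * P i k (f z)) * ?X' (\<lambda>z. Q i k (f z)))"
        using B.dorfman_presented[OF B.gen_sectionsD[OF gen(1)] B.gen_sectionsD[OF gen(2)] v Rt Rt']
        unfolding B.courant_eq snd_conv by (simp add: comp_def sum.cartesian_product split_def)
      also have "\<dots> = (\<Sum>j<n'. ?X (h' j) * snd (a' j (f x)) ?V + (\<Sum>i<n. h i x * h' j x * Aij i j + v (h i) * h' j x * snd (a' j (f x)) (?Y i)))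
         - (\<Sum>i<n. ?X' (h i) * snd (a i (f x)) ?V + (\<Sum>j<n'. h i x * h' j x * Cij i j - v (h i) * h' j x * snd (a i (f x)) (?Y' j)))"
        using T1 T2 by simp
      also have "\<dots> = (\<Sum>j<n'. ?X (h' j) * snd (a' j (f x)) ?V) - (\<Sum>i<n. ?X' (h i) * snd (a i (f x)) ?V)
         + (\<Sum>i<n. \<Sum>j<n'. h i x * h' j x * (Aij i j - Cij i j)
             + (v (h i) * h' j x * snd (a' j (f x)) (?Y i) + v (h i) * h' j x * snd (a i (f x)) (?Y' j)))"
        unfolding sum.distrib sum_subtractf right_diff_distrib
        by (simp add: sum.swap[of _ "{..<n'}" "{..<n}"])
      also have "\<dots> = (\<Sum>j<n'. ?X (h' j) * snd (a' j (f x)) ?V) - (\<Sum>i<n. ?X' (h i) * snd (a i (f x)) ?V)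
         + (\<Sum>i<n. \<Sum>j<n'. h i x * h' j x * snd (courant M (a i) (a' j) (f x)) ?V)"
        using iso D by simp
      also have "\<dots> = snd (fst ?w) ?V"
        by (simp add: local_bracket_def snd_sum fun_apply)
      finally show ?thesis by (simp add: pb_apply[OF v])
    qed
  qed
  then show ?thesis
    unfolding forget_def[of x ?w] by (simp add: prod_eq_iff B.courant_eq fst_t) (simp add: local_bracket_def)
qed

lemma pullback_bracket_forget:
  assumes s: "s \<in> PS" and s': "s' \<in> PS"
  shows "pullback_bracket B f A s s' x \<in> PF x"
    and "forget x (pullback_bracket B f A s s' x) = courant B (\<lambda>z. forget z (s z)) (\<lambda>z. forget z (s' z)) x"
proof -
  obtain n h a where p: "presented_near B A f x (fst \<circ> s) n h a" using PSD(3)[OF s] by blast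
  obtain n' h' a' where p': "presented_near B A f x (fst \<circ> s') n' h' a'" using PSD(3)[OF s'] by blast
  let ?w = "local_bracket s s' x n h a n' h' a'"
  have "pullback_bracket B f A s s' x = (THE w. \<exists>n h a n' h' a'. presented_near B A f x (fst \<circ> s) n h a \<and>
       presented_near B A f x (fst \<circ> s') n' h' a' \<and> w = local_bracket s s' x n h a n' h' a')"
    by (simp add: pullback_bracket_def local_bracket_def dirac_algebroid_def)
  also have "\<dots> = ?w"
  proof (rule the_equality)
    show "\<exists>na ha aa n'a h'a a'a. presented_near B A f x (fst \<circ> s) na ha aa \<and>
       presented_near B A f x (fst \<circ> s') n'a h'a a'a \<and> ?w = local_bracket s s' x na ha aa n'a h'a a'a"
      using p p' by blast
    fix w assume "\<exists>n h a n' h' a'. presented_near B A f x (fst \<circ> s) n h a \<and>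
       presented_near B A f x (fst \<circ> s') n' h' a' \<and> w = local_bracket s s' x n h a n' h' a'"
    then obtain n1 h1 a1 n2 h2 a2 where q: "presented_near B A f x (fst \<circ> s) n1 h1 a1"
      "presented_near B A f x (fst \<circ> s') n2 h2 a2" "w = local_bracket s s' x n1 h1 a1 n2 h2 a2" by blast
    show "w = ?w" unfolding q(3)
      by (rule forget_inj[OF local_bracket_PF[OF s s' q(1,2)] local_bracket_PF[OF s s' p p']])
        (simp add: forget_local_bracket[OF s s' q(1,2)] forget_local_bracket[OF s s' p p'])
  qed
  finally have eq: "pullback_bracket B f A s s' x = ?w" .
  show "pullback_bracket B f A s s' x \<in> PF x" unfolding eq by (rule local_bracket_PF[OF s s' p p'])
  show "forget x (pullback_bracket B f A s s' x) = courant B (\<lambda>z. forget z (s z)) (\<lambda>z. forget z (s' z)) x"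
    unfolding eq by (rule forget_local_bracket[OF s s' p p'])
qed

section \<open>Smooth sections of the pullback Dirac structure and their lifts\<close>

lemma BL_sectionD:
  assumes "s \<in> dirac_sections B BL"
  shows "s x \<in> BL x" "g \<in> Cinf B \<Longrightarrow> (\<lambda>z. fst (s z) g) \<in> Cinf B"
    "Z \<in> vfields B \<Longrightarrow> (\<lambda>z. snd (s z) (Z z)) \<in> Cinf B" "s \<in> gen_sections B"
proof -
  show g: "s \<in> gen_sections B" and "s x \<in> BL x" using assms by (simp_all add: dirac_sections_def)
  show "g \<in> Cinf B \<Longrightarrow> (\<lambda>z. fst (s z) g) \<in> Cinf B"
    using B.vfieldsD(2)[OF B.gen_sectionsD(1)[OF g]] by (simp add: comp_def)
  show "Z \<in> vfields B \<Longrightarrow> (\<lambda>z. snd (s z) (Z z)) \<in> Cinf B"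
    using B.formsD(2)[OF B.gen_sectionsD(2)[OF g]] by (simp add: comp_def)
qed

text \<open>A vector is determined by its values on the coordinate functions and a covector by its
  values on the coordinate fields; the flag in the index selects the kind of test.\<close>

lemma BL_separated: "B.smoothly_separated BL (dirac_sections B BL)"
  unfolding B.smoothly_separated_def
proof
  fix x
  obtain U y E where c: "B.coordinates_on U y E" "x \<in> U" by (rule B.coordinates_exist)
  note cD = B.coordinates_onD[OF c(1)]
  define l :: "bool \<times> nat \<Rightarrow> 'b \<Rightarrow> 'b tvec \<times> 'b cotvec \<Rightarrow> real"
    where "l k z u = (if fst k then fst u (y (snd k)) else snd u (E (snd k) z))" for k z u
  have "linear (l k z)" for k z by (rule linearI) (simp_all add: l_def fun_apply)
  moreover have "B.smooth_at (\<lambda>z. l k z (s z)) x" if "snd k < dB" "s \<in> dirac_sections B BL" for k s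
    using BL_sectionD(2)[OF that(2) cD(2)[OF that(1)]] BL_sectionD(3)[OF that(2) cD(3)[OF that(1)]]
    by (cases "fst k") (simp_all add: l_def B.Cinf_smooth_at)
  moreover have "u = 0" if u: "u \<in> BL x" and 0: "\<forall>k\<in>UNIV \<times> {..<dB}. l k x u = 0" for u
  proof -
    have t: "fst u \<in> tangent B x" "snd u \<in> cotangent B x" using u BL_gen[of x] by (auto simp: gen_tangent_def)
    have y0: "fst u (y k) = 0" and E0: "snd u (E k x) = 0" if "k < dB" for k
      using 0[rule_format, of "(True, k)"] 0[rule_format, of "(False, k)"] that by (simp_all add: l_def)
    have "fst u = (\<Sum>k<dB. fst u (y k) *\<^sub>R E k x)" by (rule B.tangent_expand[OF c t(1)])
    also have "\<dots> = 0" by (rule sum.neutral) (simp add: y0)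
    finally have "fst u = 0" .
    moreover have "snd u v = 0" for v
    proof (cases "v \<in> tangent B x")
      case True
      have "snd u v = snd u (\<Sum>k<dB. v (y k) *\<^sub>R E k x)" using B.tangent_expand[OF c True] by simp
      also have "\<dots> = (\<Sum>k<dB. v (y k) * snd u (E k x))"
        by (rule B.cotangent_sum[OF t(2) B.vfieldsD(1)[OF cD(3)]]) simp
      finally show ?thesis by (simp add: E0)
    qed (rule B.cotangent_outside[OF t(2)])
    then have "snd u = 0" by (simp add: fun_eq_iff fun_apply)
    ultimately show "u = 0" by (simp add: prod_eq_iff)
  qed
  ultimately show "\<exists>(K::(bool \<times> nat) set) l.
     (\<forall>k\<in>K. (\<forall>z. linear (l k z)) \<and> (\<forall>s\<in>dirac_sections B BL. B.smooth_at (\<lambda>z. l k z (s z)) x)) \<and>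
     (\<forall>u\<in>BL x. (\<forall>k\<in>K. l k x u = 0) \<longrightarrow> u = 0)"
    by (intro exI[of _ "UNIV \<times> {..<dB}"] exI[of _ l]) auto
qed

text \<open>Smoothness of a generalised section means smoothness of all its evaluations on functions
  and on vector fields. Each evaluation is linear in the fibre, so it passes to local combinations
  with smooth coefficients.\<close>

lemma dirac_sections_local:
  fixes r :: nat
  assumes s: "\<And>x. s x \<in> BL x"
    and loc: "\<And>x. \<exists>e c. (\<forall>i<r. e i \<in> dirac_sections B BL \<and> c i \<in> Cinf B) \<and>
      eventually (\<lambda>z. s z = (\<Sum>i<r. c i z *\<^sub>R e i z)) (nhds x)"
  shows "s \<in> dirac_sections B BL"
proof -
  have t: "fst (s x) \<in> tangent B x" "snd (s x) \<in> cotangent B x" for x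
    using s[of x] BL_gen[of x] by (auto simp: gen_tangent_def)
  have smooth: "(\<lambda>z. l z (s z)) \<in> Cinf B"
    if lin: "\<And>z. linear (l z)" and l: "\<And>e. e \<in> dirac_sections B BL \<Longrightarrow> (\<lambda>z. l z (e z)) \<in> Cinf B" for l
  proof (rule B.CinfI)
    fix x
    obtain e c where ec: "\<And>i. i < r \<Longrightarrow> e i \<in> dirac_sections B BL" "\<And>i. i < r \<Longrightarrow> c i \<in> Cinf B"
      "eventually (\<lambda>z. s z = (\<Sum>i<r. c i z *\<^sub>R e i z)) (nhds x)" using loc[of x] by auto
    have ev: "eventually (\<lambda>z. l z (s z) = (\<Sum>i<r. c i z * l z (e i z))) (nhds x)"
      using ec(3) by eventually_elim (simp add: linear_sum[OF lin] linear_cmul[OF lin])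
    have "B.smooth_at (\<lambda>z. \<Sum>i<r. c i z * l z (e i z)) x"
      by (intro B.smooth_at_sum B.Cinf_smooth_at B.Cinf_mult ec l) simp_all
    then show "B.smooth_at (\<lambda>z. l z (s z)) x" unfolding B.smooth_at_cong[OF ev] .
  qed
  have "fst \<circ> s \<in> vfields B"
  proof (rule B.vfieldsI)
    show "(fst \<circ> s) x \<in> tangent B x" for x using t by simp
    show "(\<lambda>x. (fst \<circ> s) x g) \<in> Cinf B" if "g \<in> Cinf B" for g
      unfolding comp_def
      by (rule smooth) (auto intro!: linearI simp: fun_apply BL_sectionD(2)[OF _ that])
  qed
  moreover have "snd \<circ> s \<in> forms B"
  proof (rule B.formsI)
    show "(snd \<circ> s) x \<in> cotangent B x" for x using t by simp
    show "(\<lambda>x. (snd \<circ> s) x (Z x)) \<in> Cinf B" if "Z \<in> vfields B" for Z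
      unfolding comp_def
      by (rule smooth) (auto intro!: linearI simp: fun_apply BL_sectionD(3)[OF _ that])
  qed
  ultimately show ?thesis using s by (simp add: dirac_sections_def gen_sections_def)
qed

lemma forget_sum: "forget x (\<Sum>i\<in>I. c i *\<^sub>R u i) = (\<Sum>i\<in>I. c i *\<^sub>R forget x (u i))"
  by (simp add: linear_sum[OF linear_forget] linear_cmul[OF linear_forget])

lemma forget_frame:
  assumes e: "local_frame PF PS r U e"
  shows "local_frame BL (dirac_sections B BL) r U (\<lambda>i z. forget z (e i z))"
  unfolding local_frame_iff
proof (intro conjI ballI allI impI)
  note eD = local_frameD[OF e]
  show "open U" by (rule eD(1))
  show "(\<lambda>z. forget z (e i z)) \<in> dirac_sections B BL" if "i < r" for i
    by (rule forget_section[OF eD(2)[OF that]])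
  fix x assume x: "x \<in> U"
  show "c i = 0" if 0: "(\<Sum>i<r. c i *\<^sub>R forget x (e i x)) = 0" and i: "i < r" for c i
  proof -
    have "(\<Sum>i<r. c i *\<^sub>R e i x) = 0"
    proof (rule forget_kernel)
      show "(\<Sum>i<r. c i *\<^sub>R e i x) \<in> PF x" unfolding eD(4)[OF x] by (rule rangeI)
      show "forget x (\<Sum>i<r. c i *\<^sub>R e i x) = 0" unfolding forget_sum by (rule 0)
    qed
    then show ?thesis by (rule eD(3)[OF x _ i])
  qed
  show "BL x = range (\<lambda>c. \<Sum>i<r. c i *\<^sub>R forget x (e i x))"
    unfolding forget_image[symmetric] eD(4)[OF x] image_image forget_sum ..
qed

lemma L_frames: "\<exists>rL. \<forall>y. \<exists>U a. y \<in> U \<and> local_frame L (dirac_sections M L) rL U a"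
  using L unfolding dirac_structure_def vector_bundle_def by (elim conjE exE, intro exI)

text \<open>In the image frame the section t has smooth coefficients, and by injectivity its lift
  has the same coefficients in the frame e. Each \<open>e i\<close> is presented by the family
  \<open>a\<close>, so collecting terms yields a presentation of the lift.\<close>

lemma lift_section:
  assumes t: "t \<in> dirac_sections B BL"
  shows "(\<lambda>x. lift x (t x)) \<in> PS"
  unfolding pullback_sections_def
proof (intro CollectI conjI allI)
  show lPF: "lift x (t x) \<in> PF x" for x by (rule lift_PF[OF BL_sectionD(1)[OF t]])
  have fl: "forget x (lift x (t x)) = t x" for x by (rule forget_lift[OF BL_sectionD(1)[OF t]])
  have "snd (lift x (t x)) = fst (t x)" for x using arg_cong[OF fl[of x], of fst] by simp
  then show "snd \<circ> (\<lambda>x. lift x (t x)) \<in> vfields B"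
    using B.gen_sectionsD(1)[OF BL_sectionD(4)[OF t]] by (simp add: comp_def)
  fix x
  obtain rL where "\<forall>y. \<exists>U a. y \<in> U \<and> local_frame L (dirac_sections M L) rL U a"
    using L_frames by (elim exE)
  note rL = this[THEN spec]
  let ?r = "rL + dB - dM"
  obtain U e a where x: "x \<in> U" and e: "local_frame PF PS ?r U e" and a: "\<And>j. j < rL \<Longrightarrow> a j \<in> dirac_sections M L"
    and ea: "\<forall>i<?r. \<exists>h. (\<forall>j<rL. h j \<in> Cinf B) \<and> (\<forall>z. fst (e i z) = (\<Sum>j<rL. h j z *\<^sub>R a j (f z)))"
    using PF_frame(2)[OF rL, of x] by blast
  define H where "H i h \<longleftrightarrow> (\<forall>j<rL. h j \<in> Cinf B) \<and> (\<forall>z. fst (e i z) = (\<Sum>j<rL. h j z *\<^sub>R a j (f z)))" for i h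
  have "\<forall>i<?r. \<exists>h. H i h" unfolding H_def by (rule ea)
  then obtain h where "\<forall>i<?r. H i (h i)" by metis
  then have h: "\<And>i j. i < ?r \<Longrightarrow> j < rL \<Longrightarrow> h i j \<in> Cinf B"
    "\<And>i z. i < ?r \<Longrightarrow> fst (e i z) = (\<Sum>j<rL. h i j z *\<^sub>R a j (f z))" by (simp_all add: H_def)
  have sub: "\<forall>s\<in>dirac_sections B BL. \<forall>x. s x \<in> BL x" using BL_sectionD(1) by blast
  obtain c where c: "\<And>i. i < ?r \<Longrightarrow> c i \<in> Cinf_on B U"
    "\<And>z. z \<in> U \<Longrightarrow> t z = (\<Sum>i<?r. c i z *\<^sub>R forget z (e i z))"
    by (rule B.frame_coefficients[OF sub BL_separated t forget_frame[OF e]]) blast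
  have oU: "open U" by (rule local_frameD(1)[OF e])
  have "\<exists>k\<in>Cinf B. eventually (\<lambda>z. k z = c i z) (nhds x)" if "i < ?r" for i
    by (rule B.smooth_at_extend[OF B.smooth_atI[OF oU x c(1)[OF that]]]) (rule bexI)
  then obtain k where k: "\<And>i. i < ?r \<Longrightarrow> k i \<in> Cinf B" "\<And>i. i < ?r \<Longrightarrow> eventually (\<lambda>z. k i z = c i z) (nhds x)"
    by metis
  have "eventually (\<lambda>z. \<forall>i\<in>{..<?r}. k i z = c i z) (nhds x)" using k(2) by (intro eventually_ball_finite) auto
  moreover have "eventually (\<lambda>z. z \<in> U) (nhds x)" by (rule eventually_nhds_in_open[OF oU x])
  ultimately have ev: "eventually (\<lambda>z. fst (lift z (t z)) = (\<Sum>j<rL. (\<Sum>i<?r. k i z * h i j z) *\<^sub>R a j (f z))) (nhds x)"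
  proof eventually_elim
    case (elim z)
    have "lift z (t z) = (\<Sum>i<?r. c i z *\<^sub>R e i z)"
    proof (rule forget_inj[OF lPF])
      show "(\<Sum>i<?r. c i z *\<^sub>R e i z) \<in> PF z" unfolding local_frameD(4)[OF e elim(2)] by (rule rangeI)
      show "forget z (lift z (t z)) = forget z (\<Sum>i<?r. c i z *\<^sub>R e i z)"
        unfolding fl forget_sum by (rule c(2)[OF elim(2)])
    qed
    then have "fst (lift z (t z)) = (\<Sum>i<?r. k i z *\<^sub>R (\<Sum>j<rL. h i j z *\<^sub>R a j (f z)))"
      using elim(1) by (simp add: fst_sum h(2))
    also have "\<dots> = (\<Sum>i<?r. \<Sum>j<rL. (k i z * h i j z) *\<^sub>R a j (f z))" by (simp add: scaleR_sum_right)
    also have "\<dots> = (\<Sum>j<rL. \<Sum>i<?r. (k i z * h i j z) *\<^sub>R a j (f z))" by (rule sum.swap)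
    finally show ?case by (simp add: scaleR_sum_left)
  qed
  show "\<exists>n h a. presented_near B A f x (fst \<circ> (\<lambda>x. lift x (t x))) n h a"
  proof (intro exI)
    have "(\<lambda>z. \<Sum>i<?r. k i z * h i j z) \<in> Cinf B" if "j < rL" for j
      by (intro B.Cinf_sum ballI B.Cinf_mult k(1) h(1) that) simp_all
    then show "presented_near B A f x (fst \<circ> (\<lambda>x. lift x (t x))) rL (\<lambda>j z. \<Sum>i<?r. k i z * h i j z) a"
      unfolding presented_near_def using a ev by (auto simp: dirac_algebroid_def eventually_nhds)
  qed
qed

text \<open>The two notions of smooth section agree. Closure properties of \<open>PS\<close>, for
  instance under sums, can thus be taken from \<open>BL\<close> without manipulating
  presentations.\<close>

lemma PS_iff: "s \<in> PS \<longleftrightarrow> (\<forall>x. s x \<in> PF x) \<and> (\<lambda>x. forget x (s x)) \<in> dirac_sections B BL"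
proof
  assume "s \<in> PS"
  then show "(\<forall>x. s x \<in> PF x) \<and> (\<lambda>x. forget x (s x)) \<in> dirac_sections B BL"
    using PSD(1) forget_section by blast
next
  assume s: "(\<forall>x. s x \<in> PF x) \<and> (\<lambda>x. forget x (s x)) \<in> dirac_sections B BL"
  then have "(\<lambda>x. lift x (forget x (s x))) \<in> PS" using lift_section by blast
  moreover have "(\<lambda>x. lift x (forget x (s x))) = s" using s lift_forget by (simp add: fun_eq_iff)
  ultimately show "s \<in> PS" by simp
qed

text \<open>That the Courant bracket is smooth is general; the point is that it stays in the fibres,
  and at each x it is the image under \<open>forget\<close> of the bracket of the two lifts.\<close>

lemma BL_involutive:
  assumes s: "s \<in> dirac_sections B BL" and t: "t \<in> dirac_sections B BL"
  shows "courant B s t \<in> dirac_sections B BL"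
proof -
  let ?s = "\<lambda>x. lift x (s x)" and ?t = "\<lambda>x. lift x (t x)"
  have eq: "(\<lambda>x. forget x (?s x)) = s" "(\<lambda>x. forget x (?t x)) = t"
    by (simp_all add: fun_eq_iff forget_lift BL_sectionD(1)[OF s] BL_sectionD(1)[OF t])
  have "courant B s t x \<in> BL x" for x
    using forget_BL[OF pullback_bracket_forget(1)[OF lift_section[OF s] lift_section[OF t], of x]]
    unfolding pullback_bracket_forget(2)[OF lift_section[OF s] lift_section[OF t]] eq .
  then show ?thesis
    using B.courant_gen_sections[OF BL_sectionD(4)[OF s] BL_sectionD(4)[OF t]] by (simp add: dirac_sections_def)
qed

section \<open>The two Lie algebroids and their isomorphism\<close>

lemma lie_algebroid_BL: "lie_algebroid B (dirac_algebroid B BL)"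
proof (rule B.dirac_lie_algebroid[OF _ BL_gen BL_isotropic BL_involutive])
  obtain rL where "\<forall>y. \<exists>U a. y \<in> U \<and> local_frame L (dirac_sections M L) rL U a"
    using L_frames by (elim exE)
  note rL = this[THEN spec]
  show "vector_bundle B BL (dirac_sections B BL)"
  proof (rule B.vector_bundle_criterion[OF _ _ BL_separated])
    show "\<exists>U e. x \<in> U \<and> local_frame BL (dirac_sections B BL) (rL + dB - dM) U e" for x
      using PF_frame(2)[OF rL, of x] forget_frame by blast
    show "s x \<in> BL x" if "s \<in> dirac_sections B BL" for s x by (rule BL_sectionD(1)[OF that])
  qed (rule dirac_sections_local)
qed

text \<open>The functionals of \<open>BL\<close> composed with \<open>forget\<close> serve for the
  pullback: they still separate by injectivity, and they are smooth along \<open>PS\<close> because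
  \<open>forget\<close> takes it to smooth sections of \<open>BL\<close>.\<close>

lemma PF_vector_bundle: "vector_bundle B PF PS"
proof -
  obtain rL where "\<forall>y. \<exists>U a. y \<in> U \<and> local_frame L (dirac_sections M L) rL U a"
    using L_frames by (elim exE)
  note rL = this[THEN spec]
  let ?r = "rL + dB - dM"
  show ?thesis
  proof (rule B.vector_bundle_criterion)
    show "\<exists>U e. x \<in> U \<and> local_frame PF PS ?r U e" for x
      using PF_frame(2)[OF rL, of x] by blast
    show "s x \<in> PF x" if "s \<in> PS" for s x by (rule PSD(1)[OF that])
    show "B.smoothly_separated PF PS"
      unfolding B.smoothly_separated_def
    proof
      fix x
      obtain K :: "(bool \<times> nat) set" and l where
        l: "(\<forall>k\<in>K. (\<forall>z. linear (l k z)) \<and> (\<forall>s\<in>dirac_sections B BL. B.smooth_at (\<lambda>z. l k z (s z)) x)) \<and>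
         (\<forall>u\<in>BL x. (\<forall>k\<in>K. l k x u = 0) \<longrightarrow> u = 0)"
        using BL_separated[unfolded B.smoothly_separated_def, rule_format, of x] by (elim exE)
      have "linear (\<lambda>u. l k z (forget z u))" if "k \<in> K" for k z
        using linear_compose[OF linear_forget[of z], of "l k z"] l that by (simp add: comp_def)
      moreover have "B.smooth_at (\<lambda>z. l k z (forget z (s z))) x" if "k \<in> K" "s \<in> PS" for k s
        using l[THEN conjunct1, rule_format, OF that(1), THEN conjunct2, rule_format, OF forget_section[OF that(2)]] .
      moreover have "u = 0" if "u \<in> PF x" "\<forall>k\<in>K. l k x (forget x u) = 0" for u
        using l[THEN conjunct2, rule_format, OF forget_BL[OF that(1)]] that(2) forget_kernel[OF that(1)] by simp
      ultimately show "\<exists>(K::(bool \<times> nat) set) l.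
         (\<forall>k\<in>K. (\<forall>z. linear (l k z)) \<and> (\<forall>s\<in>PS. B.smooth_at (\<lambda>z. l k z (s z)) x)) \<and>
         (\<forall>u\<in>PF x. (\<forall>k\<in>K. l k x u = 0) \<longrightarrow> u = 0)"
        by (intro exI[of _ K] exI[of _ "\<lambda>k z u. l k z (forget z u)"]) simp
    qed
    fix s assume s: "\<And>x. s x \<in> PF x" and loc: "\<And>x. \<exists>e c. (\<forall>i<?r. e i \<in> PS \<and> c i \<in> Cinf B) \<and>
        eventually (\<lambda>z. s z = (\<Sum>i<?r. c i z *\<^sub>R e i z)) (nhds x)"
    have "(\<lambda>x. forget x (s x)) \<in> dirac_sections B BL"
    proof (rule dirac_sections_local)
      show "forget x (s x) \<in> BL x" for x by (rule forget_BL[OF s])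
      fix x
      obtain e c where ec: "\<forall>i<?r. e i \<in> PS \<and> c i \<in> Cinf B" "eventually (\<lambda>z. s z = (\<Sum>i<?r. c i z *\<^sub>R e i z)) (nhds x)"
        using loc[of x] by blast
      have "eventually (\<lambda>z. forget z (s z) = (\<Sum>i<?r. c i z *\<^sub>R forget z (e i z))) (nhds x)"
        using ec(2) by eventually_elim (simp add: forget_sum)
      then show "\<exists>e c. (\<forall>i<?r. e i \<in> dirac_sections B BL \<and> c i \<in> Cinf B) \<and>
          eventually (\<lambda>z. forget z (s z) = (\<Sum>i<?r. c i z *\<^sub>R e i z)) (nhds x)"
        using ec(1) forget_section by (intro exI[of _ "\<lambda>i z. forget z (e i z)"] exI[of _ c]) simp
    qed
    then show "s \<in> PS" using s PS_iff by simp
  qed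
qed

lemma lie_algebroid_PF: "lie_algebroid B (pullback_algebroid B M f A)"
proof -
  let ?b = "pullback_bracket B f A" and ?F = "\<lambda>s x. forget x (s x)"
  note bl = lie_algebroid_BL[unfolded lie_algebroid_def dirac_algebroid_def lie_algebroid_data.simps]
  have b_PF: "?b s t x \<in> PF x" and b_forget: "?F (?b s t) = courant B (?F s) (?F t)" if "s \<in> PS" "t \<in> PS" for s t x
    using pullback_bracket_forget[OF that] by (simp_all add: fun_eq_iff)
  note fS = forget_section
  have closed: "?b s t \<in> PS" if "s \<in> PS" "t \<in> PS" for s t
    unfolding PS_iff using b_PF[OF that] b_forget[OF that] BL_involutive[OF fS fS, OF that] by simp
  \<comment> \<open>The transfer principle: an identity between sections with values in
    \<open>PF\<close> may be checked after \<open>forget\<close>, where it concerns the Courant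
    bracket on B. Both sides must first be known to lie in the fibres, hence the membership facts
    below.\<close>
  have eqI: "s = t" if s: "\<And>x. s x \<in> PF x" and t: "\<And>x. t x \<in> PF x" and st: "?F s = ?F t" for s t
  proof
    show "s x = t x" for x using fun_cong[OF st, of x] by (rule forget_inj[OF s t])
  qed
  have comb: "(\<lambda>x. g x *\<^sub>R s x + h x *\<^sub>R t x) \<in> PS" if "s \<in> PS" "t \<in> PS" "g \<in> Cinf B" "h \<in> Cinf B" for s t g h
  proof -
    have "?F (\<lambda>x. g x *\<^sub>R s x + h x *\<^sub>R t x) \<in> dirac_sections B BL"
      using dirac_sections_BL_comb[OF fS[OF that(1)] fS[OF that(2)] that(3,4)]
      by (simp add: linear_add[OF linear_forget] linear_cmul[OF linear_forget])
    then show ?thesis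
      unfolding PS_iff[of "\<lambda>x. g x *\<^sub>R s x + h x *\<^sub>R t x"]
      by (intro conjI allI subspace_add[OF subspace_PF] subspace_mul[OF subspace_PF]
          PSD(1)[OF that(1)] PSD(1)[OF that(2)])
  qed
  have Fadd: "?F (s + t) = ?F s + ?F t" and Fscale: "?F (a *\<^sub>R s) = a *\<^sub>R ?F s" and Fneg: "?F (- s) = - ?F s"
    and F0: "?F 0 = 0" for s t and a :: real
    by (simp_all add: fun_eq_iff fun_apply linear_add[OF linear_forget] linear_cmul[OF linear_forget]
        linear_neg[OF linear_forget] linear_0[OF linear_forget])
  have PFadd: "(s + t) x \<in> PF x" if "s x \<in> PF x" "t x \<in> PF x" for s t x
    using subspace_add[OF subspace_PF that] by (simp add: fun_apply)
  have PFscale: "(a *\<^sub>R s) x \<in> PF x" if "s x \<in> PF x" for s x and a :: real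
    using subspace_mul[OF subspace_PF that] by (simp add: fun_apply)
  have PFneg: "(- s) x \<in> PF x" if "s x \<in> PF x" for s x
    using subspace_neg[OF subspace_PF that] by (simp add: fun_apply)
  have PF0: "(0 :: 'b \<Rightarrow> _) x \<in> PF x" for x using subspace_0[OF subspace_PF] by (simp add: fun_apply)
  show ?thesis
    unfolding lie_algebroid_def pullback_algebroid_def lie_algebroid_data.simps
  proof (intro conjI)
    show "vector_bundle B PF PS" by (rule PF_vector_bundle)
    show "\<forall>x. linear_between (PF x) (tangent B x) snd" by (auto simp: linear_between_def PF_iff)
    show "\<forall>s\<in>PS. (\<lambda>x. snd (s x)) \<in> vfields B" using PSD(2) by (auto simp: comp_def)
    show "\<forall>s\<in>PS. \<forall>t\<in>PS. ?b s t \<in> PS" using closed by blast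
    show "\<forall>s\<in>PS. \<forall>t\<in>PS. \<forall>u\<in>PS. \<forall>a b. ?b (a *\<^sub>R s + b *\<^sub>R t) u = a *\<^sub>R ?b s u + b *\<^sub>R ?b t u"
    proof (intro ballI allI)
      fix s t u a b assume s: "s \<in> PS" and t: "t \<in> PS" and u: "u \<in> PS"
      have st: "a *\<^sub>R s + b *\<^sub>R t \<in> PS"
        using comb[OF s t B.Cinf_const B.Cinf_const, of a b] by (simp add: plus_fun_def scaleR_fun_def)
      show "?b (a *\<^sub>R s + b *\<^sub>R t) u = a *\<^sub>R ?b s u + b *\<^sub>R ?b t u"
      proof (rule eqI)
        show "?b (a *\<^sub>R s + b *\<^sub>R t) u x \<in> PF x" "(a *\<^sub>R ?b s u + b *\<^sub>R ?b t u) x \<in> PF x" for x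
          by (intro b_PF PFadd PFscale s t u st)+
        show "?F (?b (a *\<^sub>R s + b *\<^sub>R t) u) = ?F (a *\<^sub>R ?b s u + b *\<^sub>R ?b t u)"
          unfolding Fadd Fscale b_forget[OF st u] b_forget[OF s u] b_forget[OF t u]
          by (rule B.courant_comb) (intro BL_sectionD(4) fS s t u)+
      qed
    qed
    show "\<forall>s\<in>PS. \<forall>t\<in>PS. ?b s t = - ?b t s"
    proof (intro ballI)
      fix s t assume s: "s \<in> PS" and t: "t \<in> PS"
      show "?b s t = - ?b t s"
      proof (rule eqI)
        show "?b s t x \<in> PF x" "(- ?b t s) x \<in> PF x" for x by (intro b_PF PFneg s t)+
        show "?F (?b s t) = ?F (- ?b t s)"
          unfolding Fneg b_forget[OF s t] b_forget[OF t s] using bl fS[OF s] fS[OF t] by blast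
      qed
    qed
    show "\<forall>s\<in>PS. \<forall>t\<in>PS. \<forall>u\<in>PS. ?b s (?b t u) + ?b t (?b u s) + ?b u (?b s t) = 0"
    proof (intro ballI)
      fix s t u assume s: "s \<in> PS" and t: "t \<in> PS" and u: "u \<in> PS"
      show "?b s (?b t u) + ?b t (?b u s) + ?b u (?b s t) = 0"
      proof (rule eqI)
        show "(?b s (?b t u) + ?b t (?b u s) + ?b u (?b s t)) x \<in> PF x" for x
          by (intro PFadd b_PF closed s t u)
        show "0 x \<in> PF x" for x by (rule PF0)
        show "?F (?b s (?b t u) + ?b t (?b u s) + ?b u (?b s t)) = ?F 0"
          unfolding Fadd F0 b_forget[OF s closed[OF t u]] b_forget[OF t closed[OF u s]] b_forget[OF u closed[OF s t]]
            b_forget[OF s t] b_forget[OF t u] b_forget[OF u s]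
          using bl fS[OF s] fS[OF t] fS[OF u] by blast
      qed
    qed
    show "\<forall>s\<in>PS. \<forall>t\<in>PS. \<forall>h\<in>Cinf B. ?b s (\<lambda>x. h x *\<^sub>R t x) = (\<lambda>x. h x *\<^sub>R ?b s t x + snd (s x) h *\<^sub>R t x)"
    proof (intro ballI)
      fix s t h assume s: "s \<in> PS" and t: "t \<in> PS" and h: "h \<in> Cinf B"
      have ht: "(\<lambda>x. h x *\<^sub>R t x) \<in> PS" using comb[OF t t h B.Cinf_const[of 0]] by simp
      have F: "?F (\<lambda>x. h x *\<^sub>R t x) = (\<lambda>x. h x *\<^sub>R ?F t x)" by (simp add: linear_cmul[OF linear_forget])
      show "?b s (\<lambda>x. h x *\<^sub>R t x) = (\<lambda>x. h x *\<^sub>R ?b s t x + snd (s x) h *\<^sub>R t x)"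
      proof (rule eqI)
        show "?b s (\<lambda>x. h x *\<^sub>R t x) x \<in> PF x" for x by (rule b_PF[OF s ht])
        show "h x *\<^sub>R ?b s t x + snd (s x) h *\<^sub>R t x \<in> PF x" for x
          by (intro subspace_add[OF subspace_PF] subspace_mul[OF subspace_PF] b_PF PSD(1) s t)
        have "forget x (h x *\<^sub>R ?b s t x + snd (s x) h *\<^sub>R t x) = courant B (?F s) (\<lambda>x. h x *\<^sub>R ?F t x) x" for x
          unfolding B.courant_leibniz[OF BL_sectionD(4)[OF fS[OF s]] BL_sectionD(4)[OF fS[OF t]] h]
          by (simp add: linear_add[OF linear_forget] linear_cmul[OF linear_forget] fun_cong[OF b_forget[OF s t]])
        then show "?F (?b s (\<lambda>x. h x *\<^sub>R t x)) = ?F (\<lambda>x. h x *\<^sub>R ?b s t x + snd (s x) h *\<^sub>R t x)"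
          unfolding b_forget[OF s ht] F by (simp add: fun_eq_iff)
      qed
    qed
  qed
qed

lemma lift_iso: "lie_algebroid_iso B (dirac_algebroid B BL) (pullback_algebroid B M f A) lift"
proof -
  have lin: "linear_between (BL x) (PF x) (lift x)" for x
    unfolding linear_between_def
  proof (intro conjI ballI allI)
    show "lift x ` BL x \<subseteq> PF x" using lift_PF by blast
    fix u v a b assume u: "u \<in> BL x" and v: "v \<in> BL x"
    have "a *\<^sub>R u + b *\<^sub>R v = forget x (a *\<^sub>R lift x u + b *\<^sub>R lift x v)"
      by (simp add: linear_add[OF linear_forget] linear_cmul[OF linear_forget] forget_lift u v)
    then show "lift x (a *\<^sub>R u + b *\<^sub>R v) = a *\<^sub>R lift x u + b *\<^sub>R lift x v"
      by (simp only:) (intro lift_forget subspace_add[OF subspace_PF] subspace_mul[OF subspace_PF] lift_PF u v)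
  qed
  have br: "(\<lambda>x. lift x (courant B s t x)) = pullback_bracket B f A (\<lambda>x. lift x (s x)) (\<lambda>x. lift x (t x))"
    if s: "s \<in> dirac_sections B BL" and t: "t \<in> dirac_sections B BL" for s t
  proof
    fix x
    have eq: "(\<lambda>x. forget x (lift x (s x))) = s" "(\<lambda>x. forget x (lift x (t x))) = t"
      by (simp_all add: fun_eq_iff forget_lift BL_sectionD(1)[OF s] BL_sectionD(1)[OF t])
    note b = pullback_bracket_forget[OF lift_section[OF s] lift_section[OF t], of x, unfolded eq]
    show "lift x (courant B s t x) = pullback_bracket B f A (\<lambda>x. lift x (s x)) (\<lambda>x. lift x (t x)) x"
      unfolding b(2)[symmetric] by (rule lift_forget[OF b(1)])
  qed
  have anc: "snd (lift x u) = fst u" if "u \<in> BL x" for x u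
    using arg_cong[OF forget_lift[OF that], of fst] by simp
  have "lie_algebroid_hom (dirac_algebroid B BL) (pullback_algebroid B M f A) lift"
    unfolding lie_algebroid_hom_def dirac_algebroid_def[of B] pullback_algebroid_def lie_algebroid_data.simps
    using lin lift_section anc br by blast
  moreover have "lie_algebroid_hom (pullback_algebroid B M f A) (dirac_algebroid B BL) forget"
    unfolding lie_algebroid_hom_def dirac_algebroid_def[of B] pullback_algebroid_def lie_algebroid_data.simps
  proof (intro conjI allI ballI)
    show "linear_between (PF x) (BL x) (forget x)" for x
      using forget_BL by (auto simp: linear_between_def linear_add[OF linear_forget] linear_cmul[OF linear_forget])
    show "(\<lambda>x. forget x (s x)) \<in> dirac_sections B BL" if "s \<in> PS" for s by (rule forget_section[OF that])
    show "fst (forget x u) = snd u" for x u by simp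
    show "(\<lambda>x. forget x (pullback_bracket B f A s t x)) = courant B (\<lambda>x. forget x (s x)) (\<lambda>x. forget x (t x))"
      if "s \<in> PS" "t \<in> PS" for s t using pullback_bracket_forget(2)[OF that] by (rule ext)
  qed
  ultimately show ?thesis
    unfolding lie_algebroid_iso_def
  proof (intro conjI exI[of _ forget])
    show "\<forall>x. (\<forall>a\<in>fibre (dirac_algebroid B BL) x. forget x (lift x a) = a) \<and>
        (\<forall>a'\<in>fibre (pullback_algebroid B M f A) x. lift x (forget x a') = a')"
      by (simp add: dirac_algebroid_def[of B] pullback_algebroid_def forget_lift lift_forget)
  qed (rule lie_algebroid_BL lie_algebroid_PF | assumption)+
qed

end

text \<open>The second conjunct is the meaning of canonical: every element of a fibre of the
  pullback Dirac structure has the form (v, f^*eta) displayed there, so \<Phi> is determined on all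
  fibres.\<close>

theorem proposition4p1:
  fixes B :: "('b::{t2_space, second_countable_topology}, 'd::euclidean_space) manifold"
    and M :: "('m::{t2_space, second_countable_topology}, 'e::euclidean_space) manifold"
    and f :: "'b \<Rightarrow> 'm"
    and L :: "'m \<Rightarrow> ('m tvec \<times> 'm cotvec) set"
  assumes "smooth_manifold B"
    and "smooth_manifold M"
    and "smooth_map B M f"
    and "dirac_structure M L"
    and "transverse B M f L"
  shows "\<exists>\<Phi>. lie_algebroid_iso B
                (dirac_algebroid B (pullback_dirac B M f L))
                (pullback_algebroid B M f (dirac_algebroid M L)) \<Phi> \<and>
             (\<forall>x. \<forall>v\<in>tangent B x. \<forall>\<eta>\<in>cotangent M (f x).
                (pushforward M f v, \<eta>) \<in> L (f x) \<longrightarrow>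
                \<Phi> x (v, pullback_cov B M f x \<eta>) = ((pushforward M f v, \<eta>), v))"
proof -
  interpret dirac_pullback B M f L
    using assms by unfold_locales
  have "lift x (v, pb x \<eta>) = ((pf v, \<eta>), v)" if "v \<in> tangent B x" "(pf v, \<eta>) \<in> L (f x)" for x v \<eta>
  proof -
    have "((pf v, \<eta>), v) \<in> PF x" using that by (simp add: PF_iff)
    from lift_forget[OF this] show ?thesis by (simp add: forget_def)
  qed
  with lift_iso show ?thesis by blast
qed

end
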